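(* Let $F$ be a field of characteristic zero and $G$ a finite abelian group. For $g\in G\setminus\{1\}$ we have: 1) $\mathrm{Id}^{\sharp}(N_3^{\mathsf g})=\langle x_{1,1}^-,\ x_{1,g}x_{2,g},\ [x_{1,g}^+,x_{1,1}^+],\ x_{1,r}\rangle_{T_G^*}$, where $r$ ranges over $G\setminus\{1,g\}$ and $x_{i,s}$ (without sign) stands for each of $x_{i,s}^+$ and $x_{i,s}^-$; and $c_n^{\sharp}(N_3^{\mathsf g})=1+2n+2\binom n2$. 2) $\mathcal{X}_n(N_3^{\mathsf g})=(\chi_{((n)_{1^+})};\ \chi_{((n-1)_{1^+},(1)_{g^+})};\ 2\chi_{((n-1)_{1^+},(1)_{g^-})}+\chi_{((n-2,1)_{1^+},(1)_{g^-})})$. 3) $\mathcal{X}_n(A_2^{\mathsf g})=(\chi_{((n)_{1^+})};\ 2\chi_{((n-1)_{1^+},(1)_{g^+})};\ 2\chi_{((n-1)_{1^+},(1)_{g^-})})$. 4) $l_n^{\sharp}(A_2^{\mathsf g})=l_n^{\sharp}(N_3^{\mathsf g})=5$.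
   Context: **General setting.** $G$ is a finite abelian group of order $t$ with unit $1$. A $(G,* )$-algebra is an associative $F$-algebra $A=\bigoplus_{g\in G}A_g$ with $A_gA_h\subseteq A_{gh}$ and an involution $*$ with $A_g^*=A_g$ for all $g$; $A_g^{\pm}=\{a\in A_g:a^*=\pm a\}$. The free $(G,* )$-algebra $\mathcal F$ is the free associative algebra on variables $x_{i,g}^+$ and $x_{i,g}^-$ ($i\ge1$, $g\in G$), of degree $g$, with involution determined by $(x_{i,g}^{\pm})^*=\pm x_{i,g}^{\pm}$. A polynomial is a $(G,* )$-identity of $A$ if it vanishes whenever each $x_{i,g}^{\varepsilon}$ is replaced by an element of $A_g^{\varepsilon}$; $\mathrm{Id}^{\sharp}(A)$ is the set of these identities. A $T_G^*$-ideal is an ideal of $\mathcal F$ invariant under all endomorphisms of $\mathcal F$ that preserve the grading and commute with $*$ (and, as all ideals $\mathrm{Id}^{\sharp}(A)$ are, invariant under $*$); $\langle S\rangle_{T_G^*}$ is the $T_G^*$-ideal generated by $S$. $[a,b]=ab-ba$. **Codimension, cocharacter, colength.** $P_n^{\sharp}=\mathrm{span}_F\{w_{\sigma(1)}\cdots w_{\sigma(n)}:\sigma\in S_n,\ w_i\in\{x_{i,g}^+,x_{i,g}^-\},\ g\in G\}$, $c_n^{\sharp}(A)=\dim_FP_n^{\sharp}/(P_n^{\sharp}\cap\mathrm{Id}^{\sharp}(A))$. With $G=\{g_1=1,\dots,g_t\}$ and $\langle n\rangle=(n_1,\dots,n_{2t})$, $\sum n_i=n$, $P_{\langle n\rangle}$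 is the space of multilinear polynomials in $n_{2i-1}$ symmetric and $n_{2i}$ skew variables of degree $g_i$; $\chi_{\langle n\rangle}(A)$ is the character of the $S_{n_1}\times\cdots\times S_{n_{2t}}$-module $P_{\langle n\rangle}/(P_{\langle n\rangle}\cap\mathrm{Id}^{\sharp}(A))$ (each factor permutes the variables of one type). $l_n^{\sharp}(A)$ is the sum over all $\langle n\rangle$ with $\sum n_i=n$ of the number of irreducible constituents, with multiplicity, of $\chi_{\langle n\rangle}(A)$. The notation $\chi_{((\lambda)_{s^{\varepsilon}},(\mu)_{u^{\delta}},\dots)}$ denotes the irreducible character given by the outer tensor product in which $\lambda$ is the partition for the variables of degree $s$ and sign $\varepsilon$, $\mu$ the one for degree $u$ and sign $\delta$, etc., omitted partitions being empty. The equality $\mathcal{X}_n(A)=(\chi;\chi';\dots)$ means that the nonzero characters $\chi_{\langle n\rangle}(A)$, over all $\langle n\rangle$ with $\sum n_i=n$, are exactly the listed ones. **Algebras.** The reflection involution on a suitable subalgebra of upper triangular $m\times m$ matrices is $e_{ij}\mapsto e_{m-j+1,m-i+1}$. $N_3^{\mathsf g}=\mathrm{span}_F\{I_6,\ e_{23}+e_{45},\ e_{12}-e_{56},\ e_{13},\ e_{46}\}\subset UT_6(F)$ with the reflection involution and with $I_6,e_{23}+e_{45}$ of degree $1$ and $e_{12}-e_{56},e_{13},e_{46}$ of degree $g$ (the elementary grading induced by $(1,g,g,1,1,g)$). $A_2^{\mathsf g}=\mathrm{span}_F\{e_{11}+e_{44},e_{12},e_{34}\}\subset UT_4(F)$ with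 the reflection involution and with $e_{11}+e_{44}$ of degree $1$ and $e_{12},e_{34}$ of degree $g$ (elementary grading induced by $(1,g,1,g)$).
   Formalization: The range of n, left implicit, is made explicit: the codimension formula for n≥1, cocharacter and colength of N_3 for n≥3 (l_2(N_3)=4, and (n-2,1) is not a partition for n<3), those of A_2 for n≥2 (multiplicity 2 is impossible at n=1, where l_1=3). *)

theory Defs
  imports
    "HOL-Analysis.Finite_Cartesian_Product"
    "HOL-Combinatorics.Permutations"
    "HOL-Library.Poly_Mapping"
begin

text \<open>
  The finite abelian group \<open>G\<close> is a type of class \<open>{finite, ab_group_add}\<close>. It is written
  additively, so its unit is \<open>0\<close>.
\<close>


section \<open>Quotients of vector spaces\<close>

text \<open>
  \<open>B\<close> represents a finite basis of \<open>V/W\<close> (where \<open>W \<subseteq> V\<close>): modulo \<open>W\<close>, every vector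
  of \<open>V\<close> is a unique linear combination of \<open>B\<close>. The dimension and the trace below are meaningful
  when \<open>V/W\<close> is finite-dimensional (and \<open>T\<close> maps \<open>V\<close> to \<open>V\<close> and \<open>W\<close> to \<open>W\<close>).
\<close>

definition quot_combination ::
  "('f::field \<Rightarrow> 'v \<Rightarrow> 'v::ab_group_add) \<Rightarrow> 'v set \<Rightarrow> 'v set \<Rightarrow> 'v \<Rightarrow> ('v \<Rightarrow> 'f) \<Rightarrow> bool"
  where "quot_combination smul W B v c \<longleftrightarrow>
    (\<forall>b. b \<notin> B \<longrightarrow> c b = 0) \<and> v - (\<Sum>b\<in>B. smul (c b) b) \<in> W"

definition quot_basis ::
  "('f::field \<Rightarrow> 'v \<Rightarrow> 'v::ab_group_add) \<Rightarrow> 'v set \<Rightarrow> 'v set \<Rightarrow> 'v set \<Rightarrow> bool"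
  where "quot_basis smul V W B \<longleftrightarrow>
    finite B \<and> B \<subseteq> V \<and> (\<forall>v\<in>V. \<exists>!c. quot_combination smul W B v c)"

definition quot_dim ::
  "('f::field \<Rightarrow> 'v \<Rightarrow> 'v::ab_group_add) \<Rightarrow> 'v set \<Rightarrow> 'v set \<Rightarrow> nat"
  where "quot_dim smul V W = (THE d. \<exists>B. quot_basis smul V W B \<and> card B = d)"

definition quot_trace ::
  "('f::field \<Rightarrow> 'v \<Rightarrow> 'v::ab_group_add) \<Rightarrow> 'v set \<Rightarrow> 'v set \<Rightarrow> ('v \<Rightarrow> 'v) \<Rightarrow> 'f"
  where "quot_trace smul V W T =
    (let B = (SOME B. quot_basis smul V W B)
     in \<Sum>b\<in>B. (THE c. quot_combination smul W B (T b) c) b)"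


section \<open>Graded algebras with involution\<close>

datatype polarity = Plus | Minus

primrec pol_sign :: "polarity \<Rightarrow> 'a::ring_1"
  where
    "pol_sign Plus = 1"
  | "pol_sign Minus = - 1"

text \<open>Addition is that of the ambient type \<open>'a\<close>; the algebra itself is the sum of the \<open>hcomp g\<close>.\<close>

record ('a, 'f, 'g) gstar_alg =
  amult :: "'a \<Rightarrow> 'a \<Rightarrow> 'a"
  ascale :: "'f \<Rightarrow> 'a \<Rightarrow> 'a"
  hcomp :: "'g \<Rightarrow> 'a set"
  astar :: "'a \<Rightarrow> 'a"

definition acarrier :: "('a::ab_group_add, 'f, 'g::finite) gstar_alg \<Rightarrow> 'a set"
  where "acarrier A = {\<Sum>h\<in>UNIV. x h | x. \<forall>h. x h \<in> hcomp A h}"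

locale gstar_algebra =
  fixes A :: "('a::ab_group_add, 'f::field, 'g::{finite,ab_group_add}) gstar_alg"
  assumes scale: "vector_space (ascale A)"
    and comp_subspace: "module.subspace (ascale A) (hcomp A h)"
    and comp_direct: "\<lbrakk>\<And>h. x h \<in> hcomp A h; (\<Sum>h\<in>UNIV. x h) = 0\<rbrakk> \<Longrightarrow> x h = 0"
    and comp_mult: "\<lbrakk>a \<in> hcomp A h; b \<in> hcomp A k\<rbrakk> \<Longrightarrow> amult A a b \<in> hcomp A (h + k)"
    and comp_star: "a \<in> hcomp A h \<Longrightarrow> astar A a \<in> hcomp A h"
    and mult_assoc: "\<lbrakk>a \<in> acarrier A; b \<in> acarrier A; c \<in> acarrier A\<rbrakk> \<Longrightarrow>
      amult A (amult A a b) c = amult A a (amult A b c)"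
    and mult_add_left: "\<lbrakk>a \<in> acarrier A; b \<in> acarrier A; c \<in> acarrier A\<rbrakk> \<Longrightarrow>
      amult A (a + b) c = amult A a c + amult A b c"
    and mult_add_right: "\<lbrakk>a \<in> acarrier A; b \<in> acarrier A; c \<in> acarrier A\<rbrakk> \<Longrightarrow>
      amult A a (b + c) = amult A a b + amult A a c"
    and mult_scale_left: "\<lbrakk>a \<in> acarrier A; b \<in> acarrier A\<rbrakk> \<Longrightarrow>
      amult A (ascale A r a) b = ascale A r (amult A a b)"
    and mult_scale_right: "\<lbrakk>a \<in> acarrier A; b \<in> acarrier A\<rbrakk> \<Longrightarrow>
      amult A a (ascale A r b) = ascale A r (amult A a b)"
    and star_add: "\<lbrakk>a \<in> acarrier A; b \<in> acarrier A\<rbrakk> \<Longrightarrow>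
      astar A (a + b) = astar A a + astar A b"
    and star_scale: "a \<in> acarrier A \<Longrightarrow> astar A (ascale A r a) = ascale A r (astar A a)"
    and star_mult: "\<lbrakk>a \<in> acarrier A; b \<in> acarrier A\<rbrakk> \<Longrightarrow>
      astar A (amult A a b) = amult A (astar A b) (astar A a)"
    and star_star: "a \<in> acarrier A \<Longrightarrow> astar A (astar A a) = a"

definition signed_comp ::
  "('a::ab_group_add, 'f, 'g) gstar_alg \<Rightarrow> 'g \<Rightarrow> polarity \<Rightarrow> 'a set"
  where "signed_comp A h e =
    {a \<in> hcomp A h. astar A a = (case e of Plus \<Rightarrow> a | Minus \<Rightarrow> - a)}"


section \<open>The free algebra\<close>

text \<open>\<open>X i h e\<close> is the variable of index \<open>i + 1\<close>, degree \<open>h\<close> and sign \<open>e\<close>.\<close>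

datatype 'g gvar = X (index: nat) (degree: 'g) (pol: polarity)

text \<open>Words with concatenation, so that \<open>*\<close> on finitely supported functions on words is the
  product of noncommutative polynomials.\<close>

instantiation list :: (type) monoid_add
begin

definition zero_list :: "'a list" where "zero_list = []"

definition plus_list :: "'a list \<Rightarrow> 'a list \<Rightarrow> 'a list" where "plus_list = (@)"

instance by standard (simp_all add: zero_list_def plus_list_def)

end

type_synonym ('g, 'f) gpoly = "'g gvar list \<Rightarrow>\<^sub>0 'f"

definition pm_scale :: "'f \<Rightarrow> ('k \<Rightarrow>\<^sub>0 'f) \<Rightarrow> ('k \<Rightarrow>\<^sub>0 'f::field)"
  where "pm_scale c = Poly_Mapping.map ((*) c)"

definition pm_push :: "('k \<Rightarrow> 'l) \<Rightarrow> ('k \<Rightarrow>\<^sub>0 'f) \<Rightarrow> ('l \<Rightarrow>\<^sub>0 'f::field)"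
  where "pm_push f p = (\<Sum>k\<in>Poly_Mapping.keys p. Poly_Mapping.single (f k) (Poly_Mapping.lookup p k))"

definition var :: "nat \<Rightarrow> 'g \<Rightarrow> polarity \<Rightarrow> ('g, 'f::field) gpoly"
  where "var i h e = Poly_Mapping.single [X i h e] 1"

text \<open>Algebras need not be unital, so polynomials have no constant term: otherwise
  polynomials could not be evaluated in all algebras, and \<open>T\<close>-ideals of identities would not be
  closed under endomorphisms.\<close>

definition free_alg :: "('g, 'f::field) gpoly set"
  where "free_alg = {p. Poly_Mapping.lookup p [] = 0}"

definition free_comp :: "'g::ab_group_add \<Rightarrow> ('g, 'f::field) gpoly set"
  where "free_comp h = {p \<in> free_alg. \<forall>w\<in>Poly_Mapping.keys p. sum_list (map degree w) = h}"

definition free_star :: "('g, 'f) gpoly \<Rightarrow> ('g, 'f::field) gpoly"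
  where "free_star p =
    (\<Sum>w\<in>Poly_Mapping.keys p. Poly_Mapping.single (rev w)
      (prod_list (map (\<lambda>x. pol_sign (pol x)) w) * Poly_Mapping.lookup p w))"

definition commutator :: "'a::ring \<Rightarrow> 'a \<Rightarrow> 'a"
  where "commutator a b = a * b - b * a"

definition gstar_endo :: "(('g::ab_group_add, 'f::field) gpoly \<Rightarrow> ('g, 'f) gpoly) \<Rightarrow> bool"
  where "gstar_endo \<phi> \<longleftrightarrow>
    (\<forall>p\<in>free_alg. \<phi> p \<in> free_alg) \<and>
    (\<forall>p\<in>free_alg. \<forall>q\<in>free_alg. \<phi> (p + q) = \<phi> p + \<phi> q) \<and>
    (\<forall>c. \<forall>p\<in>free_alg. \<phi> (pm_scale c p) = pm_scale c (\<phi> p)) \<and>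
    (\<forall>p\<in>free_alg. \<forall>q\<in>free_alg. \<phi> (p * q) = \<phi> p * \<phi> q) \<and>
    (\<forall>h. \<forall>p\<in>free_comp h. \<phi> p \<in> free_comp h) \<and>
    (\<forall>p\<in>free_alg. \<phi> (free_star p) = free_star (\<phi> p))"

definition TGstar_ideal :: "('g::ab_group_add, 'f::field) gpoly set \<Rightarrow> bool"
  where "TGstar_ideal I \<longleftrightarrow>
    I \<subseteq> free_alg \<and> module.subspace pm_scale I \<and>
    (\<forall>p\<in>free_alg. \<forall>q\<in>I. p * q \<in> I \<and> q * p \<in> I) \<and>
    (\<forall>q\<in>I. free_star q \<in> I) \<and>
    (\<forall>\<phi>. gstar_endo \<phi> \<longrightarrow> (\<forall>q\<in>I. \<phi> q \<in> I))"

definition TGstar_generated :: "('g::ab_group_add, 'f::field) gpoly set \<Rightarrow> ('g, 'f) gpoly set"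
  where "TGstar_generated S = \<Inter>{I. TGstar_ideal I \<and> S \<subseteq> I}"


section \<open>Identities, codimensions, cocharacters and colengths\<close>

fun nonempty_prod :: "('a \<Rightarrow> 'a \<Rightarrow> 'a) \<Rightarrow> 'a list \<Rightarrow> 'a"
  where
    "nonempty_prod m [] = undefined"
  | "nonempty_prod m [x] = x"
  | "nonempty_prod m (x # y # xs) = m x (nonempty_prod m (y # xs))"

definition poly_eval ::
  "('a::ab_group_add, 'f::field, 'g) gstar_alg \<Rightarrow> ('g gvar \<Rightarrow> 'a) \<Rightarrow> ('g, 'f) gpoly \<Rightarrow> 'a"
  where "poly_eval A \<phi> p =
    (\<Sum>w\<in>Poly_Mapping.keys p. ascale A (Poly_Mapping.lookup p w) (nonempty_prod (amult A) (map \<phi> w)))"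

definition gstar_Id :: "('a::ab_group_add, 'f::field, 'g) gstar_alg \<Rightarrow> ('g, 'f) gpoly set"
  where "gstar_Id A = {p \<in> free_alg.
    \<forall>\<phi>. (\<forall>i h e. \<phi> (X i h e) \<in> signed_comp A h e) \<longrightarrow> poly_eval A \<phi> p = 0}"

definition multilin :: "nat \<Rightarrow> ('g, 'f::field) gpoly set"
  where "multilin n = module.span pm_scale
    {Poly_Mapping.single (map (\<lambda>k. w (\<sigma> k)) [0..<n]) 1 | w \<sigma>.
      (\<forall>i<n. index (w i) = i) \<and> \<sigma> permutes {..<n}}"

definition gstar_codim :: "nat \<Rightarrow> ('a::ab_group_add, 'f::field, 'g) gstar_alg \<Rightarrow> nat"
  where "gstar_codim n A = quot_dim pm_scale (multilin n) (multilin n \<inter> gstar_Id A)"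

text \<open>
  The tuples \<open>\<langle>n\<rangle>\<close>, the elements of the group \<open>S\<^bsub>\<langle>n\<rangle>\<^esub>\<close> and multipartitions are
  functions on the variable types (degree, sign).
\<close>

type_synonym 'g vtype = "'g \<times> polarity"

definition multilin_typed :: "('g vtype \<Rightarrow> nat) \<Rightarrow> ('g, 'f::field) gpoly set"
  where "multilin_typed nn = module.span pm_scale
    {Poly_Mapping.single w 1 | w. distinct w \<and> set w = {X i h e | i h e. i < nn (h, e)}}"

definition young_group :: "('g vtype \<Rightarrow> nat) \<Rightarrow> ('g vtype \<Rightarrow> nat \<Rightarrow> nat) set"
  where "young_group nn = {\<sigma>. \<forall>\<tau>. \<sigma> \<tau> permutes {..<nn \<tau>}}"

definition rename :: "('g vtype \<Rightarrow> nat \<Rightarrow> nat) \<Rightarrow> ('g, 'f) gpoly \<Rightarrow> ('g, 'f::field) gpoly"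
  where "rename \<sigma> = pm_push (map (\<lambda>x. X (\<sigma> (degree x, pol x) (index x)) (degree x) (pol x)))"

text \<open>Characters are extended by \<open>0\<close> outside the group, so that they can be compared as functions.\<close>

definition gstar_char ::
  "('a::ab_group_add, 'f::field, 'g) gstar_alg \<Rightarrow> ('g vtype \<Rightarrow> nat) \<Rightarrow> ('g vtype \<Rightarrow> nat \<Rightarrow> nat) \<Rightarrow> 'f"
  where "gstar_char A nn \<sigma> =
    (if \<sigma> \<in> young_group nn
     then quot_trace pm_scale (multilin_typed nn) (multilin_typed nn \<inter> gstar_Id A) (rename \<sigma>)
     else 0)"

definition gstar_cochar ::
  "nat \<Rightarrow> ('a::ab_group_add, 'f::field, 'g::finite) gstar_alg \<Rightarrow>
    (('g vtype \<Rightarrow> nat) \<times> (('g vtype \<Rightarrow> nat \<Rightarrow> nat) \<Rightarrow> 'f)) set"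
  where "gstar_cochar n A =
    {(nn, gstar_char A nn) | nn. sum nn UNIV = n \<and> gstar_char A nn \<noteq> (\<lambda>_. 0)}"


subsection \<open>Irreducible characters\<close>

definition is_partition :: "nat list \<Rightarrow> bool"
  where "is_partition l \<longleftrightarrow> sorted_wrt (\<ge>) l \<and> (\<forall>k\<in>set l. 0 < k)"

text \<open>
  The Specht module of a partition \<open>l\<close> of \<open>n\<close>. A tableau \<open>t\<close> maps each entry \<open>k < n\<close> to its
  box (row, column), and a tabloid is the function mapping each entry to its row (and \<open>0\<close>
  outside \<open>{..<n}\<close>). The permutation \<open>\<pi>\<close> moves the entry \<open>k\<close> to \<open>\<pi> k\<close>, so it acts on tableaux and
  on tabloids by composition with \<open>inv \<pi>\<close>.
\<close>

definition tableaux :: "nat list \<Rightarrow> (nat \<Rightarrow> nat \<times> nat) set"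
  where "tableaux l =
    {t. bij_betw t {..<sum_list l} {(i, j). i < length l \<and> j < l ! i}}"

definition tabloid :: "nat \<Rightarrow> (nat \<Rightarrow> nat \<times> nat) \<Rightarrow> (nat \<Rightarrow> nat)"
  where "tabloid n t = (\<lambda>k. if k < n then fst (t k) else 0)"

definition column_stabilizer :: "nat \<Rightarrow> (nat \<Rightarrow> nat \<times> nat) \<Rightarrow> (nat \<Rightarrow> nat) set"
  where "column_stabilizer n t = {\<pi>. \<pi> permutes {..<n} \<and> (\<forall>k<n. snd (t (\<pi> k)) = snd (t k))}"

definition polytabloid :: "nat \<Rightarrow> (nat \<Rightarrow> nat \<times> nat) \<Rightarrow> ((nat \<Rightarrow> nat) \<Rightarrow>\<^sub>0 'f::field)"
  where "polytabloid n t =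
    (\<Sum>\<pi>\<in>column_stabilizer n t. Poly_Mapping.single (tabloid n (t \<circ> inv \<pi>)) (of_int (sign \<pi>)))"

definition specht :: "nat list \<Rightarrow> ((nat \<Rightarrow> nat) \<Rightarrow>\<^sub>0 'f::field) set"
  where "specht l = module.span pm_scale (polytabloid (sum_list l) ` tableaux l)"

definition specht_char :: "nat list \<Rightarrow> (nat \<Rightarrow> nat) \<Rightarrow> 'f::field"
  where "specht_char l \<pi> = quot_trace pm_scale (specht l) {0} (pm_push (\<lambda>r. r \<circ> inv \<pi>))"

definition mpart_size :: "('g vtype \<Rightarrow> nat list) \<Rightarrow> 'g vtype \<Rightarrow> nat"
  where "mpart_size l = (\<lambda>\<tau>. sum_list (l \<tau>))"

definition mpart_char ::
  "('g::finite vtype \<Rightarrow> nat list) \<Rightarrow> ('g vtype \<Rightarrow> nat \<Rightarrow> nat) \<Rightarrow> 'f::field"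
  where "mpart_char l \<sigma> =
    (if \<sigma> \<in> young_group (mpart_size l) then \<Prod>\<tau>\<in>UNIV. specht_char (l \<tau>) (\<sigma> \<tau>) else 0)"

definition mparts :: "('g vtype \<Rightarrow> nat) \<Rightarrow> ('g vtype \<Rightarrow> nat list) set"
  where "mparts nn = {l. (\<forall>\<tau>. is_partition (l \<tau>)) \<and> mpart_size l = nn}"

text \<open>The multiplicities \<open>m\<close> are determined by the character, since the irreducible characters
  are linearly independent.\<close>

definition num_constituents ::
  "('g::finite vtype \<Rightarrow> nat) \<Rightarrow> (('g vtype \<Rightarrow> nat \<Rightarrow> nat) \<Rightarrow> 'f::field) \<Rightarrow> nat"
  where "num_constituents nn c =
    (THE k. \<exists>m :: ('g vtype \<Rightarrow> nat list) \<Rightarrow> nat.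
      c = (\<lambda>\<sigma>. \<Sum>l\<in>mparts nn. of_nat (m l) * mpart_char l \<sigma>) \<and> k = (\<Sum>l\<in>mparts nn. m l))"

definition gstar_colength :: "nat \<Rightarrow> ('a::ab_group_add, 'f::field, 'g::finite) gstar_alg \<Rightarrow> nat"
  where "gstar_colength n A =
    (\<Sum>nn | sum nn UNIV = n. num_constituents nn (gstar_char A nn))"


section \<open>The two algebras\<close>

definition E :: "'n \<Rightarrow> 'n \<Rightarrow> 'f::field ^ 'n ^ 'n"
  where "E i j = (\<chi> a b. if a = i \<and> b = j then 1 else 0)"

abbreviation mat_scale :: "'f::field \<Rightarrow> 'f ^ 'n ^ 'n \<Rightarrow> 'f ^ 'n ^ 'n"
  where "mat_scale c \<equiv> map_matrix ((*) c)"

text \<open>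
  For a numeral type \<open>'n\<close> with \<open>m\<close> elements, the indices \<open>1, \<dots>, m\<close> are taken in \<open>\<int>/m\<int>\<close>; they
  are distinct, with \<open>m = 0\<close>. The \<open>(i, j)\<close> entry of the image of \<open>M\<close> under \<open>E i j \<mapsto> E (m - j + 1) (m - i + 1)\<close>
  is the \<open>(m - j + 1, m - i + 1)\<close> entry of \<open>M\<close>, since this index map is an involution.
\<close>

definition reflection ::
  "('f::field, 'n::{finite,comm_ring_1}) vec ^ ('n::{finite,comm_ring_1}) \<Rightarrow> ('f, 'n) vec ^ ('n::{finite,comm_ring_1})"
  where "reflection M =
    (\<chi> i j. M $ (of_nat CARD('n) - j + 1) $ (of_nat CARD('n) - i + 1))"

definition N3 :: "'g::{finite,ab_group_add} \<Rightarrow> ('f::field ^ 6 ^ 6, 'f, 'g) gstar_alg"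
  where "N3 g = \<lparr>amult = (**), ascale = mat_scale,
    hcomp = (\<lambda>h.
      if h = 0 then module.span mat_scale {mat 1, E 2 3 + E 4 5}
      else if h = g then module.span mat_scale {E 1 2 - E 5 6, E 1 3, E 4 6}
      else {0}),
    astar = reflection\<rparr>"

definition A2 :: "'g::{finite,ab_group_add} \<Rightarrow> ('f::field ^ 4 ^ 4, 'f, 'g) gstar_alg"
  where "A2 g = \<lparr>amult = (**), ascale = mat_scale,
    hcomp = (\<lambda>h.
      if h = 0 then module.span mat_scale {E 1 1 + E 4 4}
      else if h = g then module.span mat_scale {E 1 2, E 3 4}
      else {0}),
    astar = reflection\<rparr>"


subsection \<open>They are \<open>(G, *)\<close>-algebras\<close>

lemma vector_space_mat_scale: "vector_space (mat_scale :: 'f::field \<Rightarrow> 'f^'n^'n \<Rightarrow> _)"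
  by unfold_locales (auto simp: vec_eq_iff algebra_simps)

interpretation mat_scale: vector_space "mat_scale :: 'f::field \<Rightarrow> 'f^'n^'n \<Rightarrow> _"
  by (rule vector_space_mat_scale)

lemma E_mult: "E i j ** E k l = (if j = k then E i l else (0 :: 'f::field^'n^'n))"
proof -
  have "(\<Sum>c\<in>UNIV. (if a = i \<and> c = j then 1 else 0) * (if c = k \<and> b = l then 1 else 0))
     = (if j = k \<and> a = i \<and> b = l then 1 else (0::'f))" for a b :: 'n
  proof -
    have "(\<Sum>c\<in>UNIV. (if a = i \<and> c = j then 1 else 0) * (if c = k \<and> b = l then 1 else 0))
       = (\<Sum>c\<in>UNIV. if c = j then (if j = k \<and> a = i \<and> b = l then 1 else (0::'f)) else 0)"
      by (rule sum.cong) auto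
    then show ?thesis by simp
  qed
  then show ?thesis by (auto simp: E_def matrix_matrix_mult_def vec_eq_iff)
qed

lemma matrix_mat_scale: "mat_scale c M ** N = mat_scale c (M ** N)" "M ** mat_scale c N = mat_scale c (M ** N)"
  for M N :: "'f::field^'n^'n"
  by (auto simp: matrix_matrix_mult_def vec_eq_iff sum_distrib_left algebra_simps)

lemma matrix_diff: "(M - K) ** N = M ** N - K ** N" "N ** (M - K) = N ** M - N ** K" for M N K:: "'f::field^'n^'n"
  by (auto simp: matrix_matrix_mult_def vec_eq_iff sum_subtractf algebra_simps)

lemma matrix_add_right: "(M + K) ** N = M ** N + K ** N" for M N K:: "'f::field^'n^'n"
  by (auto simp: matrix_matrix_mult_def vec_eq_iff sum.distrib algebra_simps)

lemma mat_span1: "x \<in> module.span mat_scale {a} \<longleftrightarrow> (\<exists>c. x = mat_scale c a)"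
  for x a b :: "'f::field^'n^'n"
  by (auto simp: mat_scale.span_singleton)
lemma mat_span_insert: "x \<in> module.span mat_scale (insert a S) \<longleftrightarrow> (\<exists>c y. y \<in> module.span mat_scale S \<and> x = mat_scale c a + y)"
  for x a b :: "'f::field^'n^'n"
proof
  assume "x \<in> module.span mat_scale (insert a S)"
  then obtain k where "x - mat_scale k a \<in> module.span mat_scale S" unfolding mat_scale.span_breakdown_eq by auto
  then show "\<exists>c y. y \<in> module.span mat_scale S \<and> x = mat_scale c a + y"
    by (intro exI[of _ k] exI[of _ "x - mat_scale k a"]) simp
next
  assume "\<exists>c y. y \<in> module.span mat_scale S \<and> x = mat_scale c a + y"
  then show "x \<in> module.span mat_scale (insert a S)" unfolding mat_scale.span_breakdown_eq by (metis add_diff_cancel_left')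
qed
lemma mat_span2: "x \<in> module.span mat_scale {a,b} \<longleftrightarrow> (\<exists>c d. x = mat_scale c a + mat_scale d b)"
  for x a b :: "'f::field^'n^'n"
  unfolding mat_span_insert[of x] mat_span1 by blast
lemma mat_span3: "x \<in> module.span mat_scale {a,b,e} \<longleftrightarrow> (\<exists>c d f. x = mat_scale c a + mat_scale d b + mat_scale f e)"
  for x a b :: "'f::field^'n^'n"
  unfolding mat_span_insert[of x] mat_span2 add.assoc by blast

lemma reflection_linear: "reflection (M + N) = reflection M + reflection N" "reflection (M - N) = reflection M - reflection N"
  "reflection (mat_scale c M) = mat_scale c (reflection M)" 
  by (auto simp: reflection_def vec_eq_iff)
lemma reflection_mat: "reflection (mat 1) = mat 1" 
  by (auto simp: reflection_def vec_eq_iff mat_def)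
lemma reflection_E: "reflection (E i j) = E (of_nat CARD('n) - j + 1) (of_nat CARD('n) - i + 1)"
   for i j :: "'n::{finite,comm_ring_1}"
  by (auto simp: reflection_def vec_eq_iff E_def)
lemma reflection_reflection: "reflection (reflection M) = M"
  by (auto simp: reflection_def vec_eq_iff)
lemma reflection_mult: "reflection (M ** N) = reflection N ** reflection M"
 for M N :: "('f::field, 'n::{finite,comm_ring_1}) vec ^ ('n::{finite,comm_ring_1})"
proof -
  have b: "bij (\<lambda>c::'n. of_nat CARD('n) - c + 1)"
    by (rule o_bij[where g="(\<lambda>c::'n. of_nat CARD('n) - c + 1)"]) auto
  show ?thesis
  unfolding reflection_def vec_eq_iff matrix_matrix_mult_def
  apply simp
  apply (intro allI)
  subgoal for i j
    using sum.reindex_bij_betw[OF b, of "\<lambda>k. M $ (of_nat CARD('n) - j + 1) $ k * N $ k $ (of_nat CARD('n) - i + 1)"]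
    apply (simp add: mult.commute)
    done
  done
qed

lemma gstar_algebra_matI:
  fixes A :: "(('f::field, 'n::{finite,comm_ring_1}) vec ^ ('n::{finite,comm_ring_1}), 'f, 'g::{finite,ab_group_add}) gstar_alg"
  assumes "amult A = (**)" "ascale A = mat_scale" "astar A = reflection"
    and "\<And>h. module.subspace mat_scale (hcomp A h)"
    and "\<And>x h. \<lbrakk>\<And>h. x h \<in> hcomp A h; (\<Sum>h\<in>UNIV. x h) = 0\<rbrakk> \<Longrightarrow> x h = 0"
    and "\<And>a b h k. \<lbrakk>a \<in> hcomp A h; b \<in> hcomp A k\<rbrakk> \<Longrightarrow> a ** b \<in> hcomp A (h + k)"
    and "\<And>a h. a \<in> hcomp A h \<Longrightarrow> reflection a \<in> hcomp A h"
  shows "gstar_algebra A"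
  apply (rule gstar_algebra.intro)
                 apply (unfold assms(1,2,3))
                 apply (fact vector_space_mat_scale, fact assms(4), fact assms(5), fact assms(6), fact assms(7),
                   simp add: matrix_mul_assoc, simp add: matrix_add_right, simp add: matrix_add_ldistrib,
                   simp add: matrix_mat_scale, simp add: matrix_mat_scale, simp add: reflection_linear, simp add: reflection_linear,
                   simp add: reflection_mult, simp add: reflection_reflection)
  done

lemma sum_two_comps: assumes "g \<noteq> (0::'g::{finite,ab_group_add})" "\<And>h. h \<noteq> 0 \<Longrightarrow> h \<noteq> g \<Longrightarrow> x h = 0"
  shows "sum x UNIV = x 0 + (x g :: 'a::ab_group_add)"
proof -
  have "sum x UNIV = sum x {0,g}" using assms by (intro sum.mono_neutral_right) auto
  then show ?thesis using assms by simp
qed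

lemma E_nth: "E i j $ a $ b = (if a = i \<and> b = j then 1 else 0)" by (simp add: E_def)

lemma gstar_algebra_N3: assumes g: "g \<noteq> 0" shows "gstar_algebra (N3 g :: ('f::field^6^6, 'f, 'g::{finite,ab_group_add}) gstar_alg)"
proof (rule gstar_algebra_matI, goal_cases)
  case (4 h) show ?case by (auto simp: N3_def mat_scale.subspace_span)
next
  case (5 x h)
  have o: "h \<noteq> 0 \<Longrightarrow> h \<noteq> g \<Longrightarrow> x h = 0" for h using 5(1)[of h] by (auto simp: N3_def)
  have s: "x 0 + x g = 0" using sum_two_comps[OF g o] 5(2) by simp
  obtain a b where 1: "x 0 = mat_scale a (mat 1) + mat_scale b (E 2 3 + E 4 5)"
    using 5(1)[of 0] by (auto simp: N3_def mat_span2)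
  obtain c d e where 2: "x g = mat_scale c (E 1 2 - E 5 6) + mat_scale d (E 1 3) + mat_scale e (E 4 6)"
    using 5(1)[of g] g by (auto simp: N3_def mat_span3)
  have "(x 0 + x g) $ i $ j = 0" for i j using s by simp
  note t = this[unfolded 1 2, simplified, unfolded E_nth mat_def, simplified]
  have "a = 0" using t[of 1 1] by simp
  moreover have "b = 0" using t[of 2 3] by simp
  moreover have "c = 0" using t[of 1 2] by simp
  moreover have "d = 0" using t[of 1 3] by simp
  moreover have "e = 0" using t[of 4 6] by simp
  ultimately show ?case using 1 2 o[of h] by (cases "h = 0"; cases "h = g") auto
next
  case (6 a b h k)
  consider "h = 0" "k = 0" | "h = 0" "k = g" | "h = g" "k = 0" | "h = g" "k = g" | "a = 0" | "b = 0"
    using 6 by (fastforce simp: N3_def split: if_splits)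
  then show ?case
  proof cases
    case 1
    obtain c d c' d' where *: "a = mat_scale c (mat 1) + mat_scale d (E 2 3 + E 4 5)" "b = mat_scale c' (mat 1) + mat_scale d' (E 2 3 + E 4 5)"
      using 6 1 by (auto simp: N3_def mat_span2)
    have "a ** b = mat_scale (c*c') (mat 1) + mat_scale (c*d'+d*c') (E 2 3 + E 4 5)"
      unfolding * apply (simp_all add: matrix_add_right matrix_add_ldistrib matrix_mat_scale E_mult algebra_simps) 
  apply (auto simp: vec_eq_iff algebra_simps)?
 done
    then show ?thesis using 1 by (auto simp: N3_def mat_span2)
  next case 2
    obtain c d c' d' e' where *: "a = mat_scale c (mat 1) + mat_scale d (E 2 3 + E 4 5)" "b = mat_scale c' (E 1 2 - E 5 6) + mat_scale d' (E 1 3) + mat_scale e' (E 4 6)"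
      using 6 2 g by (auto simp: N3_def mat_span2 mat_span3)
    have "a ** b = mat_scale (c*c') (E 1 2 - E 5 6) + mat_scale (c*d') (E 1 3) + mat_scale (c*e' - d*c') (E 4 6)"
      unfolding * apply (simp_all add: matrix_add_right matrix_add_ldistrib matrix_mat_scale E_mult matrix_diff) 
  apply (auto simp: vec_eq_iff algebra_simps)?
 done
    then show ?thesis using 2 g by (simp add: N3_def mat_span3) blast
  next case 3
    obtain c d c' d' e' where *: "b = mat_scale c (mat 1) + mat_scale d (E 2 3 + E 4 5)" "a = mat_scale c' (E 1 2 - E 5 6) + mat_scale d' (E 1 3) + mat_scale e' (E 4 6)"
      using 6 3 g by (auto simp: N3_def mat_span2 mat_span3)
    have "a ** b = mat_scale (c*c') (E 1 2 - E 5 6) + mat_scale (c*d' + d*c') (E 1 3) + mat_scale (c*e') (E 4 6)"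
      unfolding * apply (simp_all add: matrix_add_right matrix_add_ldistrib matrix_mat_scale E_mult matrix_diff) 
  apply (auto simp: vec_eq_iff algebra_simps)?
 done
    then show ?thesis using 3 g by (simp add: N3_def mat_span3) blast
  next case 4
    obtain c d e c' d' e' where *: "a = mat_scale c (E 1 2 - E 5 6) + mat_scale d (E 1 3) + mat_scale e (E 4 6)" "b = mat_scale c' (E 1 2 - E 5 6) + mat_scale d' (E 1 3) + mat_scale e' (E 4 6)"
      using 6 4 g by (auto simp: N3_def mat_span2 mat_span3)
    have "a ** b = 0"
      unfolding * by (simp add: matrix_add_right matrix_add_ldistrib matrix_mat_scale E_mult matrix_diff) 
    then show ?thesis by (auto simp: N3_def mat_scale.span_zero)
  qed (auto simp: N3_def mat_scale.span_zero)
next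
  case (7 a h)
  consider "h = 0" | "h = g" | "a = 0" using 7 by (fastforce simp: N3_def split: if_splits)
  then show ?case
  proof cases
    case 1
    then obtain c d where *: "a = mat_scale c (mat 1) + mat_scale d (E 2 3 + E 4 5)" 
      using 7 by (auto simp: N3_def mat_span2)
    have "reflection a = a" unfolding * by (simp add: reflection_linear reflection_mat reflection_E add.commute)
    then show ?thesis using 7 by simp
  next case 2
    then obtain c d e where *: "a = mat_scale c (E 1 2 - E 5 6) + mat_scale d (E 1 3) + mat_scale e (E 4 6)"
      using 7 g by (auto simp: N3_def mat_span3)
    have "reflection a = mat_scale (-c) (E 1 2 - E 5 6) + mat_scale e (E 1 3) + mat_scale d (E 4 6)" unfolding * 
  by (simp add: reflection_linear reflection_mat reflection_E) (auto simp: vec_eq_iff algebra_simps)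
    then have "reflection a \<in> module.span mat_scale {E 1 2 - E 5 6, E 1 3, E 4 6}"
      unfolding mat_span3 by blast
    then show ?thesis using 2 g by (simp add: N3_def)
  next case 3
    then have "reflection a = a" by (simp add: reflection_def vec_eq_iff)
    then show ?thesis using 7 by simp
  qed
qed (auto simp: N3_def)

lemma gstar_algebra_A2: assumes g: "g \<noteq> 0" shows "gstar_algebra (A2 g :: ('f::field^4^4, 'f, 'g::{finite,ab_group_add}) gstar_alg)"
proof (rule gstar_algebra_matI, goal_cases)
  case (4 h) show ?case by (auto simp: A2_def mat_scale.subspace_span)
next
  case (5 x h)
  have o: "h \<noteq> 0 \<Longrightarrow> h \<noteq> g \<Longrightarrow> x h = 0" for h using 5(1)[of h] by (auto simp: A2_def)
  have s: "x 0 + x g = 0" using sum_two_comps[OF g o] 5(2) by simp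
  obtain b where 1: "x 0 = mat_scale b (E 1 1 + E 4 4)"
    using 5(1)[of 0] by (auto simp: A2_def mat_span1)
  obtain d e where 2: "x g = mat_scale d (E 1 2) + mat_scale e (E 3 4)"
    using 5(1)[of g] g by (auto simp: A2_def mat_span2)
  have "(x 0 + x g) $ i $ j = 0" for i j using s by simp
  note t = this[unfolded 1 2, simplified, unfolded E_nth mat_def, simplified]
  have "b = 0" using t[of 1 1] by simp
  moreover have "d = 0" using t[of 1 2] by simp
  moreover have "e = 0" using t[of 3 4] by simp
  ultimately show ?case using 1 2 o[of h] by (cases "h = 0"; cases "h = g") auto
next
  case (6 a b h k)
  consider "h = 0" "k = 0" | "h = 0" "k = g" | "h = g" "k = 0" | "h = g" "k = g" | "a = 0" | "b = 0"
    using 6 by (fastforce simp: A2_def split: if_splits)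
  then show ?case
  proof cases
    case 1
    obtain c c' where *: "a = mat_scale c (E 1 1 + E 4 4)" "b = mat_scale c' (E 1 1 + E 4 4)"
      using 6 1 by (auto simp: A2_def mat_span1)
    have "a ** b = mat_scale (c*c') (E 1 1 + E 4 4)"
      unfolding * apply (simp_all add: matrix_add_right matrix_add_ldistrib matrix_mat_scale E_mult) 
  apply (auto simp: vec_eq_iff algebra_simps)?
 done
    then show ?thesis using 1 by (auto simp: A2_def mat_span1)
  next case 2
    obtain c d e where *: "a = mat_scale c (E 1 1 + E 4 4)" "b = mat_scale d (E 1 2) + mat_scale e (E 3 4)"
      using 6 2 g by (auto simp: A2_def mat_span1 mat_span2)
    have "a ** b = mat_scale (c*d) (E 1 2) + mat_scale 0 (E 3 4)"
      unfolding * apply (simp_all add: matrix_add_right matrix_add_ldistrib matrix_mat_scale E_mult) 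
  apply (auto simp: vec_eq_iff algebra_simps)?
 done
    then have "a ** b \<in> module.span mat_scale {E 1 2, E 3 4}"
      unfolding mat_span2 by blast
    then show ?thesis using 2 g by (simp add: A2_def)
  next case 3
    obtain c d e where *: "b = mat_scale c (E 1 1 + E 4 4)" "a = mat_scale d (E 1 2) + mat_scale e (E 3 4)"
      using 6 3 g by (auto simp: A2_def mat_span1 mat_span2)
    have "a ** b = mat_scale 0 (E 1 2) + mat_scale (c*e) (E 3 4)"
      unfolding * apply (simp_all add: matrix_add_right matrix_add_ldistrib matrix_mat_scale E_mult) 
  apply (auto simp: vec_eq_iff algebra_simps)?
 done
    then have "a ** b \<in> module.span mat_scale {E 1 2, E 3 4}"
      unfolding mat_span2 by blast
    then show ?thesis using 3 g by (simp add: A2_def)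
  next case 4
    obtain d e d' e' where *: "a = mat_scale d (E 1 2) + mat_scale e (E 3 4)" "b = mat_scale d' (E 1 2) + mat_scale e' (E 3 4)"
      using 6 4 g by (auto simp: A2_def mat_span2)
    have "a ** b = 0"
      unfolding * by (simp add: matrix_add_right matrix_add_ldistrib matrix_mat_scale E_mult) 
    then show ?thesis by (auto simp: A2_def mat_scale.span_zero)
  qed (auto simp: A2_def mat_scale.span_zero)
next
  case (7 a h)
  consider "h = 0" | "h = g" | "a = 0" using 7 by (fastforce simp: A2_def split: if_splits)
  then show ?case
  proof cases
    case 1
    then obtain c where *: "a = mat_scale c (E 1 1 + E 4 4)" 
      using 7 by (auto simp: A2_def mat_span1)
    have "reflection a = a" unfolding * by (simp add: reflection_linear reflection_E add.commute)
    then show ?thesis using 7 by simp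
  next case 2
    then obtain d e where *: "a = mat_scale d (E 1 2) + mat_scale e (E 3 4)"
      using 7 g by (auto simp: A2_def mat_span2)
    have "reflection a = mat_scale e (E 1 2) + mat_scale d (E 3 4)" unfolding * 
      by (simp add: reflection_linear reflection_E add.commute)
    then show ?thesis using 2 g by (simp add: A2_def mat_span2) blast
  next case 3
    then have "reflection a = a" by (simp add: reflection_def vec_eq_iff)
    then show ?thesis using 7 by simp
  qed
qed (auto simp: A2_def)
end

theory Submission
  imports Defs
begin

text \<open>
  Modulo the proposed generators, degree-\<open>0\<close> variables commute and symmetric variables of degree \<open>g\<close> are
  central. If \<open>z\<close> is skew of degree \<open>g\<close> and \<open>y\<close> is symmetric of degree \<open>0\<close>, then \<open>[y, z]\<close> is symmetric of
  degree \<open>g\<close>, hence central; so a word \<open>u z v\<close> is determined by its content and by how often each \<open>y\<close>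
  occurs in \<open>u\<close>. The resulting linear functionals are exactly those detected by evaluating at
  \<open>1 + (E 2 3 + E 4 5)\<close> and \<open>E 1 2 - E 5 6\<close>, once multihomogeneous components are separated by the
  linear independence of monomials as characters. They are coordinates on the multilinear spaces modulo the
  identities, which gives the codimensions, and the traces of the permutation actions.

  For the colengths, the multiplicity of the trivial character is an average over the symmetric group
  (a nontrivial Specht module is killed by the symmetrizer), and the number of the other constituents is
  bounded by comparing the values at the identity and at a transposition.
\<close>


section \<open>Linear extension of functions on a basis\<close>

text \<open>The functionals \<open>content_sum\<close> and \<open>prefix_sum\<close> sit between two
  inclusions: they vanish on every identity of \<open>N3\<close>, and a polynomial on which they
  vanish lies in every T-ideal satisfying the relations. Applied to an arbitrary T-ideal containing
  the generators, the second inclusion yields the generating set; applied to the ideal of identities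
  itself, it yields a membership test. Dimension and trace are defined through some chosen basis, so
  all later values rest on one fact: a trace on a quotient is the sum of the diagonal coordinates
  for any dual system of vectors and functionals. For \<open>A2\<close> only the multilinear
  identities of the few surviving types are determined; the relations shared with \<open>N3\<close>
  dispose of the other types. The colength is a \<open>THE\<close> over total multiplicities, for
  which two linear conditions suffice, so orthogonality of irreducible characters is bypassed. The
  bounds on \<open>n\<close> are genuine: \<open>[n - 2, 1]\<close> is a partition only from 3 on,
  and for \<open>n = 1\<close> the single letter of degree \<open>g\<close> is both first and last,
  so the multiplicity 2 for \<open>A2\<close> fails.\<close>

lemma lookup_pm_scale [simp]: "Poly_Mapping.lookup (pm_scale c p) k = c * Poly_Mapping.lookup p k"
  by (simp add: pm_scale_def Poly_Mapping.map.rep_eq when_def)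

interpretation pm: vector_space "pm_scale :: 'f::field \<Rightarrow> ('k \<Rightarrow>\<^sub>0 'f) \<Rightarrow> _"
  by unfold_locales (auto intro!: poly_mapping_eqI simp: lookup_add algebra_simps)

interpretation field_mult: vector_space "(*) :: 'f::field \<Rightarrow> 'f \<Rightarrow> 'f"
  by unfold_locales (auto simp: algebra_simps)

lemma pm_scale_single [simp]: "pm_scale c (Poly_Mapping.single k d) = Poly_Mapping.single k (c * d)"
  by (rule poly_mapping_eqI) (simp add: lookup_single when_def)

lemma sum_single:
  "(\<Sum>k\<in>Poly_Mapping.keys p. Poly_Mapping.single k (Poly_Mapping.lookup p k)) = p"
  by (rule poly_mapping_eqI) (auto simp: lookup_sum lookup_single when_def in_keys_iff)

text \<open>Renaming, evaluation, the involution of the free algebra and the coordinate functionals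
  are all linear extensions of maps on words; their target spaces differ, hence the parameter
  \<open>s\<close>, and linearity is proved once.\<close>

definition lin_ext :: "('f::field \<Rightarrow> 'v \<Rightarrow> 'v::ab_group_add) \<Rightarrow> ('k \<Rightarrow> 'v) \<Rightarrow> ('k \<Rightarrow>\<^sub>0 'f) \<Rightarrow> 'v"
  where "lin_ext s h p = (\<Sum>k\<in>Poly_Mapping.keys p. s (Poly_Mapping.lookup p k) (h k))"

context vector_space
begin

lemma lin_ext_superset:
  assumes "finite S" "Poly_Mapping.keys p \<subseteq> S"
  shows "lin_ext scale h p = (\<Sum>k\<in>S. scale (Poly_Mapping.lookup p k) (h k))"
  unfolding lin_ext_def
  by (rule sum.mono_neutral_left) (use assms in \<open>auto simp: in_keys_iff\<close>)

lemma linear_lin_ext: "Vector_Spaces.linear pm_scale scale (lin_ext scale h)"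
  unfolding Vector_Spaces.linear_iff
proof (intro conjI allI pm.vector_space_axioms vector_space_axioms)
  fix p q :: "'c \<Rightarrow>\<^sub>0 'a" and c
  show "lin_ext scale h (p + q) = lin_ext scale h p + lin_ext scale h q"
    by (subst (1 2 3) lin_ext_superset[where S = "Poly_Mapping.keys p \<union> Poly_Mapping.keys q"])
      (use Poly_Mapping.keys_add[of p q] in \<open>auto simp: lookup_add scale_left_distrib sum.distrib\<close>)
  show "lin_ext scale h (pm_scale c p) = scale c (lin_ext scale h p)"
    by (subst (1 2) lin_ext_superset[where S = "Poly_Mapping.keys p"])
      (auto simp: in_keys_iff scale_sum_right)
qed

lemma lin_ext_single [simp]: "lin_ext scale h (Poly_Mapping.single k c) = scale c (h k)"
  by (simp add: lin_ext_def)

end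

lemma pm_push_eq_lin_ext: "pm_push f = lin_ext pm_scale (\<lambda>k. Poly_Mapping.single (f k) 1)"
  by (rule ext) (simp add: pm_push_def lin_ext_def)

lemma linear_pm_push: "Vector_Spaces.linear pm_scale pm_scale (pm_push f)"
  unfolding pm_push_eq_lin_ext by (rule pm.linear_lin_ext)

lemma pm_push_single [simp]: "pm_push f (Poly_Mapping.single k c) = Poly_Mapping.single (f k) c"
  by (simp add: pm_push_eq_lin_ext)

text \<open>It replaces the spans that define the multilinear spaces by conditions on the words that
  occur.\<close>

lemma span_singles:
  "p \<in> module.span pm_scale ((\<lambda>k. Poly_Mapping.single k (1::'f::field)) ` S) \<longleftrightarrow> Poly_Mapping.keys p \<subseteq> S"
proof
  assume "p \<in> pm.span ((\<lambda>k. Poly_Mapping.single k (1::'f)) ` S)"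
  then show "Poly_Mapping.keys p \<subseteq> S"
  proof (induction rule: pm.span_induct)
    case base
    show ?case
    proof (rule pm.subspaceI)
      show "x + y \<in> {p. Poly_Mapping.keys p \<subseteq> S}"
        if "x \<in> {p. Poly_Mapping.keys p \<subseteq> S}" "y \<in> {p. Poly_Mapping.keys p \<subseteq> S}" for x y :: "'a \<Rightarrow>\<^sub>0 'f"
        using that Poly_Mapping.keys_add[of x y] by auto
    qed (auto simp: in_keys_iff)
  qed auto
next
  assume S: "Poly_Mapping.keys p \<subseteq> S"
  have "(\<Sum>k\<in>Poly_Mapping.keys p. pm_scale (Poly_Mapping.lookup p k) (Poly_Mapping.single k 1))
      \<in> pm.span ((\<lambda>k. Poly_Mapping.single k (1::'f)) ` S)"
    by (intro pm.span_sum pm.span_scale pm.span_base) (use S in auto)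
  then show "p \<in> pm.span ((\<lambda>k. Poly_Mapping.single k (1::'f)) ` S)"
    by (simp add: sum_single)
qed


section \<open>Traces and dimensions from dual bases\<close>

locale quot_space = vector_space scale
  for scale :: "'f::field_char_0 \<Rightarrow> 'v::ab_group_add \<Rightarrow> 'v" +
  fixes V W :: "'v set"
  assumes subspace_V: "subspace V" and subspace_W: "subspace W" and W_subset_V: "W \<subseteq> V"
begin

definition coef :: "'v set \<Rightarrow> 'v \<Rightarrow> 'v \<Rightarrow> 'f"
  where "coef B v = (THE c. quot_combination scale W B v c)"

lemma coef_combination:
  assumes "quot_basis scale V W B" "v \<in> V"
  shows "quot_combination scale W B v (coef B v)"
  unfolding coef_def by (rule theI'[of "quot_combination scale W B v"]) (use assms in \<open>simp add: quot_basis_def\<close>)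

lemma coef_eqI:
  assumes "quot_basis scale V W B" "v \<in> V" "quot_combination scale W B v c"
  shows "coef B v = c"
  unfolding coef_def by (rule the1_equality) (use assms in \<open>auto simp: quot_basis_def\<close>)

lemma coef_add:
  assumes B: "quot_basis scale V W B" and v: "v \<in> V" "w \<in> V"
  shows "coef B (v + w) b = coef B v b + coef B w b"
proof -
  have "coef B (v + w) = (\<lambda>b. coef B v b + coef B w b)"
  proof (rule coef_eqI[OF B])
    have *: "v + w - (\<Sum>b\<in>B. scale (coef B v b + coef B w b) b)
        = (v - (\<Sum>b\<in>B. scale (coef B v b) b)) + (w - (\<Sum>b\<in>B. scale (coef B w b) b))"
      by (simp add: scale_left_distrib sum.distrib)
    show "quot_combination scale W B (v + w) (\<lambda>b. coef B v b + coef B w b)"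
      using coef_combination[OF B v(1)] coef_combination[OF B v(2)] subspace_add[OF subspace_W]
      unfolding quot_combination_def * by auto
  qed (use v subspace_V in \<open>auto intro: subspace_add\<close>)
  then show ?thesis by simp
qed

lemma coef_scale:
  assumes B: "quot_basis scale V W B" and v: "v \<in> V"
  shows "coef B (scale r v) b = r * coef B v b"
proof -
  have "coef B (scale r v) = (\<lambda>b. r * coef B v b)"
  proof (rule coef_eqI[OF B])
    have *: "scale r v - (\<Sum>b\<in>B. scale (r * coef B v b) b) = scale r (v - (\<Sum>b\<in>B. scale (coef B v b) b))"
      by (simp add: scale_right_diff_distrib scale_sum_right)
    show "quot_combination scale W B (scale r v) (\<lambda>b. r * coef B v b)"
      using coef_combination[OF B v] subspace_scale[OF subspace_W]
      unfolding quot_combination_def * by auto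
  qed (use v subspace_V in \<open>auto intro: subspace_scale\<close>)
  then show ?thesis by simp
qed

lemma coef_W:
  assumes B: "quot_basis scale V W B" and v: "v \<in> W"
  shows "coef B v b = 0"
proof -
  have "coef B v = (\<lambda>b. 0)"
    by (rule coef_eqI[OF B]) (use v W_subset_V in \<open>auto simp: quot_combination_def\<close>)
  then show ?thesis by simp
qed

lemma coef_sum:
  assumes B: "quot_basis scale V W B" and v: "\<And>i. i \<in> I \<Longrightarrow> v i \<in> V"
  shows "coef B (\<Sum>i\<in>I. v i) b = (\<Sum>i\<in>I. coef B (v i) b)"
proof -
  have "0 \<in> W" using subspace_0[OF subspace_W] .
  then have 0: "coef B 0 b = 0" by (rule coef_W[OF B])
  show ?thesis
    using v
  proof (induction I rule: infinite_finite_induct)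
    case (insert i I)
    then have "(\<Sum>i\<in>I. v i) \<in> V" by (intro subspace_sum[OF subspace_V]) auto
    with insert show ?case by (simp add: coef_add[OF B])
  qed (simp_all add: 0)
qed

lemma quot_trace_eq_coef:
  "quot_trace scale V W T = (let B = SOME B. quot_basis scale V W B in \<Sum>b\<in>B. coef B (T b) b)"
  by (simp add: quot_trace_def coef_def)

text \<open>The chosen basis depends on \<open>V\<close> and \<open>W\<close> alone, so both sides
  use the same one. This moves a sum over the symmetric group inside the trace.\<close>

lemma quot_trace_sum:
  assumes B: "quot_basis scale V W B"
    and T: "\<And>i v. i \<in> I \<Longrightarrow> v \<in> V \<Longrightarrow> T i v \<in> V"
  shows "quot_trace scale V W (\<lambda>v. \<Sum>i\<in>I. T i v) = (\<Sum>i\<in>I. quot_trace scale V W (T i))"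
proof -
  \<comment> \<open>The given basis only witnesses existence; from here on \<open>B\<close> is the
    basis that \<open>quot_trace\<close> chooses.\<close>
  define B where "B = (SOME B. quot_basis scale V W B)"
  have B: "quot_basis scale V W B" unfolding B_def by (rule someI) fact
  then have "B \<subseteq> V" by (simp add: quot_basis_def)
  have "(\<Sum>b\<in>B. coef B (\<Sum>i\<in>I. T i b) b) = (\<Sum>b\<in>B. \<Sum>i\<in>I. coef B (T i b) b)"
    by (intro sum.cong refl coef_sum[OF B]) (use T \<open>B \<subseteq> V\<close> in auto)
  also have "\<dots> = (\<Sum>i\<in>I. \<Sum>b\<in>B. coef B (T i b) b)" by (rule sum.swap)
  finally show ?thesis unfolding quot_trace_eq_coef B_def[symmetric] Let_def .
qed

lemma quot_trace_zero:
  assumes B: "quot_basis scale V W B" and T: "\<And>v. v \<in> V \<Longrightarrow> T v \<in> W"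
  shows "quot_trace scale V W T = 0"
proof -
  define B where "B = (SOME B. quot_basis scale V W B)"
  have B: "quot_basis scale V W B" unfolding B_def by (rule someI) fact
  then have "B \<subseteq> V" by (simp add: quot_basis_def)
  have "(\<Sum>b\<in>B. coef B (T b) b) = 0"
    by (intro sum.neutral ballI coef_W[OF B]) (use T \<open>B \<subseteq> V\<close> in auto)
  then show ?thesis unfolding quot_trace_eq_coef B_def[symmetric] Let_def .
qed

end

text \<open>The functionals \<open>f i\<close> identify \<open>V/W\<close> with the functions on
  \<open>I\<close>: \<open>dual\<close> gives surjectivity, and \<open>W_eq\<close> says that
  \<open>W\<close> is exactly their common kernel. This replaces separate proofs of spanning and
  independence.\<close>

locale dual_basis = vector_space scale
  for scale :: "'f::field_char_0 \<Rightarrow> 'v::ab_group_add \<Rightarrow> 'v" +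
  fixes V W :: "'v set" and I :: "'i set" and e :: "'i \<Rightarrow> 'v" and f :: "'i \<Rightarrow> 'v \<Rightarrow> 'f"
  assumes subspace: "subspace V"
    and finite_I: "finite I"
    and e_in_V: "i \<in> I \<Longrightarrow> e i \<in> V"
    and linear_f: "i \<in> I \<Longrightarrow> Vector_Spaces.linear scale (*) (f i)"
    and dual: "i \<in> I \<Longrightarrow> j \<in> I \<Longrightarrow> f i (e j) = (if i = j then 1 else 0)"
    and W_eq: "W = {v \<in> V. \<forall>i\<in>I. f i v = 0}"
begin

lemma f_add: "i \<in> I \<Longrightarrow> f i (x + y) = f i x + f i y"
  and f_scale: "i \<in> I \<Longrightarrow> f i (scale c x) = c * f i x"
  using linear_f by (auto simp: Vector_Spaces.linear_iff)

lemma f_diff: "i \<in> I \<Longrightarrow> f i (x - y) = f i x - f i y"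
  using f_add[of i "x - y" y] by simp

lemma f_sum: "i \<in> I \<Longrightarrow> f i (sum h S) = (\<Sum>s\<in>S. f i (h s))"
  using module_hom.sum[OF linear_f[unfolded module_hom_iff_linear[symmetric]]] by auto

lemma f_zero: "i \<in> I \<Longrightarrow> f i 0 = 0"
  using f_add[of i 0 0] by simp

lemma f_combination:
  assumes "i \<in> I" shows "f i (\<Sum>j\<in>I. scale (c j) (e j)) = c i"
proof -
  have "f i (\<Sum>j\<in>I. scale (c j) (e j)) = (\<Sum>j\<in>I. if i = j then c j else 0)"
    using assms by (auto simp: f_sum f_scale dual intro!: sum.cong)
  then show ?thesis using assms finite_I by simp
qed

lemma combination_in_V: "(\<Sum>j\<in>I. scale (c j) (e j)) \<in> V"
  by (intro subspace_sum[OF subspace] subspace_scale[OF subspace] e_in_V)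

sublocale quot_space scale V W
proof unfold_locales
  show "subspace W"
    unfolding W_eq
    by (rule subspaceI)
      (auto simp: f_zero f_add f_scale intro: subspace_0[OF subspace] subspace_add[OF subspace]
        subspace_scale[OF subspace])
qed (auto simp: subspace W_eq)

lemma diff_in_W:
  assumes "v \<in> V"
  shows "v - (\<Sum>i\<in>I. scale (f i v) (e i)) \<in> W"
  using assms subspace_diff[OF subspace assms combination_in_V] by (simp add: W_eq f_diff f_combination)

lemma inj_e: "inj_on e I"
  by (rule inj_onI) (metis dual zero_neq_one)

lemma quot_basis_e: "quot_basis scale V W (e ` I)"
  unfolding quot_basis_def
proof (intro conjI ballI)
  fix v assume v: "v \<in> V"
  have sum_e: "(\<Sum>b\<in>e ` I. scale (c b) b) = (\<Sum>i\<in>I. scale (c (e i)) (e i))" for c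
    using inj_e by (simp add: sum.reindex)
  define c where "c b = (if b \<in> e ` I then f (the_inv_into I e b) v else 0)" for b
  have c: "c (e i) = f i v" if "i \<in> I" for i
    using that by (simp add: c_def the_inv_into_f_f[OF inj_e])
  show "\<exists>!c. quot_combination scale W (e ` I) v c"
  proof (rule ex1I[of _ c])
    show "quot_combination scale W (e ` I) v c"
      using diff_in_W[OF v] by (simp add: quot_combination_def sum_e c cong: sum.cong) (simp add: c_def)
    fix d assume d: "quot_combination scale W (e ` I) v d"
    have "d (e i) = f i v" if "i \<in> I" for i
    proof -
      have "f i (v - (\<Sum>j\<in>I. scale (d (e j)) (e j))) = 0"
        using d that by (auto simp: quot_combination_def sum_e W_eq)
      then show ?thesis using that by (simp add: f_diff f_combination[where c = "\<lambda>j. d (e j)"])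
    qed
    then show "d = c"
      using d c by (auto simp: quot_combination_def c_def fun_eq_iff)
  qed
qed (use finite_I e_in_V in auto)

text \<open>Invariance of the trace under change of basis: with \<open>B\<close> and
  \<open>e\<close> expanded in each other modulo \<open>W\<close>, the sum over \<open>b\<close> of
  \<open>f j b * coef B (e i) b\<close> collapses to \<open>f j (e i)\<close>. Stability of
  \<open>W\<close> under \<open>T\<close> lets \<open>f i (T v)\<close> be computed from the
  coordinates of \<open>v\<close>.\<close>

lemma trace_any_basis:
  assumes B: "quot_basis scale V W B"
    and T: "Vector_Spaces.linear scale scale T" "\<And>v. v \<in> V \<Longrightarrow> T v \<in> V" "\<And>v. v \<in> W \<Longrightarrow> T v \<in> W"
  shows "(\<Sum>b\<in>B. coef B (T b) b) = (\<Sum>i\<in>I. f i (T (e i)))"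
proof -
  interpret T: Vector_Spaces.linear scale scale T by (rule T(1))
  have BV: "b \<in> V" if "b \<in> B" for b using B that by (auto simp: quot_basis_def)
  have coef_f: "coef B v b = (\<Sum>i\<in>I. f i v * coef B (e i) b)" if v: "v \<in> V" for v b
  proof -
    define s where "s = (\<Sum>i\<in>I. scale (f i v) (e i))"
    have s: "s \<in> V" "v - s \<in> W" unfolding s_def by (rule combination_in_V, rule diff_in_W[OF v])
    then have "coef B (v - s + s) b = coef B (v - s) b + coef B s b"
      using W_subset_V by (intro coef_add[OF B]) auto
    then have "coef B v b = coef B s b" by (simp add: coef_W[OF B s(2)])
    also have "\<dots> = (\<Sum>i\<in>I. f i v * coef B (e i) b)"
      unfolding s_def
      using e_in_V subspace_scale[OF subspace_V] by (simp add: coef_sum[OF B] coef_scale[OF B])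
    finally show ?thesis .
  qed
  have f_T: "f i (T v) = (\<Sum>j\<in>I. f j v * f i (T (e j)))" if v: "v \<in> V" and i: "i \<in> I" for i v
  proof -
    have "T (v - (\<Sum>j\<in>I. scale (f j v) (e j))) \<in> W" by (rule T(3)[OF diff_in_W[OF v]])
    then have "f i (T v - (\<Sum>j\<in>I. scale (f j v) (T (e j)))) = 0"
      using i by (simp add: T.diff T.sum T.scale W_eq)
    then show ?thesis using i by (simp add: f_diff f_sum f_scale)
  qed
  have e_B: "f j (e i) = (\<Sum>b\<in>B. coef B (e i) b * f j b)" if "i \<in> I" "j \<in> I" for i j
  proof -
    have "f j (e i - (\<Sum>b\<in>B. scale (coef B (e i) b) b)) = 0"
      using coef_combination[OF B e_in_V[OF that(1)]] that by (simp add: quot_combination_def W_eq)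
    then show ?thesis using that by (simp add: f_diff f_sum f_scale)
  qed
  have "(\<Sum>b\<in>B. coef B (T b) b) = (\<Sum>b\<in>B. \<Sum>i\<in>I. \<Sum>j\<in>I. f j b * f i (T (e j)) * coef B (e i) b)"
    by (intro sum.cong refl) (simp add: coef_f[OF T(2)[OF BV]] f_T[OF BV] sum_distrib_right)
  also have "\<dots> = (\<Sum>i\<in>I. \<Sum>j\<in>I. \<Sum>b\<in>B. f j b * f i (T (e j)) * coef B (e i) b)"
    unfolding sum.swap[of _ I B] ..
  also have "\<dots> = (\<Sum>i\<in>I. \<Sum>j\<in>I. f i (T (e j)) * f j (e i))"
    by (intro sum.cong refl) (simp only: e_B sum_distrib_left, simp only: mult_ac)
  also have "\<dots> = (\<Sum>i\<in>I. \<Sum>j\<in>I. if i = j then f i (T (e i)) else 0)"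
    by (intro sum.cong refl) (simp add: dual)
  also have "\<dots> = (\<Sum>i\<in>I. f i (T (e i)))"
    using finite_I by simp
  finally show ?thesis .
qed

lemma quot_trace:
  assumes "Vector_Spaces.linear scale scale T" "\<And>v. v \<in> V \<Longrightarrow> T v \<in> V" "\<And>v. v \<in> W \<Longrightarrow> T v \<in> W"
  shows "quot_trace scale V W T = (\<Sum>i\<in>I. f i (T (e i)))"
  unfolding quot_trace_eq_coef Let_def
  by (rule trace_any_basis[OF _ assms]) (rule someI, rule quot_basis_e)

text \<open>The trace of the identity is the dimension, so that in characteristic zero the dimension
  is well defined as well.\<close>

lemma quot_basis_card:
  assumes B: "quot_basis scale V W B"
  shows "card B = card I"
proof -
  have "coef B b b = 1" if "b \<in> B" for b
  proof -
    have "(\<Sum>b'\<in>B. scale (if b' = b then 1 else 0) b') = (\<Sum>b'\<in>B. if b' = b then b' else 0)"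
      by (rule sum.cong) auto
    also have "\<dots> = b" using B that by (simp add: quot_basis_def)
    finally have "coef B b = (\<lambda>b'. if b' = b then 1 else 0)"
      using B that subspace_0[OF subspace_W]
      by (intro coef_eqI[OF B]) (auto simp: quot_basis_def quot_combination_def)
    then show ?thesis by simp
  qed
  then have "of_nat (card B) = (\<Sum>b\<in>B. coef B b b)" by simp
  also have "\<dots> = (\<Sum>i\<in>I. f i (e i))"
    using trace_any_basis[OF B linear_ident] by simp
  also have "\<dots> = (of_nat (card I) :: 'f)" by (simp add: dual)
  finally show ?thesis by simp
qed

lemma quot_dim: "quot_dim scale V W = card I"
  unfolding quot_dim_def
  using quot_basis_e quot_basis_card by (intro the_equality) auto

end


section \<open>Evaluation of polynomials\<close>

lemma poly_eval_eq_lin_ext: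
  "poly_eval A \<phi> = lin_ext (ascale A) (\<lambda>w. nonempty_prod (amult A) (map \<phi> w))"
  by (rule ext) (simp add: poly_eval_def lin_ext_def)

lemma free_star_eq_lin_ext:
  "free_star = lin_ext pm_scale (\<lambda>w. Poly_Mapping.single (rev w) (prod_list (map (\<lambda>x. pol_sign (pol x)) w)))"
  by (rule ext) (simp add: free_star_def lin_ext_def mult.commute)

lemma times_eq_sum_singles:
  "p * q = (\<Sum>u\<in>Poly_Mapping.keys p. \<Sum>v\<in>Poly_Mapping.keys q.
     Poly_Mapping.single (u @ v) (Poly_Mapping.lookup p u * Poly_Mapping.lookup q v))"
  for p q :: "('g, 'f::field) gpoly"
proof -
  have "p * q = (\<Sum>u\<in>Poly_Mapping.keys p. Poly_Mapping.single u (Poly_Mapping.lookup p u)) *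
      (\<Sum>v\<in>Poly_Mapping.keys q. Poly_Mapping.single v (Poly_Mapping.lookup q v))"
    by (simp add: sum_single)
  also have "\<dots> = (\<Sum>u\<in>Poly_Mapping.keys p. \<Sum>v\<in>Poly_Mapping.keys q.
     Poly_Mapping.single (u @ v) (Poly_Mapping.lookup p u * Poly_Mapping.lookup q v))"
    by (simp add: sum_product mult_single plus_list_def)
  finally show ?thesis .
qed

lemma free_alg_keys: "p \<in> free_alg \<longleftrightarrow> [] \<notin> Poly_Mapping.keys p"
  by (simp add: free_alg_def in_keys_iff)

lemma subspace_free_alg: "pm.subspace free_alg"
  by (rule pm.subspaceI) (simp_all add: free_alg_def lookup_add)

lemma single_in_free_alg [simp]: "w \<noteq> [] \<Longrightarrow> Poly_Mapping.single w c \<in> free_alg"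
  by (simp add: free_alg_def lookup_single)

lemma keys_times: "Poly_Mapping.keys (p * q) \<subseteq> {u @ v | u v. u \<in> Poly_Mapping.keys p \<and> v \<in> Poly_Mapping.keys q}"
  for p q :: "('g, 'f::field) gpoly"
  using Poly_Mapping.keys_mult[of p q] by (simp add: plus_list_def)

lemma times_in_free_alg: "p \<in> free_alg \<or> q \<in> free_alg \<Longrightarrow> p * q \<in> free_alg"
  for p q :: "('g, 'f::field) gpoly"
  using keys_times[of p q] by (auto simp: free_alg_keys)

definition admissible :: "('a::ab_group_add, 'f, 'g) gstar_alg \<Rightarrow> ('g gvar \<Rightarrow> 'a) \<Rightarrow> bool"
  where "admissible A \<phi> \<longleftrightarrow> (\<forall>x. \<phi> x \<in> signed_comp A (degree x) (pol x))"

lemma gstar_Id_iff: "p \<in> gstar_Id A \<longleftrightarrow> p \<in> free_alg \<and> (\<forall>\<phi>. admissible A \<phi> \<longrightarrow> poly_eval A \<phi> p = 0)"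
proof -
  have "admissible A \<phi> \<longleftrightarrow> (\<forall>i h e. \<phi> (X i h e) \<in> signed_comp A h e)" for \<phi>
    unfolding admissible_def by (metis gvar.collapse gvar.sel)
  then show ?thesis by (simp add: gstar_Id_def)
qed

context gstar_algebra
begin

sublocale vector_space "ascale A" by (rule scale)

abbreviation eval :: "('g gvar \<Rightarrow> 'a) \<Rightarrow> ('g, 'f) gpoly \<Rightarrow> 'a"
  where "eval \<equiv> poly_eval A"

text \<open>The laws of product and involution are assumed only on \<open>acarrier A\<close>, so
  closure facts such as this one are what makes them applicable to values of polynomials.\<close>

lemma subspace_acarrier: "subspace (acarrier A)"
proof (rule subspaceI)
  show "0 \<in> acarrier A"
    unfolding acarrier_def using subspace_0[OF comp_subspace] by (auto intro!: exI[of _ "\<lambda>_. 0"])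
next
  fix a b assume "a \<in> acarrier A" "b \<in> acarrier A"
  then obtain x y where "a = sum x UNIV" "b = sum y UNIV" "\<And>h. x h \<in> hcomp A h" "\<And>h. y h \<in> hcomp A h"
    by (auto simp: acarrier_def)
  then show "a + b \<in> acarrier A"
    unfolding acarrier_def
    by (auto simp: sum.distrib intro!: exI[of _ "\<lambda>h. x h + y h"] subspace_add[OF comp_subspace])
next
  fix a c assume "a \<in> acarrier A"
  then obtain x where "a = sum x UNIV" "\<And>h. x h \<in> hcomp A h" by (auto simp: acarrier_def)
  then show "ascale A c a \<in> acarrier A"
    unfolding acarrier_def
    by (auto simp: scale_sum_right intro!: exI[of _ "\<lambda>h. ascale A c (x h)"] subspace_scale[OF comp_subspace])
qed

lemma comp_subset_acarrier: "a \<in> hcomp A h \<Longrightarrow> a \<in> acarrier A"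
  unfolding acarrier_def
  using subspace_0[OF comp_subspace] by (auto intro!: exI[of _ "\<lambda>k. if k = h then a else 0"])

lemma acarrier_zero: "0 \<in> acarrier A" by (rule subspace_0[OF subspace_acarrier])

lemma mult_zero_left: "b \<in> acarrier A \<Longrightarrow> amult A 0 b = 0"
  using mult_add_left[OF acarrier_zero acarrier_zero] by simp

lemma mult_zero_right: "a \<in> acarrier A \<Longrightarrow> amult A a 0 = 0"
  using mult_add_right[OF _ acarrier_zero acarrier_zero] by simp

lemma star_zero: "astar A 0 = 0"
  using star_add[OF acarrier_zero acarrier_zero] by simp

lemma mult_sum_left:
  assumes "\<And>i. i \<in> S \<Longrightarrow> x i \<in> acarrier A" "b \<in> acarrier A"
  shows "amult A (\<Sum>i\<in>S. x i) b = (\<Sum>i\<in>S. amult A (x i) b)"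
  using assms
proof (induction S rule: infinite_finite_induct)
  case (insert i S)
  then have "(\<Sum>i\<in>S. x i) \<in> acarrier A" by (intro subspace_sum[OF subspace_acarrier]) auto
  with insert show ?case by (simp add: mult_add_left)
qed (simp_all add: mult_zero_left)

lemma mult_sum_right:
  assumes "\<And>i. i \<in> S \<Longrightarrow> x i \<in> acarrier A" "b \<in> acarrier A"
  shows "amult A b (\<Sum>i\<in>S. x i) = (\<Sum>i\<in>S. amult A b (x i))"
  using assms
proof (induction S rule: infinite_finite_induct)
  case (insert i S)
  then have "(\<Sum>i\<in>S. x i) \<in> acarrier A" by (intro subspace_sum[OF subspace_acarrier]) auto
  with insert show ?case by (simp add: mult_add_right)
qed (simp_all add: mult_zero_right)

lemma star_sum:
  assumes "\<And>i. i \<in> S \<Longrightarrow> x i \<in> acarrier A"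
  shows "astar A (\<Sum>i\<in>S. x i) = (\<Sum>i\<in>S. astar A (x i))"
  using assms
proof (induction S rule: infinite_finite_induct)
  case (insert i S)
  then have "(\<Sum>i\<in>S. x i) \<in> acarrier A" by (intro subspace_sum[OF subspace_acarrier]) auto
  with insert show ?case by (simp add: star_add)
qed (simp_all add: star_zero)

lemma mult_in_acarrier:
  assumes "a \<in> acarrier A" "b \<in> acarrier A"
  shows "amult A a b \<in> acarrier A"
proof -
  obtain x y where xy: "a = sum x UNIV" "b = sum y UNIV" "\<And>h. x h \<in> hcomp A h" "\<And>h. y h \<in> hcomp A h"
    using assms by (auto simp: acarrier_def)
  have "amult A a b = (\<Sum>h\<in>UNIV. \<Sum>k\<in>UNIV. amult A (x h) (y k))"
    using assms comp_subset_acarrier[OF xy(3)] comp_subset_acarrier[OF xy(4)]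
    unfolding xy by (simp add: mult_sum_left mult_sum_right) (rule sum.swap)
  also have "\<dots> \<in> acarrier A"
    by (intro subspace_sum[OF subspace_acarrier] comp_subset_acarrier[OF comp_mult[OF xy(3,4)]])
  finally show ?thesis .
qed

lemma nonempty_prod_in_acarrier:
  "xs \<noteq> [] \<Longrightarrow> set xs \<subseteq> acarrier A \<Longrightarrow> nonempty_prod (amult A) xs \<in> acarrier A"
  by (induction "amult A" xs rule: nonempty_prod.induct) (auto intro: mult_in_acarrier)

lemma nonempty_prod_append:
  "xs \<noteq> [] \<Longrightarrow> ys \<noteq> [] \<Longrightarrow> set xs \<subseteq> acarrier A \<Longrightarrow> set ys \<subseteq> acarrier A \<Longrightarrow>
    nonempty_prod (amult A) (xs @ ys) = amult A (nonempty_prod (amult A) xs) (nonempty_prod (amult A) ys)"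
proof (induction "amult A" xs rule: nonempty_prod.induct)
  case (2 x)
  then show ?case by (cases ys) auto
next
  case (3 x y xs)
  then show ?case
    by (simp add: mult_assoc nonempty_prod_in_acarrier)
qed simp

lemma admissibleD:
  assumes "admissible A \<phi>"
  shows "\<phi> x \<in> hcomp A (degree x)" "astar A (\<phi> x) = ascale A (pol_sign (pol x)) (\<phi> x)" "\<phi> x \<in> acarrier A"
  using assms comp_subset_acarrier[of "\<phi> x" "degree x"]
  by (auto simp: admissible_def signed_comp_def split: polarity.splits)

lemma linear_eval: "Vector_Spaces.linear pm_scale (ascale A) (eval \<phi>)"
  unfolding poly_eval_eq_lin_ext by (rule linear_lin_ext)

lemma eval_single: "eval \<phi> (Poly_Mapping.single w c) = ascale A c (nonempty_prod (amult A) (map \<phi> w))"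
  unfolding poly_eval_eq_lin_ext by simp

lemma eval_add: "eval \<phi> (p + q) = eval \<phi> p + eval \<phi> q"
  and eval_scale: "eval \<phi> (pm_scale c p) = ascale A c (eval \<phi> p)"
  using linear_eval by (auto simp: Vector_Spaces.linear_iff)

lemma eval_sum: "eval \<phi> (sum h S) = (\<Sum>s\<in>S. eval \<phi> (h s))"
  using module_hom.sum[OF linear_eval[unfolded module_hom_iff_linear[symmetric]]] by auto

lemma eval_diff: "eval \<phi> (p - q) = eval \<phi> p - eval \<phi> q"
  using eval_add[of \<phi> "p - q" q] by simp

lemma eval_in_acarrier:
  assumes "\<And>x. \<phi> x \<in> acarrier A" "p \<in> free_alg"
  shows "eval \<phi> p \<in> acarrier A"
  unfolding poly_eval_def
  by (intro subspace_sum[OF subspace_acarrier] subspace_scale[OF subspace_acarrier] nonempty_prod_in_acarrier)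
    (use assms in \<open>auto simp: free_alg_keys\<close>)

text \<open>Both factors lie in \<open>free_alg\<close> because \<open>nonempty_prod\<close> is
  \<open>undefined\<close> on the empty word.\<close>

lemma eval_mult:
  assumes \<phi>: "\<And>x. \<phi> x \<in> acarrier A" and p: "p \<in> free_alg" and q: "q \<in> free_alg"
  shows "eval \<phi> (p * q) = amult A (eval \<phi> p) (eval \<phi> q)"
proof -
  let ?n = "\<lambda>w. nonempty_prod (amult A) (map \<phi> w)"
  have n: "?n u \<in> acarrier A" if "u \<noteq> []" for u
    using that \<phi> by (intro nonempty_prod_in_acarrier) auto
  have ne: "u \<noteq> []" "v \<noteq> []" if "u \<in> Poly_Mapping.keys p" "v \<in> Poly_Mapping.keys q" for u v
    using p q that by (auto simp: free_alg_keys)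
  have "eval \<phi> (p * q) = (\<Sum>u\<in>Poly_Mapping.keys p. \<Sum>v\<in>Poly_Mapping.keys q.
      ascale A (Poly_Mapping.lookup p u * Poly_Mapping.lookup q v) (?n (u @ v)))"
    by (simp add: times_eq_sum_singles eval_sum eval_single)
  also have "\<dots> = (\<Sum>u\<in>Poly_Mapping.keys p. \<Sum>v\<in>Poly_Mapping.keys q.
      amult A (ascale A (Poly_Mapping.lookup p u) (?n u)) (ascale A (Poly_Mapping.lookup q v) (?n v)))"
  proof (intro sum.cong refl)
    fix u v assume "u \<in> Poly_Mapping.keys p" "v \<in> Poly_Mapping.keys q"
    then have uv: "u \<noteq> []" "v \<noteq> []" by (rule ne)+
    then have "?n (u @ v) = amult A (?n u) (?n v)"
      using \<phi> nonempty_prod_append[of "map \<phi> u" "map \<phi> v"] by auto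
    then show "ascale A (Poly_Mapping.lookup p u * Poly_Mapping.lookup q v) (?n (u @ v))
        = amult A (ascale A (Poly_Mapping.lookup p u) (?n u)) (ascale A (Poly_Mapping.lookup q v) (?n v))"
      using n[OF uv(1)] n[OF uv(2)] subspace_scale[OF subspace_acarrier]
      by (simp add: mult_scale_left mult_scale_right)
  qed
  also have "\<dots> = amult A (eval \<phi> p) (eval \<phi> q)"
  proof -
    have "ascale A c (?n u) \<in> acarrier A" if "u \<in> Poly_Mapping.keys p \<union> Poly_Mapping.keys q" for u c
      using that p q by (intro subspace_scale[OF subspace_acarrier] n) (auto simp: free_alg_keys)
    then show ?thesis
      using eval_in_acarrier[OF \<phi> p] eval_in_acarrier[OF \<phi> q]
      unfolding poly_eval_def by (simp add: mult_sum_left mult_sum_right) (rule sum.swap)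
  qed
  finally show ?thesis .
qed

lemma eval_in_comp:
  assumes \<phi>: "admissible A \<phi>" and p: "p \<in> free_comp h"
  shows "eval \<phi> p \<in> hcomp A h"
proof -
  have *: "w \<noteq> [] \<Longrightarrow> nonempty_prod (amult A) (map \<phi> w) \<in> hcomp A (sum_list (map degree w))" for w
  proof (induction w)
    case (Cons x w)
    then show ?case by (cases w) (auto intro: admissibleD[OF \<phi>] comp_mult)
  qed simp
  have "nonempty_prod (amult A) (map \<phi> w) \<in> hcomp A h" if "w \<in> Poly_Mapping.keys p" for w
    using p that *[of w] by (auto simp: free_comp_def free_alg_keys)
  then show ?thesis
    unfolding poly_eval_def by (intro subspace_sum[OF comp_subspace] subspace_scale[OF comp_subspace])
qed

lemma eval_star:
  assumes \<phi>: "admissible A \<phi>" and p: "p \<in> free_alg"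
  shows "eval \<phi> (free_star p) = astar A (eval \<phi> p)"
proof -
  let ?n = "\<lambda>w. nonempty_prod (amult A) (map \<phi> w)"
  let ?s = "\<lambda>w. prod_list (map (\<lambda>x. pol_sign (pol x)) w) :: 'f"
  have n: "?n u \<in> acarrier A" if "u \<noteq> []" for u
    using that admissibleD(3)[OF \<phi>] by (intro nonempty_prod_in_acarrier) auto
  have star_n: "w \<noteq> [] \<Longrightarrow> astar A (?n w) = ascale A (?s w) (?n (rev w))" for w
  proof (induction w)
    case (Cons x w)
    show ?case
    proof (cases "w = []")
      case False
      then have "?n (x # w) = amult A (\<phi> x) (?n w)" by (cases w) auto
      then have "astar A (?n (x # w)) = amult A (ascale A (?s w) (?n (rev w))) (ascale A (pol_sign (pol x)) (\<phi> x))"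
        using False Cons n admissibleD[OF \<phi>] by (simp add: star_mult)
      also have "\<dots> = ascale A (?s (x # w)) (amult A (?n (rev w)) (\<phi> x))"
        using n[of "rev w"] False admissibleD(3)[OF \<phi>] subspace_scale[OF subspace_acarrier]
        by (simp add: mult_scale_left mult_scale_right mult.commute)
      also have "amult A (?n (rev w)) (\<phi> x) = ?n (rev (x # w))"
        using nonempty_prod_append[of "map \<phi> (rev w)" "[\<phi> x]"] False admissibleD(3)[OF \<phi>]
        by (simp add: image_subset_iff)
      finally show ?thesis .
    qed (simp add: admissibleD[OF \<phi>])
  qed simp
  have ne: "w \<noteq> []" if "w \<in> Poly_Mapping.keys p" for w
    using p that by (auto simp: free_alg_keys)
  have "astar A (eval \<phi> p) = (\<Sum>w\<in>Poly_Mapping.keys p. astar A (ascale A (Poly_Mapping.lookup p w) (?n w)))"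
    unfolding poly_eval_def
    by (intro star_sum subspace_scale[OF subspace_acarrier] n) (use ne in auto)
  also have "\<dots> = (\<Sum>w\<in>Poly_Mapping.keys p. ascale A (?s w * Poly_Mapping.lookup p w) (?n (rev w)))"
    by (intro sum.cong refl) (simp add: star_scale n ne star_n mult.commute)
  also have "\<dots> = eval \<phi> (free_star p)"
    by (simp add: free_star_def eval_sum eval_single)
  finally show ?thesis by simp
qed

lemma subspace_gstar_Id: "pm.subspace (gstar_Id A)"
  by (rule pm.subspaceI)
    (auto simp: gstar_Id_iff eval_add eval_scale poly_eval_def[of _ _ 0]
      intro: pm.subspace_0 pm.subspace_add pm.subspace_scale subspace_free_alg)

end


section \<open>The free algebra and its endomorphisms\<close>

text \<open>As an instance of \<open>gstar_algebra\<close>, the free algebra inherits the evaluation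
  lemmas; evaluations in it are substitutions.\<close>

definition free_gstar :: "(('g, 'f::field) gpoly, 'f, 'g::{finite,ab_group_add}) gstar_alg"
  where "free_gstar = \<lparr>amult = (*), ascale = pm_scale, hcomp = free_comp, astar = free_star\<rparr>"

lemma free_gstar_simps [simp]:
  "amult free_gstar = (*)" "ascale free_gstar = pm_scale" "hcomp free_gstar = free_comp"
  "astar free_gstar = free_star"
  by (simp_all add: free_gstar_def)

lemma subspace_free_comp: "pm.subspace (free_comp h :: ('g::ab_group_add, 'f::field) gpoly set)"
proof (rule pm.subspaceI)
  fix p q :: "('g, 'f) gpoly" assume "p \<in> free_comp h" "q \<in> free_comp h"
  then show "p + q \<in> free_comp h"
    using Poly_Mapping.keys_add[of p q] by (auto simp: free_comp_def free_alg_keys)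
qed (auto simp: free_comp_def free_alg_def in_keys_iff)

lemma acarrier_free_gstar: "acarrier free_gstar = (free_alg :: ('g::{finite,ab_group_add}, 'f::field) gpoly set)"
proof
  show "acarrier free_gstar \<subseteq> (free_alg :: ('g, 'f) gpoly set)"
    unfolding acarrier_def
    by (auto simp: free_comp_def intro!: pm.subspace_sum[OF subspace_free_alg])
next
  show "(free_alg :: ('g, 'f) gpoly set) \<subseteq> acarrier free_gstar"
  proof
    fix p :: "('g, 'f) gpoly" assume p: "p \<in> free_alg"
    define x where "x h = (\<Sum>w\<in>{w \<in> Poly_Mapping.keys p. sum_list (map degree w) = h}.
      Poly_Mapping.single w (Poly_Mapping.lookup p w))" for h :: 'g
    have "x h \<in> free_comp h" for h
      unfolding x_def
      by (intro pm.subspace_sum[OF subspace_free_comp])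
        (use p in \<open>auto simp: free_comp_def free_alg_keys\<close>)
    moreover have "(\<Sum>h\<in>UNIV. x h) = p"
      unfolding x_def by (subst sum.group) (auto simp: sum_single)
    ultimately show "p \<in> acarrier free_gstar" by (auto simp: acarrier_def)
  qed
qed

lemma linear_free_star: "Vector_Spaces.linear pm_scale pm_scale free_star"
  unfolding free_star_eq_lin_ext by (rule pm.linear_lin_ext)

interpretation free_star: Vector_Spaces.linear pm_scale pm_scale free_star
  by (rule linear_free_star)

definition word_sign :: "'g gvar list \<Rightarrow> 'f::field"
  where "word_sign w = prod_list (map (\<lambda>x. pol_sign (pol x)) w)"

lemma word_sign_append: "word_sign (u @ v) = word_sign v * word_sign u"
  by (simp add: word_sign_def mult.commute)

lemma word_sign_rev: "word_sign (rev w) = word_sign w"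
  unfolding word_sign_def rev_map[symmetric] by (rule prod_list.rev)

lemma word_sign_square: "word_sign w * word_sign w = (1 :: 'f::field)"
proof (induction w)
  case (Cons x w)
  have "word_sign (x # w) * word_sign (x # w) = (pol_sign (pol x) * pol_sign (pol x)) * (word_sign w * word_sign w :: 'f)"
    unfolding word_sign_def by (simp only: list.map prod_list.Cons mult_ac)
  also have "\<dots> = 1" by (cases "pol x") (simp_all add: Cons)
  finally show ?case .
qed (simp add: word_sign_def)

lemma free_star_single [simp]:
  "free_star (Poly_Mapping.single w c) = Poly_Mapping.single (rev w) (word_sign w * c)"
  by (simp add: free_star_eq_lin_ext word_sign_def mult.commute)

lemma keys_free_star: "Poly_Mapping.keys (free_star p) \<subseteq> rev ` Poly_Mapping.keys p"
  unfolding free_star_def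
  by (rule order_trans[OF keys_sum]) (auto split: if_splits)

lemma free_star_in_free_alg: "p \<in> free_alg \<Longrightarrow> free_star p \<in> free_alg"
  using keys_free_star[of p] by (auto simp: free_alg_keys)

lemma free_star_free_star: "free_star (free_star p) = p" for p :: "('g, 'f::field) gpoly"
proof -
  have "free_star (free_star (Poly_Mapping.single w c)) = Poly_Mapping.single w c"
    for w :: "'g gvar list" and c :: 'f
    unfolding free_star_single rev_rev_ident word_sign_rev mult.assoc[symmetric] word_sign_square by simp
  then have "(\<Sum>w\<in>Poly_Mapping.keys p. free_star (free_star (Poly_Mapping.single w (Poly_Mapping.lookup p w)))) = p"
    by (simp only: sum_single)
  then have "free_star (free_star (\<Sum>w\<in>Poly_Mapping.keys p. Poly_Mapping.single w (Poly_Mapping.lookup p w))) = p"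
    by (simp only: free_star.sum)
  then show ?thesis by (simp only: sum_single)
qed

lemma free_star_mult: "free_star (p * q) = free_star q * free_star p"
  for p q :: "('g, 'f::field) gpoly"
proof -
  have *: "Poly_Mapping.single (rev (u @ v)) (word_sign (u @ v) * (c * d)) =
      Poly_Mapping.single (rev v) (word_sign v * d) * Poly_Mapping.single (rev u) (word_sign u * c)"
    for u v :: "'g gvar list" and c d :: 'f
    unfolding mult_single plus_list_def rev_append word_sign_append by (simp only: mult_ac)
  have "free_star (p * q) = (\<Sum>u\<in>Poly_Mapping.keys p. \<Sum>v\<in>Poly_Mapping.keys q.
      free_star (Poly_Mapping.single v (Poly_Mapping.lookup q v)) * free_star (Poly_Mapping.single u (Poly_Mapping.lookup p u)))"
    unfolding times_eq_sum_singles free_star.sum free_star_single * ..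
  also have "\<dots> = (\<Sum>v\<in>Poly_Mapping.keys q. \<Sum>u\<in>Poly_Mapping.keys p.
      free_star (Poly_Mapping.single v (Poly_Mapping.lookup q v)) * free_star (Poly_Mapping.single u (Poly_Mapping.lookup p u)))"
    by (rule sum.swap)
  also have "\<dots> = free_star q * free_star p"
    unfolding sum_product[symmetric] free_star.sum[symmetric] sum_single ..
  finally show ?thesis .
qed

lemma free_star_in_comp:
  assumes p: "p \<in> free_comp h"
  shows "free_star p \<in> free_comp h"
proof -
  have "w \<noteq> [] \<and> sum_list (map degree w) = h" if w: "w \<in> Poly_Mapping.keys (free_star p)" for w
  proof -
    obtain v where "w = rev v" "v \<in> Poly_Mapping.keys p" using w keys_free_star[of p] by auto
    then show ?thesis using p by (auto simp: free_comp_def free_alg_keys rev_map[symmetric] sum_list_rev)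
  qed
  then show ?thesis by (auto simp: free_comp_def free_alg_keys)
qed

lemma mult_in_free_comp:
  fixes p q :: "('g::ab_group_add, 'f::field) gpoly"
  assumes p: "p \<in> free_comp h" and q: "q \<in> free_comp k"
  shows "p * q \<in> free_comp (h + k)"
proof -
  have "sum_list (map degree w) = h + k" if w: "w \<in> Poly_Mapping.keys (p * q)" for w
  proof -
    obtain u v where "w = u @ v" "u \<in> Poly_Mapping.keys p" "v \<in> Poly_Mapping.keys q"
      using w keys_times[of p q] by auto
    then show ?thesis using p q by (simp add: free_comp_def)
  qed
  then show ?thesis using p times_in_free_alg[of p q] by (simp add: free_comp_def)
qed

lemma free_comp_direct:
  fixes x :: "'g \<Rightarrow> ('g::{finite,ab_group_add}, 'f::field) gpoly"
  assumes x: "\<And>h. x h \<in> free_comp h" and 0: "(\<Sum>h\<in>UNIV. x h) = 0"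
  shows "x h = 0"
proof (rule poly_mapping_eqI)
  fix w
  have k: "Poly_Mapping.lookup (x k) w = 0" if "sum_list (map degree w) \<noteq> k" for k
    using x[of k] that by (auto simp: free_comp_def in_keys_iff)
  have "Poly_Mapping.lookup (x h) w = (\<Sum>k\<in>UNIV. Poly_Mapping.lookup (x k) w)" if "sum_list (map degree w) = h"
  proof -
    have "(\<Sum>k\<in>UNIV. Poly_Mapping.lookup (x k) w) = (\<Sum>k\<in>{h}. Poly_Mapping.lookup (x k) w)"
      using that by (intro sum.mono_neutral_right) (auto simp: k)
    then show ?thesis by simp
  qed
  also have "(\<Sum>k\<in>UNIV. Poly_Mapping.lookup (x k) w) = Poly_Mapping.lookup (\<Sum>k\<in>UNIV. x k) w"
    by (simp only: lookup_sum)
  finally show "Poly_Mapping.lookup (x h) w = Poly_Mapping.lookup 0 w"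
    using k[of h] 0 by auto
qed

lemma
  fixes p q :: "('g, 'f::field) gpoly"
  shows pm_scale_mult_left: "pm_scale r p * q = pm_scale r (p * q)"
    and pm_scale_mult_right: "p * pm_scale r q = pm_scale r (p * q)"
proof -
  show "pm_scale r p * q = pm_scale r (p * q)"
    by (simp add: pm_scale_def mult_map_scale_conv_mult mult.assoc)
  have "(\<Sum>u\<in>Poly_Mapping.keys p. Poly_Mapping.single u (Poly_Mapping.lookup p u)) * Poly_Mapping.single 0 r =
      Poly_Mapping.single 0 r * (\<Sum>u\<in>Poly_Mapping.keys p. Poly_Mapping.single u (Poly_Mapping.lookup p u))"
    unfolding sum_distrib_left sum_distrib_right by (simp add: mult_single mult.commute)
  then have "p * Poly_Mapping.single 0 r = Poly_Mapping.single 0 r * p" by (simp only: sum_single)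
  then show "p * pm_scale r q = pm_scale r (p * q)"
    by (simp add: pm_scale_def mult_map_scale_conv_mult mult.assoc[symmetric])
qed

interpretation free: gstar_algebra free_gstar
proof (rule gstar_algebra.intro, unfold acarrier_free_gstar free_gstar_simps)
  show "x h = 0" if "\<And>h. x h \<in> free_comp h" "(\<Sum>h\<in>UNIV. x h) = 0"
    for x :: "'a \<Rightarrow> ('a, 'b) gpoly" and h
    using that by (rule free_comp_direct)
qed (rule pm.vector_space_axioms subspace_free_comp mult_in_free_comp free_star_in_comp mult.assoc
    distrib_left distrib_right pm_scale_mult_left pm_scale_mult_right free_star.add
    free_star.scale free_star_mult free_star_free_star; assumption)+

text \<open>Through this a T-ideal admits substitution of homogeneous elements of the right sign for
  the variables of its members.\<close>

lemma eval_free_endo: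
  assumes "admissible free_gstar \<theta>"
  shows "gstar_endo (poly_eval free_gstar \<theta>)"
  unfolding gstar_endo_def
proof (intro conjI ballI allI)
  note acarrier = free.admissibleD(3)[OF assms]
  fix p q :: "('a, 'b) gpoly" and c h
  show "poly_eval free_gstar \<theta> (p + q) = poly_eval free_gstar \<theta> p + poly_eval free_gstar \<theta> q"
    by (rule free.eval_add)
  show "poly_eval free_gstar \<theta> (pm_scale c p) = pm_scale c (poly_eval free_gstar \<theta> p)"
    using free.eval_scale[of \<theta> c p] by simp
  show "poly_eval free_gstar \<theta> p \<in> free_comp h" if "p \<in> free_comp h"
    using free.eval_in_comp[OF assms that] by simp
  assume p: "p \<in> free_alg"
  show "poly_eval free_gstar \<theta> p \<in> free_alg"
    using free.eval_in_acarrier[OF acarrier p] by (simp add: acarrier_free_gstar)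
  show "poly_eval free_gstar \<theta> (free_star p) = free_star (poly_eval free_gstar \<theta> p)"
    using free.eval_star[OF assms p] by simp
  assume "q \<in> free_alg"
  with p show "poly_eval free_gstar \<theta> (p * q) = poly_eval free_gstar \<theta> p * poly_eval free_gstar \<theta> q"
    using free.eval_mult[OF acarrier] by simp
qed

lemma gstar_endoD:
  assumes "gstar_endo \<phi>"
  shows "p \<in> free_alg \<Longrightarrow> \<phi> p \<in> free_alg"
    and "p \<in> free_alg \<Longrightarrow> q \<in> free_alg \<Longrightarrow> \<phi> (p + q) = \<phi> p + \<phi> q"
    and "p \<in> free_alg \<Longrightarrow> \<phi> (pm_scale c p) = pm_scale c (\<phi> p)"
    and "p \<in> free_alg \<Longrightarrow> q \<in> free_alg \<Longrightarrow> \<phi> (p * q) = \<phi> p * \<phi> q"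
    and "p \<in> free_comp h \<Longrightarrow> \<phi> p \<in> free_comp h"
    and "p \<in> free_alg \<Longrightarrow> \<phi> (free_star p) = free_star (\<phi> p)"
  using assms unfolding gstar_endo_def by blast+

context gstar_algebra
begin

text \<open>An endomorphism is determined on \<open>free_alg\<close> by the images of the variables,
  so following it by an evaluation is again an evaluation, at the values of those images.\<close>

lemma eval_endo:
  assumes \<phi>: "gstar_endo \<phi>" and \<psi>: "admissible A \<psi>" and p: "p \<in> free_alg"
  shows "eval \<psi> (\<phi> p) = eval (\<lambda>x. eval \<psi> (\<phi> (Poly_Mapping.single [x] 1))) p"
proof -
  note endo = gstar_endoD[OF \<phi>]
  note mult = eval_mult[OF admissibleD(3)[OF \<psi>]]
  let ?\<theta> = "\<lambda>x. eval \<psi> (\<phi> (Poly_Mapping.single [x] 1))"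
  have word: "w \<noteq> [] \<Longrightarrow> eval \<psi> (\<phi> (Poly_Mapping.single w 1)) = nonempty_prod (amult A) (map ?\<theta> w)" for w
  proof (induction w)
    case (Cons x w)
    show ?case
    proof (cases w)
      case (Cons y v)
      have "Poly_Mapping.single (x # w) (1::'f) = Poly_Mapping.single [x] 1 * Poly_Mapping.single w 1"
        by (simp add: mult_single plus_list_def)
      then have "eval \<psi> (\<phi> (Poly_Mapping.single (x # w) 1))
          = amult A (eval \<psi> (\<phi> (Poly_Mapping.single [x] 1))) (eval \<psi> (\<phi> (Poly_Mapping.single w 1)))"
        using Cons by (simp only: endo(1,4) mult single_in_free_alg list.distinct simp_thms)
      then show ?thesis using Cons Cons.IH by simp
    qed simp
  qed simp
  \<comment> \<open>\<open>gstar_endo\<close> constrains \<open>\<phi>\<close> on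
    \<open>free_alg\<close> only, so the lemmas on linear maps do not apply and additivity over sums
    is proved by induction.\<close>
  have sum: "\<phi> (\<Sum>w\<in>S. pm_scale (c w) (Poly_Mapping.single w 1)) = (\<Sum>w\<in>S. pm_scale (c w) (\<phi> (Poly_Mapping.single w 1)))"
    if "finite S" "[] \<notin> S" for S c
    using that
  proof (induction S)
    case empty
    have "\<phi> 0 = pm_scale 0 (\<phi> 0)" using endo(3)[of 0 0] pm.subspace_0[OF subspace_free_alg] by simp
    then show ?case by simp
  next
    case (insert w S)
    then have w: "Poly_Mapping.single w (1::'f) \<in> free_alg" by auto
    have "(\<Sum>w\<in>S. pm_scale (c w) (Poly_Mapping.single w 1)) \<in> free_alg"
      using insert by (intro pm.subspace_sum[OF subspace_free_alg] pm.subspace_scale[OF subspace_free_alg] single_in_free_alg) auto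
    then have "\<phi> (pm_scale (c w) (Poly_Mapping.single w 1) + (\<Sum>w\<in>S. pm_scale (c w) (Poly_Mapping.single w 1)))
        = pm_scale (c w) (\<phi> (Poly_Mapping.single w 1)) + \<phi> (\<Sum>w\<in>S. pm_scale (c w) (Poly_Mapping.single w 1))"
      using pm.subspace_scale[OF subspace_free_alg w] by (simp only: endo(2) endo(3)[OF w])
    then show ?case using insert by simp
  qed
  have "\<phi> p = (\<Sum>w\<in>Poly_Mapping.keys p. pm_scale (Poly_Mapping.lookup p w) (\<phi> (Poly_Mapping.single w 1)))"
    using sum[of "Poly_Mapping.keys p" "Poly_Mapping.lookup p"] p
    unfolding pm_scale_single mult_1_right sum_single free_alg_keys by simp
  then have "eval \<psi> (\<phi> p) = eval \<psi> (\<Sum>w\<in>Poly_Mapping.keys p. pm_scale (Poly_Mapping.lookup p w) (\<phi> (Poly_Mapping.single w 1)))"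
    by (rule arg_cong)
  also have "\<dots> = (\<Sum>w\<in>Poly_Mapping.keys p. ascale A (Poly_Mapping.lookup p w) (nonempty_prod (amult A) (map ?\<theta> w)))"
    unfolding eval_sum eval_scale
    by (intro sum.cong refl arg_cong[where f = "ascale A _"] word) (use p in \<open>auto simp: free_alg_keys\<close>)
  finally show ?thesis by (simp add: poly_eval_def)
qed

lemma admissible_endo:
  assumes \<phi>: "gstar_endo \<phi>" and \<psi>: "admissible A \<psi>"
  shows "admissible A (\<lambda>x. eval \<psi> (\<phi> (Poly_Mapping.single [x] 1)))"
  unfolding admissible_def
proof
  fix x :: "'g gvar"
  note endo = gstar_endoD[OF \<phi>]
  let ?p = "Poly_Mapping.single [x] 1 :: ('g, 'f) gpoly"
  have "?p \<in> free_comp (degree x)" by (simp add: free_comp_def)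
  then have 1: "eval \<psi> (\<phi> ?p) \<in> hcomp A (degree x)" by (intro eval_in_comp[OF \<psi>] endo(5))
  have "astar A (eval \<psi> (\<phi> ?p)) = eval \<psi> (\<phi> (free_star ?p))"
    by (simp add: eval_star[OF \<psi>] endo(1,6) del: free_star_single)
  \<comment> \<open>A variable is an eigenvector of the involution, and its image remains one
    because \<open>\<phi>\<close> commutes with scaling and with the involution.\<close>
  also have "free_star ?p = pm_scale (pol_sign (pol x)) ?p" by (simp add: word_sign_def)
  also have "eval \<psi> (\<phi> \<dots>) = ascale A (pol_sign (pol x)) (eval \<psi> (\<phi> ?p))"
    by (subst endo(3)) (simp_all add: eval_scale)
  finally show "eval \<psi> (\<phi> ?p) \<in> signed_comp A (degree x) (pol x)"
    using 1 by (cases "pol x") (simp_all add: signed_comp_def)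
qed

lemma TGstar_ideal_gstar_Id: "TGstar_ideal (gstar_Id A)"
  unfolding TGstar_ideal_def
proof (intro conjI ballI allI impI)
  show "gstar_Id A \<subseteq> free_alg" by (auto simp: gstar_Id_iff)
next
  fix p q :: "('g, 'f) gpoly" assume p: "p \<in> free_alg" and q: "q \<in> gstar_Id A"
  have "eval \<phi> (p * q) = 0 \<and> eval \<phi> (q * p) = 0" if \<phi>: "admissible A \<phi>" for \<phi>
  proof -
    note acarrier = admissibleD(3)[OF \<phi>]
    have "eval \<phi> q = 0" "q \<in> free_alg" using q \<phi> by (auto simp: gstar_Id_iff)
    then show ?thesis
      using eval_mult[OF acarrier p] eval_mult[OF acarrier _ p] eval_in_acarrier[OF acarrier p]
      by (simp add: mult_zero_left mult_zero_right)
  qed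
  then show "p * q \<in> gstar_Id A" "q * p \<in> gstar_Id A"
    using times_in_free_alg[of p q] times_in_free_alg[of q p] p by (simp_all add: gstar_Id_iff)
next
  fix q :: "('g, 'f) gpoly" assume q: "q \<in> gstar_Id A"
  then have "eval \<phi> (free_star q) = 0" if \<phi>: "admissible A \<phi>" for \<phi>
    using eval_star[OF \<phi>, of q] \<phi> by (simp add: gstar_Id_iff star_zero)
  then show "free_star q \<in> gstar_Id A"
    using q free_star_in_free_alg[of q] by (simp add: gstar_Id_iff)
next
  fix \<phi> :: "('g, 'f) gpoly \<Rightarrow> ('g, 'f) gpoly" and q
  assume \<phi>: "gstar_endo \<phi>" and q: "q \<in> gstar_Id A"
  have "eval \<psi> (\<phi> q) = 0" if \<psi>: "admissible A \<psi>" for \<psi>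
    using q admissible_endo[OF \<phi> \<psi>] eval_endo[OF \<phi> \<psi>, of q] by (simp add: gstar_Id_iff)
  then show "\<phi> q \<in> gstar_Id A"
    using q gstar_endoD(1)[OF \<phi>, of q] by (simp add: gstar_Id_iff)
qed (rule subspace_gstar_Id)

end


section \<open>Polynomials modulo the \<open>T\<close>-ideal of \<open>N3\<close>\<close>

abbreviation word :: "'g gvar list \<Rightarrow> ('g, 'f::field) gpoly"
  where "word w \<equiv> Poly_Mapping.single w 1"

lemma word_append: "word (u @ v) = word u * word v"
  by (simp add: mult_single plus_list_def)

lemma word_Nil: "word [] = 1"
  by (metis single_one zero_list_def)

lemma word_in_free_comp: "w \<noteq> [] \<Longrightarrow> word w \<in> free_comp (sum_list (map degree w))"
  by (simp add: free_comp_def)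

section \<open>Linear functionals on words and the vanishing condition\<close>

definition ywords :: "'g::zero gvar list set"
  where "ywords = {w. \<forall>x\<in>set w. degree x = 0 \<and> pol x = Plus}"

lemma ywords_simps [simp]:
  "[] \<in> ywords" "x # w \<in> ywords \<longleftrightarrow> degree x = 0 \<and> pol x = Plus \<and> w \<in> ywords"
  "u @ v \<in> ywords \<longleftrightarrow> u \<in> ywords \<and> v \<in> ywords"
  by (auto simp: ywords_def)

lemma ywords_mset: "mset u = mset v \<Longrightarrow> u \<in> ywords \<longleftrightarrow> v \<in> ywords"
  unfolding ywords_def by (auto dest: mset_eq_setD)

lemma word_ywords: "w \<in> ywords \<Longrightarrow> w \<noteq> [] \<Longrightarrow> word w \<in> free_comp 0"
proof -
  assume w: "w \<in> ywords" "w \<noteq> []"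
  then have "map degree w = map (\<lambda>_. 0) w" by (intro map_cong) (auto simp: ywords_def)
  then have "sum_list (map degree w) = 0" by (simp del: map_eq_conv)
  then show ?thesis using word_in_free_comp[OF w(2)] by simp
qed

text \<open>Meant for words with a single letter \<open>z\<close> of nonzero degree, where it counts
  the occurrences of \<open>y\<close> to the left of \<open>z\<close>.\<close>

definition prefix_count :: "'g::zero gvar \<Rightarrow> 'g gvar list \<Rightarrow> nat"
  where "prefix_count y w = count_list (takeWhile (\<lambda>x. degree x = 0) w) y"

lemma prefix_count_split: "u \<in> ywords \<Longrightarrow> degree z \<noteq> 0 \<Longrightarrow> prefix_count y (u @ z # v) = count_list u y"
  unfolding prefix_count_def by (subst takeWhile_append2) (auto simp: ywords_def)

text \<open>The coefficient of the commutative monomial \<open>m\<close> after all variables are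
  made to commute.\<close>

definition content_sum :: "'g gvar multiset \<Rightarrow> ('g, 'f::field) gpoly \<Rightarrow> 'f"
  where "content_sum m = lin_ext (*) (\<lambda>w. if mset w = m then 1 else 0)"

text \<open>In the normal form of \<open>move_minus\<close>, with \<open>z\<close> the letter of
  degree \<open>g\<close> in \<open>m\<close>, this is the coefficient of \<open>[y, z]\<close>
  times the remaining letters.\<close>

definition prefix_sum :: "'g::zero gvar multiset \<Rightarrow> 'g gvar \<Rightarrow> ('g, 'f::field) gpoly \<Rightarrow> 'f"
  where "prefix_sum m y = lin_ext (*) (\<lambda>w. if mset w = m then of_nat (prefix_count y w) else 0)"

lemma content_sum_eq:
  "content_sum m p = (\<Sum>w\<in>{w \<in> Poly_Mapping.keys p. mset w = m}. Poly_Mapping.lookup p w)"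
  unfolding content_sum_def lin_ext_def
  by (rule sum.mono_neutral_cong_right) auto

lemma prefix_sum_eq:
  "prefix_sum m y p = (\<Sum>w\<in>{w \<in> Poly_Mapping.keys p. mset w = m}. Poly_Mapping.lookup p w * of_nat (prefix_count y w))"
  unfolding prefix_sum_def lin_ext_def
  by (rule sum.mono_neutral_cong_right) auto

text \<open>Contents with two letters of degree \<open>g\<close>, with a skew letter of degree 0 or
  with a letter of another degree are left free: words of such content lie in the T-ideal by
  \<open>word_cases\<close>. Prefixes are tested only for skew \<open>z\<close>, since a symmetric
  one is central.\<close>

definition sums_vanish :: "'g::zero \<Rightarrow> ('g, 'f::field) gpoly \<Rightarrow> bool"
  where "sums_vanish g p \<longleftrightarrow> (\<forall>c\<in>ywords. content_sum (mset c) p = 0 \<and>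
    (\<forall>z. degree z = g \<longrightarrow> content_sum (mset (z # c)) p = 0 \<and>
      (pol z = Minus \<longrightarrow> (\<forall>y\<in>set c. prefix_sum (mset (z # c)) y p = 0))))"

lemma (in gstar_algebra) admissible_zero: "admissible A (\<lambda>_. 0)"
  unfolding admissible_def signed_comp_def
  using subspace_0[OF comp_subspace] by (auto simp: star_zero split: polarity.splits)

lemma admissible_upd:
  "admissible A \<theta> \<Longrightarrow> a \<in> signed_comp A (degree x) (pol x) \<Longrightarrow> admissible A (\<theta>(x := a))"
  by (simp add: admissible_def)

lemma mset_eq_split:
  assumes "mset w = mset (u @ z # v)"
  obtains u' v' where "w = u' @ z # v'" "mset (u' @ v') = mset (u @ v)"
proof -
  have "z \<in> set w" using mset_eq_setD[OF assms] by simp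
  then obtain u' v' where "w = u' @ z # v'" by (meson split_list)
  then show ?thesis using assms that[of u' v'] by simp
qed

text \<open>The generators other than the commutator, which \<open>N3\<close> and \<open>A2\<close>
  have in common. The T-ideal \<open>I\<close> stays arbitrary: it is later both an ideal of
  identities and any T-ideal containing the generators.\<close>

locale degree_relations =
  fixes g :: "'g::{finite,ab_group_add}" and I :: "('g, 'f::field_char_0) gpoly set"
  assumes g: "g \<noteq> 0"
    and ideal: "TGstar_ideal I"
    and skew_gen: "var 0 0 Minus \<in> I"
    and prod_gen: "var 0 g d * var 1 g e \<in> I"
    and degree_gen: "r \<noteq> 0 \<Longrightarrow> r \<noteq> g \<Longrightarrow> var 0 r e \<in> I"
begin

lemma subspace_I: "pm.subspace I"
  and mult_I: "p \<in> free_alg \<Longrightarrow> q \<in> I \<Longrightarrow> p * q \<in> I" "p \<in> free_alg \<Longrightarrow> q \<in> I \<Longrightarrow> q * p \<in> I"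
  and endo_I: "gstar_endo \<phi> \<Longrightarrow> q \<in> I \<Longrightarrow> \<phi> q \<in> I"
  using ideal unfolding TGstar_ideal_def by blast+

lemmas I_add = pm.subspace_add[OF subspace_I]
lemmas I_diff = pm.subspace_diff[OF subspace_I]
lemmas I_scale = pm.subspace_scale[OF subspace_I]
lemmas I_sum = pm.subspace_sum[OF subspace_I]
lemmas I_zero = pm.subspace_0[OF subspace_I]

lemma word_mult_I:
  assumes "q \<in> I"
  shows "word u * q \<in> I" "q * word u \<in> I"
  using assms mult_I[of "word u" q] by (cases "u = []"; simp add: word_Nil)+

lemma subst_I: "q \<in> I \<Longrightarrow> admissible free_gstar \<theta> \<Longrightarrow> poly_eval free_gstar \<theta> q \<in> I"
  by (rule endo_I[OF eval_free_endo])

lemma eval_var: "poly_eval free_gstar \<theta> (var i h e) = \<theta> (X i h e)" for \<theta> :: "'g gvar \<Rightarrow> ('g, 'f) gpoly"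
  by (simp add: var_def free.eval_single[unfolded free_gstar_simps])

lemma eval_var_mult:
  "poly_eval free_gstar \<theta> (var i h e * var j k d) = \<theta> (X i h e) * \<theta> (X j k d)"
  for \<theta> :: "'g gvar \<Rightarrow> ('g, 'f) gpoly"
  by (simp add: var_def mult_single plus_list_def free.eval_single[unfolded free_gstar_simps])

lemmas admissible_free = admissible_upd[OF free.admissible_zero]

text \<open>Relations in signed variables can be specialized only to symmetric or skew elements;
  halving extends them to all homogeneous elements.\<close>

lemma split_symmetric:
  fixes q :: "('g, 'f) gpoly"
  assumes "q \<in> free_comp h"
  obtains a b where "q = a + b" "a \<in> signed_comp free_gstar h Plus" "b \<in> signed_comp free_gstar h Minus"
proof
  let ?a = "pm_scale (1/2) (q + free_star q)" and ?b = "pm_scale (1/2) (q - free_star q)"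
  have "free_star q \<in> free_comp h" by (rule free_star_in_comp) fact
  then have "?a \<in> free_comp h" "?b \<in> free_comp h"
    using assms by (auto intro!: pm.subspace_scale[OF subspace_free_comp] pm.subspace_add[OF subspace_free_comp]
      pm.subspace_diff[OF subspace_free_comp])
  then show "?a \<in> signed_comp free_gstar h Plus" "?b \<in> signed_comp free_gstar h Minus"
    by (simp_all add: signed_comp_def free_star.scale free_star.add free_star.diff free_star_free_star add.commute
      pm.scale_minus_right[symmetric] del: pm.scale_minus_right)
  show "q = ?a + ?b"
    by (rule poly_mapping_eqI) (simp add: lookup_add lookup_minus field_simps)
qed

lemma skew_I: "q \<in> signed_comp free_gstar 0 Minus \<Longrightarrow> q \<in> I"
  using subst_I[OF skew_gen admissible_free[of q "X 0 0 Minus"]] by (simp add: eval_var)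

lemma degree_I: "r \<noteq> 0 \<Longrightarrow> r \<noteq> g \<Longrightarrow> q \<in> signed_comp free_gstar r e \<Longrightarrow> q \<in> I"
  using subst_I[OF degree_gen[of r e] admissible_free[of q "X 0 r e"]] by (simp add: eval_var)

lemma prod_signed_I:
  assumes "a \<in> signed_comp free_gstar g d" "b \<in> signed_comp free_gstar g e"
  shows "a * b \<in> I"
  using subst_I[OF prod_gen[of d e] admissible_upd[OF admissible_free[of a "X 0 g d"], of b "X 1 g e"]] assms
  by (simp add: eval_var_mult)

lemma prod_I:
  assumes "a \<in> free_comp g" "b \<in> free_comp g"
  shows "a * b \<in> I"
proof -
  obtain a1 a2 where a: "a = a1 + a2" "a1 \<in> signed_comp free_gstar g Plus" "a2 \<in> signed_comp free_gstar g Minus"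
    using assms(1) by (rule split_symmetric)
  obtain b1 b2 where b: "b = b1 + b2" "b1 \<in> signed_comp free_gstar g Plus" "b2 \<in> signed_comp free_gstar g Minus"
    using assms(2) by (rule split_symmetric)
  have "a1 * b1 + a1 * b2 + (a2 * b1 + a2 * b2) \<in> I"
    using a b by (intro I_add prod_signed_I)
  then show ?thesis by (simp add: a b algebra_simps)
qed

text \<open>The commutator of two symmetric elements of degree 0 is skew, hence a specialization of
  \<open>skew_gen\<close>; products with a skew factor of degree 0 lie in \<open>I\<close>
  anyway.\<close>

lemma commute_zero_I:
  assumes "r \<in> free_comp 0" "s \<in> free_comp 0"
  shows "r * s - s * r \<in> I"
proof -
  obtain r1 r2 where r: "r = r1 + r2" "r1 \<in> signed_comp free_gstar 0 Plus" "r2 \<in> signed_comp free_gstar 0 Minus"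
    using assms(1) by (rule split_symmetric)
  obtain s1 s2 where s: "s = s1 + s2" "s1 \<in> signed_comp free_gstar 0 Plus" "s2 \<in> signed_comp free_gstar 0 Minus"
    using assms(2) by (rule split_symmetric)
  have free: "r1 \<in> free_alg" "r2 \<in> free_alg" "s \<in> free_alg"
    using r s assms by (auto simp: signed_comp_def free_comp_def)
  have "r1 * s1 - s1 * r1 \<in> free_comp (0 + 0)"
    using r s by (intro pm.subspace_diff[OF subspace_free_comp] mult_in_free_comp) (auto simp: signed_comp_def)
  then have "r1 * s1 - s1 * r1 \<in> I"
    using r s by (intro skew_I) (simp add: signed_comp_def free_star.diff free_star_mult)
  moreover have "r1 * s2 - s2 * r1 \<in> I" "r2 * s - s * r2 \<in> I"
    using mult_I[OF free(1) skew_I[OF s(3)]] mult_I[OF free(3) skew_I[OF r(3)]] by (simp_all add: I_diff)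
  ultimately have "(r1 * s1 - s1 * r1) + (r1 * s2 - s2 * r1) + (r2 * s - s * r2) \<in> I"
    by (intro I_add)
  then show ?thesis by (simp add: r s algebra_simps)
qed

lemma reorder_ywords:
  "u \<in> ywords \<Longrightarrow> mset u = mset v \<Longrightarrow> word u - word v \<in> I"
proof (induction u arbitrary: v)
  case Nil
  then show ?case by (simp add: I_zero)
next
  case (Cons x u)
  obtain v1 v2 where v: "v = v1 @ x # v2" "mset (v1 @ v2) = mset u"
    using mset_eq_split[of v "[]" x u] Cons.prems(2) by (metis append_Nil)
  have "v1 \<in> ywords" using Cons.prems v ywords_mset[OF v(2)] by simp
  have "word u - word (v1 @ v2) \<in> I" using Cons v by simp
  then have 1: "word [x] * (word u - word (v1 @ v2)) \<in> I" by (rule word_mult_I)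
  have "word [x] * word v1 - word v1 * word [x] \<in> I"
  proof (cases "v1 = []")
    case False
    then show ?thesis using Cons.prems \<open>v1 \<in> ywords\<close> by (intro commute_zero_I word_ywords) auto
  qed (simp add: word_Nil I_zero)
  then have "(word [x] * word v1 - word v1 * word [x]) * word v2 \<in> I" by (rule word_mult_I)
  then have "word [x] * (word u - word (v1 @ v2)) + (word [x] * word v1 - word v1 * word [x]) * word v2 \<in> I"
    by (rule I_add[OF 1])
  then show ?case by (simp add: v algebra_simps word_append[symmetric])
qed

lemma word_signed: "word [x] \<in> signed_comp free_gstar (degree x) (pol x)" for x :: "'g gvar"
  by (cases "pol x") (simp_all add: signed_comp_def free_comp_def word_sign_def single_uminus)

lemma word_I_member:
  assumes "x \<in> set w" "word [x] \<in> I"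
  shows "word w \<in> I"
proof -
  obtain u v where "w = u @ x # v" using assms(1) by (meson split_list)
  moreover have "word u * word [x] * word v \<in> I" by (intro word_mult_I assms)
  ultimately show ?thesis by (simp add: word_append[symmetric])
qed

lemma word_cases:
  obtains (zero) "w \<in> ywords"
    | (one) u z v where "w = u @ z # v" "u \<in> ywords" "v \<in> ywords" "degree z = g"
    | (I) "word w \<in> I"
proof (cases "\<exists>x\<in>set w. word [x] \<in> I")
  case True
  then show ?thesis using word_I_member that by blast
next
  case False
  have x: "degree x = 0 \<and> pol x = Plus \<or> degree x = g" if "x \<in> set w" for x
    using False word_signed[of x] skew_I[of "word [x]"] degree_I[of "degree x"] that
    by (cases "pol x"; cases "degree x = 0") auto
  show ?thesis
  proof (cases "\<exists>z\<in>set w. degree z = g")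
    case no_z: False
    then show ?thesis using x that(1) by (auto simp: ywords_def)
  next
    case True
    then obtain u z v where w: "w = u @ z # v" "degree z = g" "\<forall>x\<in>set u. degree x \<noteq> g"
      by (rule split_list_first_propE)
    then have u: "u \<in> ywords" using x by (auto simp: ywords_def)
    show ?thesis
    proof (cases "\<exists>z\<in>set v. degree z = g")
      case False
      then show ?thesis using x w u by (intro that(2)[of u z v]) (auto simp: ywords_def)
    next
      case True
      then obtain v1 z' v2 where v: "v = v1 @ z' # v2" "degree z' = g" "\<forall>x\<in>set v1. degree x \<noteq> g"
        by (rule split_list_first_propE)
      then have "v1 \<in> ywords" using x w by (auto simp: ywords_def)
      \<comment> \<open>\<open>z\<close> together with the degree 0 letters after it is one element
        of degree \<open>g\<close>, so its product with \<open>z'\<close> is covered by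
        \<open>prod_I\<close> although the two letters need not be adjacent.\<close>
      then have "word (z # v1) \<in> free_comp g"
        using w word_ywords[of v1] by (cases "v1 = []") (auto simp: free_comp_def)
      moreover have "word [z'] \<in> free_comp g" using v by (simp add: free_comp_def)
      ultimately have "word u * (word (z # v1) * word [z']) * word v2 \<in> I"
        by (intro word_mult_I prod_I)
      then show ?thesis using w v by (intro that(3)) (simp add: word_append[symmetric])
    qed
  qed
qed

end

locale N3_relations = degree_relations g I
  for g :: "'g::{finite,ab_group_add}" and I :: "('g, 'f::field_char_0) gpoly set" +
  assumes comm_gen: "commutator (var 0 g Plus) (var 0 0 Plus) \<in> I"
begin

text \<open>For symmetric \<open>r\<close> this is a specialization of the commutator generator; for
  skew \<open>r\<close> both products already lie in \<open>I\<close>.\<close>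

lemma commute_symmetric_I:
  assumes q: "q \<in> signed_comp free_gstar g Plus" and r: "r \<in> free_comp 0"
  shows "q * r - r * q \<in> I"
proof -
  obtain r1 r2 where r: "r = r1 + r2" "r1 \<in> signed_comp free_gstar 0 Plus" "r2 \<in> signed_comp free_gstar 0 Minus"
    using r by (rule split_symmetric)
  have "q * r1 - r1 * q \<in> I"
    using subst_I[OF comm_gen admissible_upd[OF admissible_free[of q "X 0 g Plus"], of r1 "X 0 0 Plus"]] q r g
    by (simp add: commutator_def free.eval_diff eval_var_mult)
  moreover have "q * r2 - r2 * q \<in> I"
    using q mult_I[OF _ skew_I[OF r(3)], of q] by (simp add: I_diff signed_comp_def free_comp_def)
  ultimately have "(q * r1 - r1 * q) + (q * r2 - r2 * q) \<in> I" by (rule I_add)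
  then show ?thesis by (simp add: r algebra_simps)
qed

lemma move_plus:
  assumes z: "degree z = g" "pol z = Plus" and u: "u \<in> ywords"
  shows "word (u @ z # v) - word (z # u @ v) \<in> I"
proof -
  have "word [z] \<in> signed_comp free_gstar g Plus"
    using z by (simp add: signed_comp_def free_comp_def word_sign_def)
  then have "word [z] * word u - word u * word [z] \<in> I"
    using word_ywords[OF u] by (cases "u = []") (auto simp: word_Nil I_zero intro: commute_symmetric_I)
  then have "pm_scale (- 1) ((word [z] * word u - word u * word [z]) * word v) \<in> I"
    by (intro I_scale word_mult_I)
  also have "pm_scale (- 1) ((word [z] * word u - word u * word [z]) * word v) = word (u @ z # v) - word (z # u @ v)"
    unfolding left_diff_distrib word_append[symmetric] by simp
  finally show ?thesis .
qed

text \<open>The commutator of a symmetric element of degree \<open>0\<close> with a skew element of degree \<open>g\<close>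
  is symmetric, and therefore central.\<close>

lemma move_minus:
  assumes z: "degree z = g" "pol z = Minus" and c: "c \<in> ywords"
  shows "mset (u @ v) = mset c \<Longrightarrow> word (u @ z # v) -
    (word (z # c) + (\<Sum>y\<leftarrow>u. word (y # z # remove1 y c) - word (z # y # remove1 y c))) \<in> I"
proof (induction u arbitrary: v rule: rev_induct)
  case Nil
  then have "word [z] * (word v - word c) \<in> I"
    using c ywords_mset by (intro word_mult_I reorder_ywords) auto
  then show ?case by (simp add: right_diff_distrib word_append[symmetric])
next
  case (snoc y u)
  have uv: "u \<in> ywords" "v \<in> ywords" "y # [] \<in> ywords"
    using c ywords_mset[OF snoc.prems] by auto
  \<comment> \<open>\<open>u y z v\<close> is \<open>u z y v\<close> plus \<open>u ?s v\<close>. The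
    first term falls under the induction hypothesis; in the second, \<open>?s\<close> is symmetric,
    so it moves to the front of \<open>u\<close>, and the letters behind it are put in the order of
    \<open>remove1 y c\<close>.\<close>
  let ?s = "word [y] * word [z] - word [z] * word [y]"
  have 1: "word (u @ z # y # v) - (word (z # c) + (\<Sum>y\<leftarrow>u. word (y # z # remove1 y c) - word (z # y # remove1 y c))) \<in> I"
    using snoc.prems by (intro snoc.IH) simp
  have "?s \<in> free_comp g"
    using uv z by (intro pm.subspace_diff[OF subspace_free_comp]; simp add: word_append[symmetric] free_comp_def)
  then have s: "?s \<in> signed_comp free_gstar g Plus"
    using uv z by (simp add: signed_comp_def word_append[symmetric] free_star.diff word_sign_def single_uminus)
  then have "?s * word u - word u * ?s \<in> I"
    using word_ywords[OF uv(1)] by (cases "u = []") (auto simp: word_Nil I_zero intro: commute_symmetric_I)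
  then have 2: "(?s * word u - word u * ?s) * word v \<in> I" by (rule word_mult_I)
  have "mset (u @ v) = mset (remove1 y c)"
    using arg_cong[OF snoc.prems, of "\<lambda>m. m - {#y#}"] by simp
  then have "word (u @ v) - word (remove1 y c) \<in> I"
    using uv by (intro reorder_ywords) auto
  then have 3: "?s * (word (u @ v) - word (remove1 y c)) \<in> I"
    using s by (intro mult_I) (auto simp: signed_comp_def free_comp_def)
  have "word (u @ z # y # v) - (word (z # c) + (\<Sum>y\<leftarrow>u. word (y # z # remove1 y c) - word (z # y # remove1 y c)))
      - (?s * word u - word u * ?s) * word v + ?s * (word (u @ v) - word (remove1 y c)) \<in> I"
    by (intro I_add I_diff 1 2 3)
  then show ?case by (simp add: algebra_simps word_append[symmetric])
qed

end


context N3_relations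
begin

text \<open>\<open>N\<close> plays the normal form modulo \<open>I\<close>, so membership is reduced
  to cancellation among few normal words.\<close>

lemma scaled_words_I:
  assumes "\<And>w. w \<in> S \<Longrightarrow> word w - N w \<in> I" "(\<Sum>w\<in>S. pm_scale (c w) (N w)) = 0"
  shows "(\<Sum>w\<in>S. pm_scale (c w) (word w)) \<in> I"
proof -
  have "(\<Sum>w\<in>S. pm_scale (c w) (word w - N w)) \<in> I"
    by (intro I_sum I_scale assms)
  then show ?thesis
    using assms(2) by (simp add: pm.scale_right_diff_distrib sum_subtractf del: pm_scale_single)
qed

lemma sum_list_count_pm:
  fixes N :: "'g gvar \<Rightarrow> ('g, 'f) gpoly"
  assumes "set u \<subseteq> set c"
  shows "(\<Sum>y\<leftarrow>u. N y) = (\<Sum>y\<in>set c. pm_scale (of_nat (count_list u y)) (N y))"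
  using assms
proof (induction u)
  case (Cons x u)
  have "(\<Sum>y\<in>set c. pm_scale (of_nat (count_list (x # u) y)) (N y))
     = (\<Sum>y\<in>set c. (if y = x then N y else 0) + pm_scale (of_nat (count_list u y)) (N y))"
    by (intro sum.cong refl) (simp add: pm.scale_left_distrib)
  also have "\<dots> = N x + (\<Sum>y\<in>set c. pm_scale (of_nat (count_list u y)) (N y))"
    using Cons.prems by (simp add: sum.distrib)
  finally show ?case using Cons by simp
qed simp

lemma content_class_I:
  fixes p :: "('g, 'f) gpoly" and m :: "'g gvar multiset"
  assumes v: "sums_vanish g p"
  defines "S \<equiv> {w \<in> Poly_Mapping.keys p. mset w = m}"
  shows "(\<Sum>w\<in>S. pm_scale (Poly_Mapping.lookup p w) (word w)) \<in> I"
proof -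
  \<comment> \<open>The first two shapes of \<open>word_cases\<close> depend only on the content, so
    one word of such a shape decides the case for the whole class.\<close>
  consider (zero) w0 where "w0 \<in> S" "w0 \<in> ywords"
    | (one) w0 u0 z v0 where "w0 \<in> S" "w0 = u0 @ z # v0" "u0 \<in> ywords" "v0 \<in> ywords" "degree z = g"
    | (I) "\<And>w. w \<in> S \<Longrightarrow> word w \<in> I"
    using word_cases by metis
  then show ?thesis
  proof cases
  case zero
  then have m: "m = mset w0" by (simp add: S_def)
  show ?thesis
  proof (rule scaled_words_I[where N = "\<lambda>_. word w0"])
    show "word w - word w0 \<in> I" if "w \<in> S" for w
      using that zero ywords_mset[of w w0] by (intro reorder_ywords) (auto simp: S_def)
    show "(\<Sum>w\<in>S. pm_scale (Poly_Mapping.lookup p w) (word w0)) = 0"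
      using v zero unfolding sums_vanish_def content_sum_eq S_def m
      by (simp add: pm.scale_sum_left[symmetric] del: pm_scale_single)
  qed
next
  case (one w0 u0 z v0)
  define c where "c = u0 @ v0"
  have c: "c \<in> ywords" using one by (simp add: c_def)
  have m: "m = mset (z # c)" using one by (auto simp: c_def S_def)
  have sum: "(\<Sum>w\<in>S. Poly_Mapping.lookup p w) = 0"
    using v c one unfolding sums_vanish_def content_sum_eq S_def m by blast
  have split: "\<exists>u v. w = u @ z # v \<and> u \<in> ywords \<and> v \<in> ywords \<and> mset (u @ v) = mset c" if "w \<in> S" for w
  proof -
    have "mset w = mset (u0 @ z # v0)" using that by (simp add: S_def m c_def)
    then obtain u v where "w = u @ z # v" "mset (u @ v) = mset (u0 @ v0)" by (rule mset_eq_split)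
    then show ?thesis using c ywords_mset[of "u @ v" c] by (auto simp: c_def)
  qed
  show ?thesis
  proof (cases "pol z")
    case Plus
    show ?thesis
    proof (rule scaled_words_I[where N = "\<lambda>_. word (z # c)"])
      fix w assume "w \<in> S"
      then obtain u v where w: "w = u @ z # v" "u \<in> ywords" "v \<in> ywords" "mset (u @ v) = mset c"
        using split by blast
      have "word w - word (z # u @ v) \<in> I"
        unfolding w(1) by (rule move_plus) (use one Plus w in auto)
      moreover have "word [z] * (word (u @ v) - word c) \<in> I"
        using w by (intro word_mult_I reorder_ywords) auto
      ultimately have "(word w - word (z # u @ v)) + word [z] * (word (u @ v) - word c) \<in> I"
        by (rule I_add)
      then show "word w - word (z # c) \<in> I" by (simp add: algebra_simps word_append[symmetric])
    qed (simp add: sum pm.scale_sum_left[symmetric] del: pm_scale_single)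
  next
    case Minus
    \<comment> \<open>\<open>?N y\<close> is the commutator of \<open>y\<close> and \<open>z\<close>
      followed by the remaining letters, and \<open>?n w\<close> is the normal form from
      \<open>move_minus\<close> with equal letters collected.\<close>
    let ?N = "\<lambda>y. word (y # z # remove1 y c) - word (z # y # remove1 y c) :: ('g, 'f) gpoly"
    let ?n = "\<lambda>w. word (z # c) + (\<Sum>y\<in>set c. pm_scale (of_nat (prefix_count y w)) (?N y)) :: ('g, 'f) gpoly"
    have psum: "(\<Sum>w\<in>S. Poly_Mapping.lookup p w * of_nat (prefix_count y w)) = 0" if "y \<in> set c" for y
      using v c one Minus that unfolding sums_vanish_def prefix_sum_eq S_def m by blast
    show ?thesis
    proof (rule scaled_words_I[where N = ?n])
      fix w assume "w \<in> S"
      then obtain u v where w: "w = u @ z # v" "u \<in> ywords" "v \<in> ywords" "mset (u @ v) = mset c"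
        using split by blast
      have "set u \<subseteq> set c" using mset_eq_setD[OF w(4)] by auto
      then have "?n w = word (z # c) + (\<Sum>y\<leftarrow>u. ?N y)"
        using prefix_count_split[OF w(2), of z _ v] one(5) g by (simp only: sum_list_count_pm w(1) simp_thms)
      then show "word w - ?n w \<in> I"
        using move_minus[OF one(5) Minus c w(4)] w(1) by simp
    next
      have "(\<Sum>w\<in>S. pm_scale (Poly_Mapping.lookup p w) (?n w)) =
          pm_scale (\<Sum>w\<in>S. Poly_Mapping.lookup p w) (word (z # c)) +
          (\<Sum>y\<in>set c. pm_scale (\<Sum>w\<in>S. Poly_Mapping.lookup p w * of_nat (prefix_count y w)) (?N y))"
        unfolding pm.scale_right_distrib sum.distrib pm.scale_sum_right pm.scale_sum_left pm.scale_scale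
        by (rule arg_cong2[where f = "(+)", OF refl], rule sum.swap)
      then show "(\<Sum>w\<in>S. pm_scale (Poly_Mapping.lookup p w) (?n w)) = 0"
        by (simp only: sum psum pm.scale_zero_left sum.neutral_const add_0_left cong: sum.cong)
    qed
  qed
next
  case I
  then show ?thesis by (intro I_sum I_scale)
  qed
qed

lemma sums_vanish_I:
  fixes p :: "('g, 'f) gpoly"
  assumes v: "sums_vanish g p"
  shows "p \<in> I"
proof -
  have "p = (\<Sum>w\<in>Poly_Mapping.keys p. pm_scale (Poly_Mapping.lookup p w) (word w))"
    by (simp add: sum_single)
  also have "\<dots> = (\<Sum>m\<in>mset ` Poly_Mapping.keys p.
      \<Sum>w\<in>{w \<in> Poly_Mapping.keys p. mset w = m}. pm_scale (Poly_Mapping.lookup p w) (word w))"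
    by (rule sum.group[symmetric]) auto
  also have "\<dots> \<in> I"
    by (rule I_sum) (rule content_class_I[OF v])
  finally show ?thesis .
qed

end


section \<open>The identities of \<open>N3\<close>\<close>

lemma prod_mset_double:
  fixes \<alpha> :: "'x \<Rightarrow> 'f::comm_ring_1"
  shows "(\<Prod>y\<in>#m. (\<alpha>(x := 2 * \<alpha> x)) y) = 2 ^ count m x * (\<Prod>y\<in>#m. \<alpha> y)"
proof (induction m)
  case (add y m)
  show ?case
  proof (cases "y = x")
    case True
    show ?thesis
      unfolding True image_mset_add_mset prod_mset.add_mset add fun_upd_same
      by (simp only: count_add_mset if_True refl power_Suc mult_ac)
  next
    case False
    then have "(\<alpha>(x := 2 * \<alpha> x)) y = \<alpha> y" "count (add_mset y m) x = count m x" by auto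
    then show ?thesis
      unfolding image_mset_add_mset prod_mset.add_mset add by (simp only: mult_ac)
  qed
qed simp

text \<open>Distinct monomials are distinct multiplicative characters; Dedekind's argument only needs one
  substitution \<open>x \<mapsto> 2 x\<close> that separates two of them.\<close>

lemma monomials_independent:
  fixes c :: "'x multiset \<Rightarrow> 'f::field_char_0"
  assumes "finite S" "\<And>\<alpha>. (\<Sum>m\<in>S. c m * (\<Prod>x\<in>#m. \<alpha> x)) = 0" "m \<in> S"
  shows "c m = 0"
  using assms
proof (induction S arbitrary: c m)
  case (insert m0 S)
  have distrib: "r * (s - t) * q = r * (s * q) - t * (r * q)" for r s t q :: 'f
    unfolding right_diff_distrib left_diff_distrib by (simp only: mult_ac)
  have S: "c m = 0" if m: "m \<in> S" for m
  proof -
    obtain x where x: "count m x \<noteq> count m0 x"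
      using insert.hyps m multiset_eqI[of m m0] by blast
    have "(\<Sum>k\<in>S. (c k * (2 ^ count k x - 2 ^ count m0 x)) * (\<Prod>x\<in>#k. \<alpha> x)) = 0" for \<alpha>
    proof -
      have "(\<Sum>k\<in>insert m0 S. (c k * (2 ^ count k x - 2 ^ count m0 x)) * (\<Prod>x\<in>#k. \<alpha> x))
          = (\<Sum>k\<in>insert m0 S. c k * (2 ^ count k x * (\<Prod>y\<in>#k. \<alpha> y)))
            - 2 ^ count m0 x * (\<Sum>k\<in>insert m0 S. c k * (\<Prod>y\<in>#k. \<alpha> y))"
        unfolding sum_distrib_left sum_subtractf[symmetric] by (rule sum.cong[OF refl]) (rule distrib)
      also have "\<dots> = 0"
        unfolding insert.prems(1)[of \<alpha>]
          insert.prems(1)[of "\<alpha>(x := 2 * \<alpha> x)", unfolded prod_mset_double] by simp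
      finally show ?thesis using insert.hyps by simp
    qed
    from insert.IH[OF this m] have "c m * (2 ^ count m x - 2 ^ count m0 x) = 0" .
    moreover have "(2::'f) ^ count m x \<noteq> 2 ^ count m0 x"
    proof
      assume "(2::'f) ^ count m x = 2 ^ count m0 x"
      then have "of_nat (2 ^ count m x) = (of_nat (2 ^ count m0 x) :: 'f)" by simp
      then have "(2::nat) ^ count m x = 2 ^ count m0 x" by (simp only: of_nat_eq_iff)
      with x show False by simp
    qed
    ultimately show ?thesis by simp
  qed
  have "(\<Sum>k\<in>insert m0 S. c k * (\<Prod>x\<in>#k. (\<lambda>_. 1) x)) = 0" by (rule insert.prems(1))
  then have "c m0 = 0" using insert.hyps S by simp
  then show ?case using S insert.prems(2) by auto
qed simp

lemma (in gstar_algebra) nonempty_prod_scale: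
  assumes "\<And>x. \<psi> x \<in> acarrier A"
  shows "w \<noteq> [] \<Longrightarrow> nonempty_prod (amult A) (map (\<lambda>x. ascale A (\<alpha> x) (\<psi> x)) w)
    = ascale A (\<Prod>x\<in>#mset w. \<alpha> x) (nonempty_prod (amult A) (map \<psi> w))"
proof (induction w)
  case (Cons x w)
  show ?case
  proof (cases w)
    case Nil
    then show ?thesis by simp
  next
    case (Cons y v)
    then have "nonempty_prod (amult A) (map \<psi> w) \<in> acarrier A"
      using assms by (intro nonempty_prod_in_acarrier) auto
    then show ?thesis
      using Cons Cons.IH assms[of x] subspace_scale[OF subspace_acarrier]
      by (simp add: mult_scale_left mult_scale_right)
  qed
qed simp

text \<open>Rescaling every variable by its own scalar keeps a substitution admissible and
  multiplies each word by the monomial of its content, so independence of monomials separates the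
  content classes. \<open>L\<close> will be a matrix entry.\<close>

lemma gstar_Id_content:
  fixes A :: "('a::ab_group_add, 'f::field_char_0, 'g::{finite,ab_group_add}) gstar_alg"
  assumes A: "gstar_algebra A" and p: "p \<in> gstar_Id A" and \<psi>: "admissible A \<psi>"
    and L: "Vector_Spaces.linear (ascale A) (*) L"
  shows "(\<Sum>w\<in>{w \<in> Poly_Mapping.keys p. mset w = m}.
    Poly_Mapping.lookup p w * L (nonempty_prod (amult A) (map \<psi> w))) = 0" (is "?c m = 0")
proof (cases "m \<in> mset ` Poly_Mapping.keys p")
  case True
  interpret gstar_algebra A by fact
  interpret L: Vector_Spaces.linear "ascale A" "(*)" L by fact
  note acarrier = admissibleD(3)[OF \<psi>]
  show ?thesis
  proof (rule monomials_independent[OF _ _ True])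
    fix \<alpha> :: "'g gvar \<Rightarrow> 'f"
    have "admissible A (\<lambda>x. ascale A (\<alpha> x) (\<psi> x))"
      using \<psi> subspace_scale[OF comp_subspace] acarrier
      by (auto simp: admissible_def signed_comp_def star_scale split: polarity.splits)
    then have "0 = L (eval (\<lambda>x. ascale A (\<alpha> x) (\<psi> x)) p)"
      using p by (simp add: gstar_Id_iff L.zero)
    also have "\<dots> = (\<Sum>w\<in>Poly_Mapping.keys p. Poly_Mapping.lookup p w *
        L (nonempty_prod (amult A) (map (\<lambda>x. ascale A (\<alpha> x) (\<psi> x)) w)))"
      by (simp add: poly_eval_def L.sum L.scale)
    also have "\<dots> = (\<Sum>w\<in>Poly_Mapping.keys p. Poly_Mapping.lookup p w *
        L (nonempty_prod (amult A) (map \<psi> w)) * (\<Prod>x\<in>#mset w. \<alpha> x))"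
    proof (rule sum.cong[OF refl])
      fix w assume "w \<in> Poly_Mapping.keys p"
      then have "w \<noteq> []" using p by (auto simp: gstar_Id_iff free_alg_keys)
      then show "Poly_Mapping.lookup p w * L (nonempty_prod (amult A) (map (\<lambda>x. ascale A (\<alpha> x) (\<psi> x)) w))
          = Poly_Mapping.lookup p w * L (nonempty_prod (amult A) (map \<psi> w)) * (\<Prod>x\<in>#mset w. \<alpha> x)"
        by (simp add: nonempty_prod_scale[OF acarrier] L.scale)
    qed
    also have "\<dots> = (\<Sum>m\<in>mset ` Poly_Mapping.keys p. \<Sum>w\<in>{w \<in> Poly_Mapping.keys p. mset w = m}.
        Poly_Mapping.lookup p w * L (nonempty_prod (amult A) (map \<psi> w)) * (\<Prod>x\<in>#mset w. \<alpha> x))"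
      by (rule sum.group[symmetric]) auto
    also have "\<dots> = (\<Sum>m\<in>mset ` Poly_Mapping.keys p. ?c m * (\<Prod>x\<in>#m. \<alpha> x))"
      by (intro sum.cong refl) (simp add: sum_distrib_right)
    finally show "(\<Sum>m\<in>mset ` Poly_Mapping.keys p. ?c m * (\<Prod>x\<in>#m. \<alpha> x)) = 0" by simp
  qed simp
next
  case False
  then have "{w \<in> Poly_Mapping.keys p. mset w = m} = {}" by auto
  then show ?thesis by (simp only: sum.empty)
qed

lemma nonempty_prod_matrix: "xs \<noteq> [] \<Longrightarrow> nonempty_prod (**) xs = foldr (**) xs (mat 1)"
  for xs :: "('f::field^'n^'n) list"
  by (induction xs rule: induct_list012) simp_all

lemma foldr_matrix_mult: "foldr (**) xs M = foldr (**) xs (mat 1) ** M" for M :: "'f::field^'n^'n"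
  by (induction xs) (simp_all add: matrix_mul_assoc)

lemma linear_entry: "Vector_Spaces.linear mat_scale (*) (\<lambda>M. M $ i $ j)"
  by (simp add: Vector_Spaces.linear_iff vector_space_mat_scale field_mult.vector_space_axioms)


section \<open>Products of matrices at the test points of \<open>N3\<close>\<close>

lemma N3_simps [simp]:
  "amult (N3 g) = (**)" "ascale (N3 g) = mat_scale" "astar (N3 g) = reflection"
  by (simp_all add: N3_def)

lemma N3_hcomp:
  "hcomp (N3 g) 0 = {mat_scale a (mat 1) + mat_scale b (E 2 3 + E 4 5) | a b. True}"
  "g \<noteq> 0 \<Longrightarrow> hcomp (N3 g) g = {mat_scale c (E 1 2 - E 5 6) + mat_scale d (E 1 3) + mat_scale e (E 4 6) | c d e. True}"
  "h \<noteq> 0 \<Longrightarrow> h \<noteq> g \<Longrightarrow> hcomp (N3 g) h = {0}"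
  by (simp_all add: N3_def set_eq_iff mat_span2 mat_span3)

text \<open>All symmetric variables of degree 0 except \<open>y\<close> become the identity matrix,
  so that a product of such letters sees only the occurrences of \<open>y\<close>. The values at
  degree \<open>g\<close> are a symmetric and a skew element for the reflection.\<close>

abbreviation N3_point :: "'g::zero \<Rightarrow> 'g gvar \<Rightarrow> 'g gvar \<Rightarrow> 'f::field^6^6"
  where "N3_point g y x \<equiv>
    (if degree x = 0 then
      (case pol x of Plus \<Rightarrow> if x = y then mat 1 + (E 2 3 + E 4 5) else mat 1 | Minus \<Rightarrow> 0)
     else if degree x = g then (case pol x of Plus \<Rightarrow> E 1 3 + E 4 6 | Minus \<Rightarrow> E 1 2 - E 5 6)
     else 0)"

lemma reflection_zero: "reflection 0 = 0"
  by (simp add: reflection_def vec_eq_iff)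

lemma admissible_N3_point:
  assumes g: "g \<noteq> 0"
  shows "admissible (N3 g) (N3_point g y :: _ \<Rightarrow> 'f::field_char_0^6^6)"
proof -
  have "mat 1 = mat_scale 1 (mat 1) + mat_scale 0 (E 2 3 + E 4 5 :: 'f^6^6)"
    "mat 1 + (E 2 3 + E 4 5) = mat_scale 1 (mat 1) + mat_scale 1 (E 2 3 + E 4 5 :: 'f^6^6)"
    "0 = mat_scale 0 (mat 1) + mat_scale 0 (E 2 3 + E 4 5 :: 'f^6^6)"
    "E 1 3 + E 4 6 = mat_scale 0 (E 1 2 - E 5 6) + mat_scale 1 (E 1 3) + mat_scale 1 (E 4 6 :: 'f^6^6)"
    "E 1 2 - E 5 6 = mat_scale 1 (E 1 2 - E 5 6) + mat_scale 0 (E 1 3) + mat_scale 0 (E 4 6 :: 'f^6^6)"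
    by (simp_all add: vec_eq_iff)
  note eqs = this
  have "mat 1 \<in> (hcomp (N3 g) 0 :: ('f^6^6) set)" unfolding N3_hcomp(1) using eqs(1) by blast
  moreover have "mat 1 + (E 2 3 + E 4 5) \<in> (hcomp (N3 g) 0 :: ('f^6^6) set)"
    unfolding N3_hcomp(1) using eqs(2) by blast
  moreover have "0 \<in> (hcomp (N3 g) 0 :: ('f^6^6) set)" unfolding N3_hcomp(1) using eqs(3) by blast
  moreover have "E 1 3 + E 4 6 \<in> (hcomp (N3 g) g :: ('f^6^6) set)"
    unfolding N3_hcomp(2)[OF g] using eqs(4) by blast
  moreover have "E 1 2 - E 5 6 \<in> (hcomp (N3 g) g :: ('f^6^6) set)"
    unfolding N3_hcomp(2)[OF g] using eqs(5) by blast
  moreover have "0 \<in> (hcomp (N3 g) h :: ('f^6^6) set)" for h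
    using module.subspace_0[OF mat_scale.module_axioms gstar_algebra.comp_subspace[OF gstar_algebra_N3[OF g], unfolded N3_simps]] .
  ultimately show ?thesis
    by (simp add: g admissible_def signed_comp_def reflection_linear reflection_mat reflection_E reflection_zero
       add.commute split: polarity.splits)
qed

text \<open>\<open>E 2 3 + E 4 5\<close> squares to zero, so the powers of
  \<open>mat 1 + (E 2 3 + E 4 5)\<close> are linear in the exponent.\<close>

lemma N3_product_ywords:
  "u \<in> ywords \<Longrightarrow> foldr (**) (map (N3_point g y) u) (mat 1) =
    mat 1 + mat_scale (of_nat (count_list u y)) (E 2 3 + E 4 5 :: 'f::field^6^6)"
proof (induction u)
  case Nil
  then show ?case by (simp add: vec_eq_iff)
next
  case (Cons x u)
  have "(mat 1 + (E 2 3 + E 4 5)) ** (mat 1 + mat_scale c (E 2 3 + E 4 5))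
      = mat 1 + mat_scale (1 + c) (E 2 3 + E 4 5 :: 'f^6^6)" for c
    by (simp add: matrix_add_right matrix_add_ldistrib matrix_mat_scale E_mult) (simp add: vec_eq_iff algebra_simps)
  then show ?case using Cons by simp
qed

text \<open>For the skew element, letters on the right act through \<open>E 1 2 ** E 2 3\<close> and
  letters on the left through \<open>E 4 5 ** E 5 6\<close>, so the entries (1,3) and (4,6) count,
  up to sign, the occurrences of \<open>y\<close> after and before \<open>z\<close>. The symmetric
  element is untouched on both sides.\<close>

lemma N3_products:
  "(mat 1 + mat_scale k (E 2 3 + E 4 5)) ** ((E 1 3 + E 4 6) ** (mat 1 + mat_scale l (E 2 3 + E 4 5)))
    = E 1 3 + (E 4 6 :: 'f::field^6^6)"
  "(mat 1 + mat_scale k (E 2 3 + E 4 5)) ** ((E 1 2 - E 5 6) ** (mat 1 + mat_scale l (E 2 3 + E 4 5)))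
    = E 1 2 - E 5 6 + mat_scale l (E 1 3) - mat_scale k (E 4 6 :: 'f::field^6^6)"
  by (simp_all add: matrix_add_right matrix_add_ldistrib matrix_mat_scale matrix_diff E_mult)

lemma N3_product_one:
  fixes g :: "'g::{finite,ab_group_add}"
  assumes "u \<in> ywords" "v \<in> ywords" "degree z = g" "g \<noteq> 0"
  shows "nonempty_prod (**) (map (N3_point g y) (u @ z # v)) =
    (case pol z of Plus \<Rightarrow> E 1 3 + E 4 6
     | Minus \<Rightarrow> E 1 2 - E 5 6 + mat_scale (of_nat (count_list v y)) (E 1 3)
        - mat_scale (of_nat (count_list u y)) (E 4 6 :: 'f::field^6^6))"
proof -
  have "nonempty_prod (**) (map (N3_point g y) (u @ z # v))
      = foldr (**) (map (N3_point g y) u) (mat 1) ** (N3_point g y z ** foldr (**) (map (N3_point g y) v) (mat 1 :: 'f^6^6))"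
    by (subst nonempty_prod_matrix) (simp_all add: foldr_matrix_mult[of "map (N3_point g y) u" "N3_point g y z ** _"])
  also have "\<dots> = (case pol z of Plus \<Rightarrow> E 1 3 + E 4 6
     | Minus \<Rightarrow> E 1 2 - E 5 6 + mat_scale (of_nat (count_list v y)) (E 1 3)
        - mat_scale (of_nat (count_list u y)) (E 4 6))"
    unfolding N3_product_ywords[OF assms(1)] N3_product_ywords[OF assms(2)]
    using assms(3,4) N3_products by (cases "pol z") simp_all
  finally show ?thesis .
qed

lemma linear_entry_N3: "Vector_Spaces.linear (ascale (N3 g)) (*) (\<lambda>M. M $ i $ j)"
  using linear_entry[of i j] by simp

lemma gstar_Id_N3_sums_vanish:
  fixes g :: "'g::{finite,ab_group_add}" and p :: "('g, 'f::field_char_0) gpoly"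
  assumes g: "g \<noteq> 0" and p: "p \<in> gstar_Id (N3 g)"
  shows "sums_vanish g p"
  unfolding sums_vanish_def
proof (intro ballI conjI allI impI)
  note content = gstar_Id_content[OF gstar_algebra_N3[OF g] p admissible_N3_point[OF g]
      linear_entry_N3, unfolded N3_simps]
  fix c :: "'g gvar list" assume c: "c \<in> ywords"
  \<comment> \<open>\<open>undefined\<close> is an arbitrary distinguished variable: the entry (1,1)
    is 1 for any choice.\<close>
  have "(\<Sum>w\<in>{w \<in> Poly_Mapping.keys p. mset w = mset c}.
      Poly_Mapping.lookup p w * nonempty_prod (**) (map (N3_point g undefined :: _ \<Rightarrow> 'f^6^6) w) $ 1 $ 1) = 0"
    by (rule content)
  moreover have "nonempty_prod (**) (map (N3_point g undefined :: _ \<Rightarrow> 'f^6^6) w) $ 1 $ 1 = 1"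
    if "w \<in> Poly_Mapping.keys p" "mset w = mset c" for w
  proof -
    have "w \<noteq> []" using p that by (auto simp: gstar_Id_iff free_alg_keys)
    moreover have "w \<in> ywords" using c ywords_mset that by blast
    ultimately show ?thesis
      by (simp add: nonempty_prod_matrix N3_product_ywords) (simp add: mat_def E_def)
  qed
  ultimately show "content_sum (mset c) p = 0" by (simp add: content_sum_eq)
  fix z :: "'g gvar" assume z: "degree z = g"
  have split: "\<exists>u v. w = u @ z # v \<and> u \<in> ywords \<and> v \<in> ywords" if "mset w = mset (z # c)" for w
  proof -
    have "mset w = mset ([] @ z # c)" using that by simp
    then obtain u v where "w = u @ z # v" "mset (u @ v) = mset ([] @ c)" by (rule mset_eq_split)
    then show ?thesis using c ywords_mset[of "u @ v" c] by auto
  qed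
  \<comment> \<open>The column whose entry in row 1 is 1 whatever the order of the letters:
    \<open>E 1 3\<close> for symmetric \<open>z\<close>, \<open>E 1 2\<close> for skew
    \<open>z\<close>.\<close>
  define j :: 6 where "j = (case pol z of Plus \<Rightarrow> 3 | Minus \<Rightarrow> 2)"
  have "(\<Sum>w\<in>{w \<in> Poly_Mapping.keys p. mset w = mset (z # c)}.
      Poly_Mapping.lookup p w * nonempty_prod (**) (map (N3_point g undefined :: _ \<Rightarrow> 'f^6^6) w) $ 1 $ j) = 0"
    by (rule content)
  moreover have "nonempty_prod (**) (map (N3_point g undefined :: _ \<Rightarrow> 'f^6^6) w) $ 1 $ j = 1"
    if w: "mset w = mset (z # c)" for w
  proof -
    obtain u v where w: "w = u @ z # v" "u \<in> ywords" "v \<in> ywords" using split[OF w] by blast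
    show ?thesis
      unfolding w(1) N3_product_one[OF w(2,3) z g] j_def by (cases "pol z") (simp_all add: E_def)
  qed
  ultimately show "content_sum (mset (z # c)) p = 0" by (simp add: content_sum_eq)
  fix y assume "pol z = Minus"
  \<comment> \<open>The sign stems from the summand \<open>- E 5 6\<close> of the skew test
    point.\<close>
  have entry: "nonempty_prod (**) (map (N3_point g y :: _ \<Rightarrow> 'f^6^6) w) $ 4 $ 6 = - of_nat (prefix_count y w)"
    if w: "mset w = mset (z # c)" for w
  proof -
    obtain u v where w: "w = u @ z # v" "u \<in> ywords" "v \<in> ywords" using split[OF w] by blast
    have "degree z \<noteq> 0" using z g by simp
    show ?thesis
      unfolding w(1) N3_product_one[OF w(2,3) z g] prefix_count_split[OF w(2) \<open>degree z \<noteq> 0\<close>] \<open>pol z = Minus\<close>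
      by (simp add: E_def)
  qed
  have "- prefix_sum (mset (z # c)) y p = (\<Sum>w\<in>{w \<in> Poly_Mapping.keys p. mset w = mset (z # c)}.
      Poly_Mapping.lookup p w * nonempty_prod (**) (map (N3_point g y :: _ \<Rightarrow> 'f^6^6) w) $ 4 $ 6)"
    unfolding prefix_sum_eq sum_negf[symmetric] by (rule sum.cong[OF refl]) (simp add: entry)
  also have "\<dots> = 0" by (rule content)
  finally show "prefix_sum (mset (z # c)) y p = 0" by simp
qed

lemma double_matrix_eq_0: "M = - M \<Longrightarrow> M = 0" for M :: "'f::field_char_0^'n^'m"
  by (simp add: vec_eq_iff eq_neg_iff_add_eq_0 mult_2[symmetric])

lemma N3_relations_gstar_Id:
  fixes g :: "'g::{finite,ab_group_add}"
  assumes g: "g \<noteq> 0"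
  shows "N3_relations g (gstar_Id (N3 g) :: ('g, 'f::field_char_0) gpoly set)"
proof unfold_locales
  interpret gstar_algebra "N3 g :: ('f^6^6, 'f, 'g) gstar_alg" by (rule gstar_algebra_N3[OF g])
  have eval_word: "eval \<phi> (Poly_Mapping.single w 1) = nonempty_prod (**) (map \<phi> w)"
    for \<phi> :: "'g gvar \<Rightarrow> 'f^6^6" and w
    using eval_single[of \<phi> w 1] by (simp add: vec_eq_iff)
  have pt: "\<phi> (X i h e) \<in> hcomp (N3 g) h" "reflection (\<phi> (X i h e)) = (case e of Plus \<Rightarrow> \<phi> (X i h e) | Minus \<Rightarrow> - \<phi> (X i h e))"
    if "admissible (N3 g) \<phi>" for \<phi> :: "'g gvar \<Rightarrow> 'f^6^6" and i h e
    using that unfolding admissible_def signed_comp_def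
    by (cases e; auto dest!: spec[of _ "X i h e"])+
  show "TGstar_ideal (gstar_Id (N3 g :: ('f^6^6, 'f, 'g) gstar_alg))" by (rule TGstar_ideal_gstar_Id)
  show "var 0 0 Minus \<in> gstar_Id (N3 g :: ('f^6^6, 'f, 'g) gstar_alg)"
    unfolding gstar_Id_iff
  proof (intro conjI allI impI)
    fix \<phi> :: "'g gvar \<Rightarrow> 'f^6^6" assume \<phi>: "admissible (N3 g) \<phi>"
    obtain a b where x: "\<phi> (X 0 0 Minus) = mat_scale a (mat 1) + mat_scale b (E 2 3 + E 4 5)"
      using pt(1)[OF \<phi>, of 0 0 Minus] unfolding N3_hcomp by blast
    \<comment> \<open>The reflection fixes the component of degree 0 pointwise, so a skew value
      there equals its own negative.\<close>
    have "reflection (\<phi> (X 0 0 Minus)) = \<phi> (X 0 0 Minus)"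
      unfolding x by (simp add: reflection_linear reflection_mat reflection_E add.commute)
    then have "\<phi> (X 0 0 Minus) = 0"
      using pt(2)[OF \<phi>, of 0 0 Minus] by (intro double_matrix_eq_0) simp
    then show "eval \<phi> (var 0 0 Minus) = 0" by (simp add: var_def eval_word)
  qed (simp add: var_def)
  show "var 0 g d * var 1 g e \<in> gstar_Id (N3 g :: ('f^6^6, 'f, 'g) gstar_alg)" for d e
    unfolding gstar_Id_iff
  proof (intro conjI allI impI)
    fix \<phi> :: "'g gvar \<Rightarrow> 'f^6^6" assume \<phi>: "admissible (N3 g) \<phi>"
    obtain a1 b1 c1 where x: "\<phi> (X 0 g d) = mat_scale a1 (E 1 2 - E 5 6) + mat_scale b1 (E 1 3) + mat_scale c1 (E 4 6)"
      using pt(1)[OF \<phi>, of 0 g d] unfolding N3_hcomp(2)[OF g] by blast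
    obtain a2 b2 c2 where y: "\<phi> (X 1 g e) = mat_scale a2 (E 1 2 - E 5 6) + mat_scale b2 (E 1 3) + mat_scale c2 (E 4 6)"
      using pt(1)[OF \<phi>, of 1 g e] unfolding N3_hcomp(2)[OF g] by blast
    have "\<phi> (X 0 g d) ** \<phi> (X 1 g e) = 0"
      unfolding x y by (simp add: matrix_add_right matrix_add_ldistrib matrix_mat_scale E_mult matrix_diff)
    then show "eval \<phi> (var 0 g d * var 1 g e) = 0"
      unfolding var_def word_append[symmetric] by (simp add: eval_word)
  qed (simp add: var_def word_append[symmetric])
  show "commutator (var 0 g Plus) (var 0 0 Plus) \<in> gstar_Id (N3 g :: ('f^6^6, 'f, 'g) gstar_alg)"
    unfolding gstar_Id_iff
  proof (intro conjI allI impI)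
    fix \<phi> :: "'g gvar \<Rightarrow> 'f^6^6" assume \<phi>: "admissible (N3 g) \<phi>"
    obtain a b c where x: "\<phi> (X 0 g Plus) = mat_scale a (E 1 2 - E 5 6) + mat_scale b (E 1 3) + mat_scale c (E 4 6)"
      using pt(1)[OF \<phi>, of 0 g Plus] unfolding N3_hcomp(2)[OF g] by blast
    obtain d e where y: "\<phi> (X 0 0 Plus) = mat_scale d (mat 1) + mat_scale e (E 2 3 + E 4 5)"
      using pt(1)[OF \<phi>, of 0 0 Plus] unfolding N3_hcomp by blast
    \<comment> \<open>\<open>E 1 2 - E 5 6\<close> is skew, so a symmetric element has no such
      component, and what remains commutes with the component of degree 0.\<close>
    have "reflection (\<phi> (X 0 g Plus)) $ 1 $ 2 = \<phi> (X 0 g Plus) $ 1 $ 2"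
      using pt(2)[OF \<phi>, of 0 g Plus] by simp
    then have "- a = a"
      unfolding x reflection_linear reflection_E by (simp add: E_def)
    then have a: "a = 0" by (simp add: neg_eq_iff_add_eq_0 mult_2[symmetric])
    have "\<phi> (X 0 g Plus) ** \<phi> (X 0 0 Plus) = \<phi> (X 0 0 Plus) ** \<phi> (X 0 g Plus)"
      unfolding x y a by (simp add: matrix_add_right matrix_add_ldistrib matrix_mat_scale E_mult matrix_diff)
         (simp add: vec_eq_iff algebra_simps)
    then show "eval \<phi> (commutator (var 0 g Plus) (var 0 0 Plus)) = 0"
      unfolding commutator_def var_def word_append[symmetric] eval_diff by (simp add: eval_word)
  next
    show "commutator (var 0 g Plus) (var 0 0 Plus) \<in> (free_alg :: ('g, 'f) gpoly set)"
      unfolding commutator_def var_def word_append[symmetric]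
      by (intro pm.subspace_diff[OF subspace_free_alg]) simp_all
  qed
  show "var 0 r e \<in> gstar_Id (N3 g :: ('f^6^6, 'f, 'g) gstar_alg)" if r: "r \<noteq> 0" "r \<noteq> g" for r e
    unfolding gstar_Id_iff
  proof (intro conjI allI impI)
    fix \<phi> :: "'g gvar \<Rightarrow> 'f^6^6" assume \<phi>: "admissible (N3 g) \<phi>"
    show "eval \<phi> (var 0 r e) = 0"
      using pt(1)[OF \<phi>, of 0 r e] unfolding N3_hcomp(3)[OF r] by (simp add: var_def eval_word)
  qed (simp add: var_def)
qed (rule g)

lemma gstar_Id_N3_iff:
  fixes g :: "'g::{finite,ab_group_add}" and p :: "('g, 'f::field_char_0) gpoly"
  assumes g: "g \<noteq> 0"
  shows "p \<in> gstar_Id (N3 g) \<longleftrightarrow> p \<in> free_alg \<and> sums_vanish g p"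
proof
  assume "p \<in> gstar_Id (N3 g)"
  then show "p \<in> free_alg \<and> sums_vanish g p"
    using gstar_Id_N3_sums_vanish[OF g, of p] by (simp add: gstar_Id_iff)
next
  assume "p \<in> free_alg \<and> sums_vanish g p"
  then show "p \<in> gstar_Id (N3 g)"
    using N3_relations.sums_vanish_I[OF N3_relations_gstar_Id[OF g]] by blast
qed

text \<open>Any T-ideal containing the generators instantiates \<open>N3_relations\<close>, so the
  vanishing condition places every identity in it.\<close>

lemma gstar_Id_N3_generators:
  fixes g :: "'g::{finite,ab_group_add}"
  assumes g: "g \<noteq> 0"
  shows "gstar_Id (N3 g :: ('f::field_char_0 ^ 6 ^ 6, 'f, 'g) gstar_alg) =
    TGstar_generated
      ({var 0 0 Minus}
       \<union> {var 0 g d * var 1 g e | d e. True}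
       \<union> {commutator (var 0 g Plus) (var 0 0 Plus)}
       \<union> {var 0 r e | r e. r \<noteq> 0 \<and> r \<noteq> g})" (is "?Id = TGstar_generated ?S")
proof
  have "p \<in> I" if "p \<in> ?Id" "TGstar_ideal I" "?S \<subseteq> I" for p I
  proof -
    interpret N3_relations g I
      using g that(2,3) by (intro N3_relations.intro degree_relations.intro N3_relations_axioms.intro) auto
    show ?thesis using gstar_Id_N3_sums_vanish[OF g that(1)] by (rule sums_vanish_I)
  qed
  then show "?Id \<subseteq> TGstar_generated ?S" by (auto simp: TGstar_generated_def)
next
  interpret N3_relations g ?Id by (rule N3_relations_gstar_Id[OF g])
  have "?S \<subseteq> ?Id" using skew_gen prod_gen comm_gen degree_gen by auto
  then show "TGstar_generated ?S \<subseteq> ?Id" using ideal by (auto simp: TGstar_generated_def)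
qed


section \<open>Multilinear polynomials\<close>

definition typed_vars :: "('g vtype \<Rightarrow> nat) \<Rightarrow> 'g gvar set"
  where "typed_vars nn = {X i h e | i h e. i < nn (h, e)}"

lemma typed_vars_iff: "x \<in> typed_vars nn \<longleftrightarrow> index x < nn (degree x, pol x)"
  unfolding typed_vars_def by (cases x) auto

lemma multilin_typed_iff:
  fixes p :: "('g, 'f::field) gpoly"
  shows "p \<in> multilin_typed nn \<longleftrightarrow> (\<forall>w\<in>Poly_Mapping.keys p. distinct w \<and> set w = typed_vars nn)"
proof -
  have "{word w :: ('g, 'f) gpoly | w. distinct w \<and> set w = typed_vars nn} = word ` {w. distinct w \<and> set w = typed_vars nn}"
    by auto
  then show ?thesis
    unfolding multilin_typed_def typed_vars_def[symmetric] by (simp only: span_singles) blast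
qed

lemma subspace_multilin_typed: "pm.subspace (multilin_typed nn)"
  unfolding multilin_typed_def by (rule pm.subspace_span)

lemma word_in_multilin_typed:
  "distinct w \<Longrightarrow> set w = typed_vars nn \<Longrightarrow> word w \<in> multilin_typed nn"
  by (simp add: multilin_typed_iff)

text \<open>Reduces the vanishing condition to a single content class.\<close>

lemma multilin_typed_mset:
  assumes "p \<in> multilin_typed nn" "w \<in> Poly_Mapping.keys p" "distinct w0" "set w0 = typed_vars nn"
  shows "mset w = mset w0"
  using assms set_eq_iff_mset_eq_distinct[of w w0] by (simp add: multilin_typed_iff)

text \<open>For the type without variables the empty word would be a constant term.\<close>

lemma multilin_typed_free_alg:
  assumes "p \<in> multilin_typed nn" "typed_vars nn \<noteq> {}"
  shows "p \<in> free_alg"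
  using assms by (force simp: multilin_typed_iff free_alg_keys)

definition rename_var :: "('g vtype \<Rightarrow> nat \<Rightarrow> nat) \<Rightarrow> 'g gvar \<Rightarrow> 'g gvar"
  where "rename_var \<sigma> x = X (\<sigma> (degree x, pol x) (index x)) (degree x) (pol x)"

lemma rename_var_sel [simp]:
  "index (rename_var \<sigma> x) = \<sigma> (degree x, pol x) (index x)"
  "degree (rename_var \<sigma> x) = degree x" "pol (rename_var \<sigma> x) = pol x"
  by (simp_all add: rename_var_def)

lemma rename_eq: "rename \<sigma> = pm_push (map (rename_var \<sigma>))"
  by (simp add: rename_def rename_var_def[abs_def])

lemma linear_rename: "Vector_Spaces.linear pm_scale pm_scale (rename \<sigma>)"
  unfolding rename_eq by (rule linear_pm_push)

lemma rename_word: "rename \<sigma> (word w) = word (map (rename_var \<sigma>) w)"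
  by (simp add: rename_eq)

lemma inj_rename_var:
  assumes "\<sigma> \<in> young_group nn" shows "inj (rename_var \<sigma>)"
proof (rule injI)
  fix x y assume "rename_var \<sigma> x = rename_var \<sigma> y"
  then have eq: "\<sigma> (degree x, pol x) (index x) = \<sigma> (degree x, pol x) (index y)" "degree x = degree y" "pol x = pol y"
    by (auto simp: rename_var_def)
  have "\<sigma> (degree x, pol x) permutes {..<nn (degree x, pol x)}" using assms unfolding young_group_def by blast
  then have "inj (\<sigma> (degree x, pol x))" by (rule permutes_inj)
  with eq show "x = y" by (metis gvar.expand injD)
qed

lemma rename_var_typed_vars:
  assumes "\<sigma> \<in> young_group nn" shows "rename_var \<sigma> ` typed_vars nn = typed_vars nn"
proof
  have perm: "\<sigma> \<tau> permutes {..<nn \<tau>}" for \<tau> using assms unfolding young_group_def by blast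
  show "rename_var \<sigma> ` typed_vars nn \<subseteq> typed_vars nn"
    using permutes_in_image[OF perm] by (auto simp: typed_vars_iff)
  show "typed_vars nn \<subseteq> rename_var \<sigma> ` typed_vars nn"
  proof
    fix x assume x: "x \<in> typed_vars nn"
    let ?y = "X (inv (\<sigma> (degree x, pol x)) (index x)) (degree x) (pol x)"
    have "rename_var \<sigma> ?y = x"
      using permutes_inverses(1)[OF perm] by (cases x) (simp add: rename_var_def)
    moreover have "?y \<in> typed_vars nn"
      using x permutes_in_image[OF permutes_inv[OF perm]] by (auto simp: typed_vars_iff)
    ultimately show "x \<in> rename_var \<sigma> ` typed_vars nn" by (metis image_eqI)
  qed
qed

lemma rename_word_multilin_typed:
  assumes "\<sigma> \<in> young_group nn" "distinct w" "set w = typed_vars nn"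
  shows "distinct (map (rename_var \<sigma>) w)" "set (map (rename_var \<sigma>) w) = typed_vars nn"
  using assms inj_rename_var[OF assms(1)] rename_var_typed_vars[OF assms(1)]
  by (auto simp: distinct_map inj_on_def)

lemma rename_multilin_typed:
  assumes \<sigma>: "\<sigma> \<in> young_group nn" and p: "p \<in> multilin_typed nn"
  shows "rename \<sigma> p \<in> multilin_typed nn"
  unfolding rename_eq pm_push_eq_lin_ext lin_ext_def
proof (intro pm.subspace_sum[OF subspace_multilin_typed] pm.subspace_scale[OF subspace_multilin_typed])
  fix w assume "w \<in> Poly_Mapping.keys p"
  then show "word (map (rename_var \<sigma>) w) \<in> multilin_typed nn"
    using rename_word_multilin_typed[OF \<sigma>, of w] p by (intro word_in_multilin_typed) (auto simp: multilin_typed_iff)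
qed

text \<open>Renaming keeps degree and sign, so it only changes the point of evaluation to another
  admissible one.\<close>

lemma (in gstar_algebra) rename_gstar_Id:
  assumes "p \<in> gstar_Id A"
  shows "rename \<sigma> p \<in> gstar_Id A"
proof -
  have eval: "eval \<phi> (rename \<sigma> p) = eval (\<phi> \<circ> rename_var \<sigma>) p" for \<phi>
  proof -
    have "rename \<sigma> p = (\<Sum>w\<in>Poly_Mapping.keys p. Poly_Mapping.single (map (rename_var \<sigma>) w) (Poly_Mapping.lookup p w))"
      by (simp add: rename_eq pm_push_def)
    then show ?thesis by (simp add: eval_sum eval_single poly_eval_def[of _ _ p])
  qed
  have "admissible A (\<phi> \<circ> rename_var \<sigma>)" if "admissible A \<phi>" for \<phi>
    unfolding admissible_def
  proof
    fix x
    show "(\<phi> \<circ> rename_var \<sigma>) x \<in> signed_comp A (degree x) (pol x)"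
      using that[unfolded admissible_def, rule_format, of "rename_var \<sigma> x"] by simp
  qed
  moreover have "rename \<sigma> p \<in> free_alg"
  proof -
    have "p \<in> free_alg" using assms by (simp add: gstar_Id_iff)
    then show ?thesis
      unfolding rename_eq pm_push_eq_lin_ext lin_ext_def
      by (intro pm.subspace_sum[OF subspace_free_alg] pm.subspace_scale[OF subspace_free_alg] single_in_free_alg)
        (auto simp: free_alg_keys)
  qed
  ultimately show ?thesis using assms by (simp add: gstar_Id_iff eval)
qed

lemma gstar_char_dual:
  fixes A :: "('a::ab_group_add, 'f::field_char_0, 'g::{finite,ab_group_add}) gstar_alg"
  assumes A: "gstar_algebra A"
    and dual: "dual_basis pm_scale (multilin_typed nn) (multilin_typed nn \<inter> gstar_Id A) I e f"
    and \<sigma>: "\<sigma> \<in> young_group nn"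
  shows "gstar_char A nn \<sigma> = (\<Sum>i\<in>I. f i (rename \<sigma> (e i)))"
proof -
  have "quot_trace pm_scale (multilin_typed nn) (multilin_typed nn \<inter> gstar_Id A) (rename \<sigma>) = (\<Sum>i\<in>I. f i (rename \<sigma> (e i)))"
    by (rule dual_basis.quot_trace[OF dual linear_rename])
      (use rename_multilin_typed[OF \<sigma>] gstar_algebra.rename_gstar_Id[OF A] in auto)
  then show ?thesis using \<sigma> by (simp add: gstar_char_def)
qed

lemma gstar_char_zero:
  fixes A :: "('a::ab_group_add, 'f::field_char_0, 'g::{finite,ab_group_add}) gstar_alg"
  assumes A: "gstar_algebra A" and "multilin_typed nn \<subseteq> gstar_Id A"
  shows "gstar_char A nn = (\<lambda>_. 0)"
proof
  fix \<sigma>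
  have "dual_basis pm_scale (multilin_typed nn) (multilin_typed nn \<inter> gstar_Id A) {} (\<lambda>_::nat. 0) (\<lambda>_ _. 0)"
    by (intro dual_basis.intro dual_basis_axioms.intro pm.vector_space_axioms) (use assms(2) in \<open>auto simp: subspace_multilin_typed\<close>)
  from gstar_char_dual[OF A this] show "gstar_char A nn \<sigma> = 0"
    by (cases "\<sigma> \<in> young_group nn") (auto simp: gstar_char_def)
qed


section \<open>Coordinates modulo the identities of \<open>N3\<close>\<close>

lemma linear_content_sum: "Vector_Spaces.linear pm_scale (*) (content_sum m :: ('g, 'f::field) gpoly \<Rightarrow> 'f)"
  unfolding content_sum_def by (rule field_mult.linear_lin_ext)

lemma linear_prefix_sum: "Vector_Spaces.linear pm_scale (*) (prefix_sum m y :: ('g::zero, 'f::field) gpoly \<Rightarrow> 'f)"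
  unfolding prefix_sum_def by (rule field_mult.linear_lin_ext)

lemma content_sum_word [simp]: "content_sum m (word w) = (if mset w = m then 1 else 0)"
  by (simp add: content_sum_def)

lemma prefix_sum_word [simp]:
  "prefix_sum m y (word w) = (if mset w = m then of_nat (prefix_count y w) else 0)"
  by (simp add: prefix_sum_def)

lemma content_sum_eq_0: "(\<And>w. w \<in> Poly_Mapping.keys p \<Longrightarrow> mset w \<noteq> m) \<Longrightarrow> content_sum m p = 0"
  unfolding content_sum_eq by (rule sum.neutral) auto

lemma prefix_sum_eq_0: "(\<And>w. w \<in> Poly_Mapping.keys p \<Longrightarrow> mset w \<noteq> m) \<Longrightarrow> prefix_sum m y p = 0"
  unfolding prefix_sum_eq by (rule sum.neutral) auto

lemma sums_vanish_cong:
  assumes "\<And>c. c \<in> ywords \<Longrightarrow> (\<exists>w\<in>Poly_Mapping.keys p. mset w = mset c) \<Longrightarrow> content_sum (mset c) p = 0"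
    and "\<And>c z. c \<in> ywords \<Longrightarrow> degree z = g \<Longrightarrow> (\<exists>w\<in>Poly_Mapping.keys p. mset w = mset (z # c)) \<Longrightarrow>
      content_sum (mset (z # c)) p = 0 \<and> (pol z = Minus \<longrightarrow> (\<forall>y\<in>set c. prefix_sum (mset (z # c)) y p = 0))"
  shows "sums_vanish g p"
  unfolding sums_vanish_def
proof (intro ballI conjI allI impI)
  fix c :: "'a gvar list" assume c: "c \<in> ywords"
  show "content_sum (mset c) p = 0"
    using assms(1)[OF c] content_sum_eq_0[of p "mset c"] by blast
  fix z :: "'a gvar" assume z: "degree z = g"
  show "content_sum (mset (z # c)) p = 0"
    using assms(2)[OF c z] content_sum_eq_0[of p "mset (z # c)"] by blast
  fix y assume "pol z = Minus" "y \<in> set c"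
  then show "prefix_sum (mset (z # c)) y p = 0"
    using assms(2)[OF c z] prefix_sum_eq_0[of p "mset (z # c)"] by blast
qed

text \<open>Modulo the identities, the words with content \<open>z # c\<close>, where \<open>z\<close> is the skew variable of degree \<open>g\<close>,
  have as basis the word \<open>z # c\<close> (index \<open>z\<close>) and, for each \<open>y\<close> in \<open>c\<close>, the word in which
  only \<open>y\<close> stands to the left of \<open>z\<close> (index \<open>y\<close>).\<close>

definition skew_word :: "'g gvar list \<Rightarrow> 'g gvar \<Rightarrow> 'g gvar \<Rightarrow> 'g gvar list"
  where "skew_word c z v = (if v = z then z # c else v # z # remove1 v c)"

text \<open>Dual to the basis words: among them \<open>prefix_sum\<close> at \<open>y\<close> is 1
  on the word of \<open>y\<close> alone, while \<open>content_sum\<close> is 1 on all of them, so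
  the coordinate at \<open>z\<close> subtracts the prefix sums.\<close>

definition skew_coord :: "'g::zero gvar list \<Rightarrow> 'g gvar \<Rightarrow> 'g gvar \<Rightarrow> ('g, 'f::field) gpoly \<Rightarrow> 'f"
  where "skew_coord c z v = (if v = z
    then \<lambda>p. content_sum (mset (z # c)) p - (\<Sum>y\<in>set c. prefix_sum (mset (z # c)) y p)
    else prefix_sum (mset (z # c)) v)"

lemma mset_skew_word: "v \<in> set (z # c) \<Longrightarrow> mset (skew_word c z v) = mset (z # c)"
  by (auto simp: skew_word_def)

lemma linear_skew_coord: "Vector_Spaces.linear pm_scale (*) (skew_coord c z v :: ('g::zero, 'f::field) gpoly \<Rightarrow> 'f)"
proof -
  have "Vector_Spaces.linear pm_scale (*)
      (\<lambda>p :: ('g, 'f) gpoly. content_sum (mset (z # c)) p - (\<Sum>y\<in>set c. prefix_sum (mset (z # c)) y p))"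
    using linear_content_sum[of "mset (z # c)", where 'f = 'f] linear_prefix_sum[of "mset (z # c)", where 'f = 'f]
    by (simp add: Vector_Spaces.linear_iff sum.distrib sum_distrib_left right_diff_distrib)
  then show ?thesis by (simp add: skew_coord_def linear_prefix_sum)
qed

lemma skew_coord_other: "mset w \<noteq> mset (z # c) \<Longrightarrow> skew_coord c z v (word w) = 0"
  by (simp add: skew_coord_def)

lemma skew_coord_vanish:
  assumes "z \<notin> set c"
  shows "(\<forall>v\<in>set (z # c). skew_coord c z v p = 0) \<longleftrightarrow>
    content_sum (mset (z # c)) p = 0 \<and> (\<forall>y\<in>set c. prefix_sum (mset (z # c)) y p = 0)"
  using assms by (auto simp: skew_coord_def intro!: sum.neutral)

text \<open>With at most one letter before \<open>z\<close>, the first letter of the word names its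
  class. The order of \<open>t\<close> is free, so the lemma covers renamed basis words too.\<close>

lemma skew_coord_word:
  assumes c: "c \<in> ywords" "distinct c" and z: "degree z \<noteq> 0" and v: "v \<in> set (z # c)"
    and w: "mset (x @ z # t) = mset (z # c)" "length x \<le> 1"
  shows "skew_coord c z v (word (x @ z # t) :: ('g::zero, 'f::field) gpoly) = (if v = hd (x @ [z]) then 1 else 0)"
proof -
  have "z \<notin> set c" using c z by (auto simp: ywords_def)
  have "mset (x @ t) = mset c" using w(1) by simp
  then have x: "x \<in> ywords" "set x \<subseteq> set c" using c ywords_mset[of "x @ t" c] mset_eq_setD[of "x @ t" c] by auto
  consider "x = []" | y where "x = [y]" "y \<in> set c" "y \<noteq> z"
    using w(2) x \<open>z \<notin> set c\<close> by (cases x) auto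
  then show ?thesis
  proof cases
    case 1
    then show ?thesis using w(1) prefix_count_split[of "[]" z] z
      by (simp add: skew_coord_def)
  next
    case (2 y)
    have "of_nat (prefix_count y' (y # z # t)) = (if y' = y then 1 else 0 :: 'f)" for y'
      using prefix_count_split[OF x(1) z, of y' t] 2 by simp
    then have "skew_coord c z v (word (x @ z # t) :: ('g, 'f) gpoly) =
        (if v = z then 1 - (\<Sum>y'\<in>set c. if y' = y then 1 else 0) else (if v = y then 1 else 0))"
      using 2 w(1) by (simp add: skew_coord_def)
    then show ?thesis using 2 by auto
  qed
qed

lemma skew_dual:
  assumes c: "c \<in> ywords" "distinct c" and z: "degree z \<noteq> 0"
    and v: "v \<in> set (z # c)" "v' \<in> set (z # c)"
  shows "skew_coord c z v (word (skew_word c z v')) = (if v = v' then 1 else 0)"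
proof (cases "v' = z")
  case True
  then show ?thesis using skew_coord_word[OF c z v(1), of "[]" c] by (simp add: skew_word_def)
next
  case False
  then show ?thesis
    using skew_coord_word[OF c z v(1), of "[v']" "remove1 v' c"] v(2) by (simp add: skew_word_def)
qed


abbreviation yvar :: "nat \<Rightarrow> 'g::zero gvar"
  where "yvar i \<equiv> X i 0 Plus"

definition ylist :: "nat list \<Rightarrow> 'g::zero gvar list"
  where "ylist is = map yvar is"

lemma ylist_ywords [simp]: "ylist is \<in> ywords"
  by (auto simp: ywords_def ylist_def)

lemma set_ylist: "set (ylist is) = yvar ` set is"
  by (simp add: ylist_def)

lemma distinct_ylist [simp]: "distinct (ylist is) \<longleftrightarrow> distinct is"
  by (simp add: ylist_def distinct_map inj_on_def)

lemma length_ylist [simp]: "length (ylist is) = length is"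
  by (simp add: ylist_def)

lemma mset_ywords_index: "c \<in> ywords \<Longrightarrow> mset (map index c) = mset is \<Longrightarrow> mset c = mset (ylist is)"
proof -
  assume c: "c \<in> ywords" "mset (map index c) = mset is"
  have "map yvar (map index c) = map (\<lambda>x. x) c"
    unfolding map_map by (rule map_cong[OF refl]) (use c(1) in \<open>auto simp: ywords_def intro: gvar.expand\<close>)
  then have "mset c = image_mset yvar (mset (map index c))" by (metis list.map_ident mset_map)
  then show ?thesis using c(2) by (simp add: ylist_def)
qed

subsection \<open>The codimensions\<close>

lemma multilin_iff:
  fixes p :: "('g, 'f::field) gpoly"
  shows "p \<in> multilin n \<longleftrightarrow> (\<forall>w\<in>Poly_Mapping.keys p. mset (map index w) = mset [0..<n])"
proof -
  have "(\<exists>w \<sigma>. v = map (\<lambda>k. w (\<sigma> k)) [0..<n] \<and> (\<forall>i<n. index (w i) = i) \<and> \<sigma> permutes {..<n})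
      \<longleftrightarrow> mset (map index v) = mset [0..<n]" for v :: "'g gvar list"
  proof
    assume "\<exists>w \<sigma>. v = map (\<lambda>k. w (\<sigma> k)) [0..<n] \<and> (\<forall>i<n. index (w i) = i) \<and> \<sigma> permutes {..<n}"
    then obtain w \<sigma> where v: "v = map (\<lambda>k. w (\<sigma> k)) [0..<n]" and w: "\<forall>i<n. index (w i) = i" and \<sigma>: "\<sigma> permutes {..<n}"
      by blast
    have "map index v = map \<sigma> [0..<n]"
      unfolding v using w permutes_in_image[OF \<sigma>] by auto
    then have "mset (map index v) = image_mset \<sigma> (mset_set {..<n})" by (simp add: lessThan_atLeast0)
    also have "\<dots> = mset_set {..<n}"
      using permutes_inj_on[OF \<sigma>, of "{..<n}"] permutes_image[OF \<sigma>] by (simp add: image_mset_mset_set)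
    finally show "mset (map index v) = mset [0..<n]" by (simp add: lessThan_atLeast0)
  next
    assume v: "mset (map index v) = mset [0..<n]"
    then have len: "length v = n" using mset_eq_length[OF v] by simp
    have set: "index ` set v = {..<n}" using mset_eq_setD[OF v] by auto
    have dist: "distinct (map index v)" using v by (metis distinct_upt mset_eq_imp_distinct_iff)
    \<comment> \<open>Position \<open>k\<close> carries the index \<open>\<sigma> k\<close>; the
      identity elsewhere makes it a permutation of all naturals, as \<open>permutes\<close>
      demands.\<close>
    define \<sigma> where "\<sigma> k = (if k < n then index (v ! k) else k)" for k
    have inj: "inj_on \<sigma> {..<n}"
      using dist len by (auto simp: inj_on_def \<sigma>_def distinct_conv_nth)
    have "\<sigma> ` {..<n} \<subseteq> {..<n}"
      using set len by (auto simp: \<sigma>_def set_conv_nth)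
    then have "\<sigma> ` {..<n} = {..<n}" using inj by (intro endo_inj_surj) auto
    then have \<sigma>: "\<sigma> permutes {..<n}"
      using inj by (intro bij_imp_permutes) (auto simp: bij_betw_def \<sigma>_def)
    define w where "w i = v ! (inv \<sigma> i)" for i
    have "map (\<lambda>k. w (\<sigma> k)) [0..<n] = v"
      by (rule nth_equalityI) (simp_all add: len w_def permutes_inverses[OF \<sigma>])
    moreover have "index (w i) = i" if "i < n" for i
    proof -
      have "inv \<sigma> i < n" using permutes_in_image[OF permutes_inv[OF \<sigma>], of i] that by simp
      then have "index (w i) = \<sigma> (inv \<sigma> i)" by (simp add: w_def \<sigma>_def)
      then show ?thesis by (simp add: permutes_inverses[OF \<sigma>])
    qed
    ultimately show "\<exists>w \<sigma>. v = map (\<lambda>k. w (\<sigma> k)) [0..<n] \<and> (\<forall>i<n. index (w i) = i) \<and> \<sigma> permutes {..<n}"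
      using \<sigma> by metis
  qed
  moreover have "{Poly_Mapping.single (map (\<lambda>k. w (\<sigma> k)) [0..<n]) (1::'f) | w \<sigma>.
      (\<forall>i<n. index (w i) = i) \<and> \<sigma> permutes {..<n}} = word ` {v :: 'g gvar list.
      \<exists>w \<sigma>. v = map (\<lambda>k. w (\<sigma> k)) [0..<n] \<and> (\<forall>i<n. index (w i) = i) \<and> \<sigma> permutes {..<n}}"
    by blast
  ultimately have "{Poly_Mapping.single (map (\<lambda>k. w (\<sigma> k)) [0..<n]) (1::'f) | w \<sigma>.
      (\<forall>i<n. index (w i) = i) \<and> \<sigma> permutes {..<n}} = word ` {v :: 'g gvar list. mset (map index v) = mset [0..<n]}"
    by (simp only:)
  then show ?thesis
    unfolding multilin_def by (simp only: span_singles) blast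
qed

text \<open>Indexes a basis of the multilinear space modulo the identities: no letter has degree
  \<open>g\<close>, or the letter of index \<open>k\<close> is the symmetric one, or it is the skew
  one and \<open>v\<close> selects a word as in \<open>skew_word\<close>. This makes
  \<open>1 + n + n * n\<close> basis words.\<close>

datatype 'g slot = Central | Symmetric nat | Skew nat "'g gvar"

definition rest :: "nat \<Rightarrow> nat \<Rightarrow> 'g::zero gvar list"
  where "rest n k = ylist (remove1 k [0..<n])"

lemma mset_rest: "k < n \<Longrightarrow> mset (map index (X k h e # rest n k)) = mset [0..<n]"
  by (simp add: rest_def ylist_def comp_def)

primrec slot_word :: "'g::zero \<Rightarrow> nat \<Rightarrow> 'g slot \<Rightarrow> 'g gvar list"
  where
    "slot_word g n Central = ylist [0..<n]"
  | "slot_word g n (Symmetric k) = X k g Plus # rest n k"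
  | "slot_word g n (Skew k v) = skew_word (rest n k) (X k g Minus) v"

primrec slot_coord :: "'g::zero \<Rightarrow> nat \<Rightarrow> 'g slot \<Rightarrow> ('g, 'f::field) gpoly \<Rightarrow> 'f"
  where
    "slot_coord g n Central = content_sum (mset (ylist [0..<n]))"
  | "slot_coord g n (Symmetric k) = content_sum (mset (X k g Plus # rest n k))"
  | "slot_coord g n (Skew k v) = skew_coord (rest n k) (X k g Minus) v"

definition slots :: "'g::zero \<Rightarrow> nat \<Rightarrow> 'g slot set"
  where "slots g n = insert Central (Symmetric ` {..<n} \<union>
    (\<lambda>(k, v). Skew k v) ` (SIGMA k : {..<n}. set (X k g Minus # rest n k)))"

lemma X_notin_rest: "g \<noteq> 0 \<Longrightarrow> X k g e \<notin> set (rest n k')"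
  by (auto simp: rest_def set_ylist)

lemma distinct_rest: "distinct (rest n k)"
  by (simp add: rest_def)

lemma rest_ywords: "rest n k \<in> ywords"
  by (simp add: rest_def)

text \<open>Slots of different kind or index have words of different content; only skew slots with
  equal \<open>k\<close> call for \<open>skew_dual\<close>.\<close>

lemma slot_coord_word:
  assumes g: "g \<noteq> 0" and s: "s \<in> slots g n" "s' \<in> slots g n"
  shows "slot_coord g n s (word (slot_word g n s')) = (if s = s' then 1 else 0)"
proof -
  have "X k g e \<notin># mset (ylist is)" for k e "is" using g by (auto simp: set_ylist)
  then have contents:
    "mset (X k g e # rest n k) \<noteq> mset (ylist [0..<n])"
    "mset (X k g e # rest n k) = mset (X k' g e' # rest n k') \<longleftrightarrow> k = k' \<and> e = e'" for k k' e e'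
    using X_notin_rest[OF g, of k e n k'] set_mset_mset
    by (metis list.set_intros(1) set_mset_mset)
      (metis X_notin_rest[OF g] gvar.inject list.set_intros(1) set_ConsD set_mset_mset)
  have skew: "mset (skew_word (rest n k) (X k g Minus) v) = mset (X k g Minus # rest n k)"
    if "v \<in> set (X k g Minus # rest n k)" for k v
    by (rule mset_skew_word) fact
  show ?thesis
  proof (cases s)
    case Central
    then show ?thesis using s(2) contents skew by (cases s') (auto simp: slots_def)
  next
    case (Symmetric k)
    then show ?thesis
      using s(2) contents(1)[of k Plus, THEN not_sym] contents(2) skew by (cases s') (auto simp: slots_def)
  next
    case (Skew k v)
    then have v: "v \<in> set (X k g Minus # rest n k)" using s(1) by (auto simp: slots_def)
    show ?thesis
    proof (cases s')
      case (Skew k' v')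
      then have v': "v' \<in> set (X k' g Minus # rest n k')" using s(2) by (auto simp: slots_def)
      show ?thesis
      proof (cases "k = k'")
        case True
        then show ?thesis
          using skew_dual[OF rest_ywords distinct_rest _ v, of v'] v' g Skew \<open>s = Skew k v\<close> by simp
      next
        case False
        then have "mset (skew_word (rest n k') (X k' g Minus) v') \<noteq> mset (X k g Minus # rest n k)"
          unfolding skew[OF v'] contents by simp
        then show ?thesis using False Skew \<open>s = Skew k v\<close> by (simp add: skew_coord_other)
      qed
    qed (use contents(1)[of k Minus, THEN not_sym] contents(2) \<open>s = Skew k v\<close> in \<open>auto intro!: skew_coord_other\<close>)
  qed
qed

lemma linear_slot_coord: "Vector_Spaces.linear pm_scale (*) (slot_coord g n s)"
  by (cases s) (simp_all only: slot_coord.simps linear_content_sum linear_skew_coord)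

text \<open>An occurring content uses each index below \<open>n\<close> once, which leaves only the
  contents of the slots among those tested by \<open>sums_vanish\<close>.\<close>

lemma sums_vanish_multilin:
  fixes p :: "('g::{finite,ab_group_add}, 'f::field_char_0) gpoly"
  assumes g: "g \<noteq> 0" and p: "p \<in> multilin n"
  shows "sums_vanish g p \<longleftrightarrow> (\<forall>s\<in>slots g n. slot_coord g n s p = 0)"
proof
  assume v: "sums_vanish g p"
  show "\<forall>s\<in>slots g n. slot_coord g n s p = 0"
  proof
    fix s assume s: "s \<in> slots g n"
    show "slot_coord g n s p = 0"
    proof (cases s)
      case Central
      then show ?thesis using v by (simp add: sums_vanish_def)
    next
      case (Symmetric k)
      have "degree (X k g Plus) = g" by simp
      then show ?thesis
        using v rest_ywords[of n k] unfolding sums_vanish_def Symmetric slot_coord.simps by blast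
    next
      case (Skew k x)
      have "\<forall>x\<in>set (X k g Minus # rest n k). skew_coord (rest n k) (X k g Minus) x p = 0"
        using v[unfolded sums_vanish_def, rule_format, OF rest_ywords[of n k]]
        unfolding skew_coord_vanish[OF X_notin_rest[OF g]] by simp
      then show ?thesis using s Skew by (auto simp: slots_def)
    qed
  qed
next
  assume 0: "\<forall>s\<in>slots g n. slot_coord g n s p = 0"
  have index: "mset (map index w) = mset [0..<n]" if "w \<in> Poly_Mapping.keys p" for w
    using p that by (simp add: multilin_iff)
  show "sums_vanish g p"
  proof (rule sums_vanish_cong)
    fix c :: "'g gvar list" assume c: "c \<in> ywords" "\<exists>w\<in>Poly_Mapping.keys p. mset w = mset c"
    then have "mset (map index c) = mset [0..<n]" using index by (metis mset_map)
    then have "mset c = mset (ylist [0..<n])" by (rule mset_ywords_index[OF c(1)])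
    then show "content_sum (mset c) p = 0" using 0 by (simp add: slots_def)
  next
    fix c :: "'g gvar list" and z
    assume c: "c \<in> ywords" "\<exists>w\<in>Poly_Mapping.keys p. mset w = mset (z # c)" and z: "degree z = g"
    then have i: "mset (map index (z # c)) = mset [0..<n]" using index by (metis mset_map)
    then have k: "index z < n" using mset_eq_setD[OF i] by auto
    have "mset (map index c) = mset (remove1 (index z) [0..<n])" using i by simp
        (metis add_mset_remove_trivial)
    then have mset: "mset c = mset (rest n (index z))"
      unfolding rest_def by (rule mset_ywords_index[OF c(1)])
    then have set: "set c = set (rest n (index z))" by (rule mset_eq_setD)
    have zX: "z = X (index z) g (pol z)" using z by (cases z) simp
    show "content_sum (mset (z # c)) p = 0 \<and> (pol z = Minus \<longrightarrow> (\<forall>y\<in>set c. prefix_sum (mset (z # c)) y p = 0))"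
    proof (cases "pol z")
      case Plus
      have "Symmetric (index z) \<in> slots g n" using k by (simp add: slots_def)
      with 0 have "slot_coord g n (Symmetric (index z)) p = 0" by blast
      then show ?thesis using Plus zX mset by simp
    next
      case Minus
      have "Skew (index z) x \<in> slots g n" if "x \<in> set (X (index z) g Minus # rest n (index z))" for x
        using that k by (force simp: slots_def)
      with 0 have "\<forall>x\<in>set (X (index z) g Minus # rest n (index z)). slot_coord g n (Skew (index z) x) p = 0"
        by blast
      moreover have zX: "X (index z) g Minus = z" using Minus zX by simp
      ultimately have "\<forall>x\<in>set (z # rest n (index z)). skew_coord (rest n (index z)) z x p = 0"
        unfolding slot_coord.simps by simp
      then show ?thesis
        using mset set skew_coord_vanish[of z "rest n (index z)" p] X_notin_rest[OF g, of "index z" Minus n] zX by simp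
    qed
  qed
qed

lemma card_slots:
  fixes g :: "'g::zero"
  assumes "g \<noteq> 0"
  shows "card (slots g n) = 1 + 2 * n + 2 * (n choose 2)"
proof -
  have "card (set (X k g Minus # rest n k)) = n" if "k < n" for k
    using that distinct_card[of "X k g Minus # rest n k"] X_notin_rest[OF assms, of k Minus n k]
    by (simp add: distinct_rest) (simp add: rest_def length_remove1)
  then have "card (SIGMA k : {..<n}. set (X k g Minus # rest n k)) = n * n" by simp
  moreover have "inj_on (\<lambda>(k, v :: 'g gvar). Skew k v) S" for S by (auto simp: inj_on_def)
  ultimately have skew: "card ((\<lambda>(k, v). Skew k v) ` (SIGMA k : {..<n}. set (X k g Minus # rest n k))) = n * n"
    by (simp add: card_image)
  have sym: "card (Symmetric ` {..<n} :: 'g slot set) = n" by (simp add: card_image inj_on_def)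
  have "card (slots g n) = Suc (n + n * n)"
    unfolding slots_def by (subst card_insert_disjoint, force, force, subst card_Un_disjoint, force, force, force)
      (simp only: skew sym)
  also have "\<dots> = 1 + 2 * n + 2 * (n choose 2)"
    by (cases n) (simp_all add: choose_two)
  finally show ?thesis .
qed

lemma gstar_codim_N3:
  fixes g :: "'g::{finite,ab_group_add}"
  assumes g: "g \<noteq> 0" and n: "n \<ge> 1"
  shows "gstar_codim n (N3 g :: ('f::field_char_0 ^ 6 ^ 6, 'f, 'g) gstar_alg) = 1 + 2 * n + 2 * (n choose 2)"
proof -
  have "p \<in> free_alg" if "p \<in> multilin n" for p :: "('g, 'f) gpoly"
  proof -
    \<comment> \<open>For \<open>n = 0\<close> the empty word would be multilinear; \<open>n\<close>
      at least 1 keeps constants out.\<close>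
    have "mset (map index []) \<noteq> mset [0..<n]"
      using n mset_eq_length[of "map index []" "[0..<n]"] by auto
    then show ?thesis using that unfolding multilin_iff free_alg_keys by blast
  qed
  then have "dual_basis pm_scale (multilin n) (multilin n \<inter> gstar_Id (N3 g :: ('f ^ 6 ^ 6, 'f, 'g) gstar_alg))
      (slots g n) (\<lambda>s. word (slot_word g n s)) (slot_coord g n)"
  proof (intro dual_basis.intro dual_basis_axioms.intro pm.vector_space_axioms)
    show "pm.subspace (multilin n :: ('g, 'f) gpoly set)" unfolding multilin_def by (rule pm.subspace_span)
    show "finite (slots g n)" by (simp add: slots_def)
    show "word (slot_word g n s) \<in> (multilin n :: ('g, 'f) gpoly set)" if "s \<in> slots g n" for s
    proof -
      have "mset (map index (slot_word g n s)) = mset [0..<n]"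
      proof (cases s)
        case (Skew k v)
        then have "mset (slot_word g n s) = mset (X k g Minus # rest n k)" "k < n"
          using that mset_skew_word[of v "X k g Minus" "rest n k"] by (auto simp: slots_def)
        then show ?thesis using mset_rest[of k n g Minus] by (metis mset_map)
      qed (use that mset_rest in \<open>auto simp: slots_def ylist_def comp_def\<close>)
      then show ?thesis by (simp add: multilin_iff)
    qed
  qed (use g in \<open>auto simp: linear_slot_coord slot_coord_word gstar_Id_N3_iff sums_vanish_multilin\<close>)
  then show ?thesis
    unfolding gstar_codim_def by (simp add: dual_basis.quot_dim card_slots[OF g])
qed


subsection \<open>The characters of \<open>N3\<close>\<close>

abbreviation type0 :: "nat \<Rightarrow> 'g::zero vtype \<Rightarrow> nat"
  where "type0 n \<equiv> (\<lambda>_. 0)((0, Plus) := n)"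

text \<open>\<open>n\<close> counts the variables of degree 0 only, so the total is
  \<open>n + 1\<close>; cocharacters in total degree \<open>n\<close> use
  \<open>type1 g e (n - 1)\<close>.\<close>

abbreviation type1 :: "'g::zero \<Rightarrow> polarity \<Rightarrow> nat \<Rightarrow> 'g vtype \<Rightarrow> nat"
  where "type1 g e n \<equiv> (\<lambda>_. 0)((0, Plus) := n, (g, e) := 1)"

lemma typed_vars_type0: "typed_vars (type0 n) = set (ylist [0..<n])"
  by (auto simp: set_ylist typed_vars_def split: if_splits)

lemma typed_vars_type1:
  fixes g :: "'g::zero"
  assumes "g \<noteq> 0"
  shows "typed_vars (type1 g e n) = set (X 0 g e # ylist [0..<n])"
proof (rule set_eqI)
  fix x :: "'g gvar"
  show "x \<in> typed_vars (type1 g e n) \<longleftrightarrow> x \<in> set (X 0 g e # ylist [0..<n])"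
    using assms by (cases x) (auto simp: typed_vars_iff set_ylist)
qed

lemma X_notin_ylist: "g \<noteq> 0 \<Longrightarrow> X k g e \<notin> set (ylist is)"
  by (auto simp: set_ylist)

text \<open>A word outside \<open>I\<close> has, by \<open>word_cases\<close>, at most one letter
  other than symmetric ones of degree 0, and this forces the type to be \<open>type0\<close> or
  \<open>type1\<close>.\<close>

lemma (in degree_relations) multilin_typed_I:
  fixes nn :: "'g vtype \<Rightarrow> nat"
  assumes nn: "nn \<noteq> type0 (nn (0, Plus))" "\<And>e. nn \<noteq> type1 g e (nn (0, Plus))"
  shows "multilin_typed nn \<subseteq> I"
proof
  fix p :: "('g, 'f) gpoly" assume p: "p \<in> multilin_typed nn"
  define k where "k = nn (0, Plus)"
  have "word w \<in> I" if w: "w \<in> Poly_Mapping.keys p" for w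
  proof (cases w rule: word_cases)
    case zero
    have set: "set w = typed_vars nn" using p w by (simp add: multilin_typed_iff)
    have "nn \<tau> = type0 k \<tau>" for \<tau>
    proof (cases \<tau>)
      case (Pair h e)
      show ?thesis
      proof (cases "0 < nn (h, e)")
        case True
        then have "X 0 h e \<in> set w" unfolding set typed_vars_iff by simp
        then have "h = 0" "e = Plus" using zero by (auto simp: ywords_def)
        then show ?thesis using Pair by (simp add: k_def)
      qed (use Pair k_def in auto)
    qed
    then have "nn = type0 k" by (rule ext)
    with nn(1)[folded k_def] show ?thesis by (rule notE)
  next
    case (one u z v)
    have set: "set w = typed_vars nn" using p w by (simp add: multilin_typed_iff)
    have "nn \<tau> = type1 g (pol z) k \<tau>" for \<tau>
    proof (cases "\<tau> = (0, Plus)")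
      case False
      \<comment> \<open>Every variable that is not symmetric of degree 0 must be the one letter
        \<open>z\<close>, which bounds the entries of \<open>nn\<close>.\<close>
      have z: "X i (fst \<tau>) (snd \<tau>) = z" if "i < nn \<tau>" for i
      proof -
        have "X i (fst \<tau>) (snd \<tau>) \<in> set w" using that unfolding set typed_vars_iff by simp
        moreover have "X i (fst \<tau>) (snd \<tau>) \<notin> set u \<union> set v"
          using False one(2,3) by (cases \<tau>) (auto simp: ywords_def)
        ultimately show ?thesis using one(1) by auto
      qed
      show ?thesis
      proof (cases "\<tau> = (g, pol z)")
        case True
        have "z \<in> set w" using one(1) by simp
        then have "0 < nn \<tau>" unfolding set typed_vars_iff using one(4) True by auto
        moreover have "\<not> 1 < nn \<tau>" using z[of 0] z[of 1] by auto
        ultimately show ?thesis using True g by simp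
      next
        case not_z: False
        have "\<not> 0 < nn \<tau>"
        proof
          assume "0 < nn \<tau>"
          from z[OF this] have "\<tau> = (degree z, pol z)" by (metis gvar.sel(2,3) prod.collapse)
          with not_z one(4) show False by simp
        qed
        then show ?thesis using False not_z by simp
      qed
    qed (use g k_def in auto)
    then have "nn = type1 g (pol z) k" by (rule ext)
    with nn(2)[of "pol z", folded k_def] show ?thesis by (rule notE)
  qed
  then have "(\<Sum>w\<in>Poly_Mapping.keys p. pm_scale (Poly_Mapping.lookup p w) (word w)) \<in> I"
    by (intro I_sum I_scale)
  then show "p \<in> I" by (simp add: sum_single)
qed

text \<open>The quotient is a line on which renaming acts trivially, since it only reorders the
  letters of \<open>w\<close>.\<close>

lemma gstar_char_trivial:
  fixes A :: "('a::ab_group_add, 'f::field_char_0, 'g::{finite,ab_group_add}) gstar_alg"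
  assumes A: "gstar_algebra A" and w: "distinct w" "set w = typed_vars nn"
    and Id: "\<And>p. p \<in> multilin_typed nn \<Longrightarrow> p \<in> gstar_Id A \<longleftrightarrow> content_sum (mset w) p = 0"
  shows "gstar_char A nn = (\<lambda>\<sigma>. if \<sigma> \<in> young_group nn then 1 else 0)"
proof
  fix \<sigma>
  have dual: "dual_basis pm_scale (multilin_typed nn) (multilin_typed nn \<inter> gstar_Id A) {()} (\<lambda>_. word w)
      (\<lambda>_. content_sum (mset w))"
    by (intro dual_basis.intro dual_basis_axioms.intro pm.vector_space_axioms subspace_multilin_typed)
      (use w Id in \<open>auto simp: linear_content_sum intro: word_in_multilin_typed\<close>)
  have "mset (map (rename_var \<sigma>) w) = mset w" if "\<sigma> \<in> young_group nn"
    using rename_word_multilin_typed[OF that w] w set_eq_iff_mset_eq_distinct by blast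
  then show "gstar_char A nn \<sigma> = (if \<sigma> \<in> young_group nn then 1 else 0)"
    using gstar_char_dual[OF A dual, of \<sigma>]
    by (cases "\<sigma> \<in> young_group nn") (simp_all add: rename_word gstar_char_def)
qed

context
  fixes g :: "'g::{finite,ab_group_add}"
  assumes g: "g \<noteq> 0"
begin

lemma sums_vanish_type0:
  fixes p :: "('g, 'f::field_char_0) gpoly"
  assumes p: "p \<in> multilin_typed (type0 n)"
  shows "sums_vanish g p \<longleftrightarrow> content_sum (mset (ylist [0..<n])) p = 0"
proof
  assume 0: "content_sum (mset (ylist [0..<n])) p = 0"
  have mset: "mset w = mset (ylist [0..<n])" if "w \<in> Poly_Mapping.keys p" for w
    using multilin_typed_mset[OF p that, of "ylist [0..<n]"] by (simp add: typed_vars_type0)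
  show "sums_vanish g p"
  proof (rule sums_vanish_cong)
    fix c :: "'g gvar list" assume "\<exists>w\<in>Poly_Mapping.keys p. mset w = mset c"
    then show "content_sum (mset c) p = 0" using mset 0 by auto
  next
    fix c and z :: "'g gvar" assume "\<exists>w\<in>Poly_Mapping.keys p. mset w = mset (z # c)" and z: "degree z = g"
    then have "mset (z # c) = mset (ylist [0..<n])" using mset by auto
    from mset_eq_setD[OF this] have "z \<in> set (ylist [0..<n])" by auto
    then show "content_sum (mset (z # c)) p = 0 \<and> (pol z = Minus \<longrightarrow> (\<forall>y\<in>set c. prefix_sum (mset (z # c)) y p = 0))"
      using z g by (auto simp: set_ylist)
  qed
qed (auto simp: sums_vanish_def)

lemma sums_vanish_type1:
  fixes p :: "('g, 'f::field_char_0) gpoly"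
  assumes p: "p \<in> multilin_typed (type1 g e n)"
  defines "z \<equiv> X 0 g e" and "c \<equiv> ylist [0..<n]"
  shows "sums_vanish g p \<longleftrightarrow> content_sum (mset (z # c)) p = 0 \<and>
    (e = Minus \<longrightarrow> (\<forall>y\<in>set c. prefix_sum (mset (z # c)) y p = 0))"
proof
  assume "sums_vanish g p"
  from this[unfolded sums_vanish_def, rule_format, of c]
  show "content_sum (mset (z # c)) p = 0 \<and> (e = Minus \<longrightarrow> (\<forall>y\<in>set c. prefix_sum (mset (z # c)) y p = 0))"
    unfolding z_def c_def by auto
next
  assume 0: "content_sum (mset (z # c)) p = 0 \<and> (e = Minus \<longrightarrow> (\<forall>y\<in>set c. prefix_sum (mset (z # c)) y p = 0))"
  have "z \<notin> set c" unfolding z_def c_def by (rule X_notin_ylist[OF g])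
  have mset: "mset w = mset (z # c)" if "w \<in> Poly_Mapping.keys p" for w
    using multilin_typed_mset[OF p that, of "z # c"] typed_vars_type1[OF g] \<open>z \<notin> set c\<close>
    by (simp add: z_def c_def)
  show "sums_vanish g p"
  proof (rule sums_vanish_cong)
    fix c' :: "'g gvar list" assume c': "c' \<in> ywords" "\<exists>w\<in>Poly_Mapping.keys p. mset w = mset c'"
    then have "mset c' = mset (z # c)" using mset by auto
    from mset_eq_setD[OF this] have "z \<in> set c'" by auto
    then show "content_sum (mset c') p = 0" using c'(1) g by (auto simp: ywords_def z_def)
  next
    fix c' and z' :: "'g gvar"
    assume c': "c' \<in> ywords" "\<exists>w\<in>Poly_Mapping.keys p. mset w = mset (z' # c')" and z': "degree z' = g"
    then have eq: "mset (z' # c') = mset (z # c)" using mset by auto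
    from mset_eq_setD[OF this] have "z' \<in> set (z # c)" by auto
    then have "z' = z" using z' g by (auto simp: c_def set_ylist)
    then show "content_sum (mset (z' # c')) p = 0 \<and> (pol z' = Minus \<longrightarrow> (\<forall>y\<in>set c'. prefix_sum (mset (z' # c')) y p = 0))"
      using 0 eq mset_eq_setD[of c' c] by (simp add: z_def)
  qed
qed

lemma gstar_Id_N3_typed:
  fixes p :: "('g, 'f::field_char_0) gpoly"
  assumes "p \<in> multilin_typed nn" "typed_vars nn \<noteq> {}"
  shows "p \<in> gstar_Id (N3 g) \<longleftrightarrow> sums_vanish g p"
  using multilin_typed_free_alg[OF assms] by (simp add: gstar_Id_N3_iff[OF g])

lemma gstar_char_N3_type0:
  assumes "n \<ge> 1"
  shows "gstar_char (N3 g :: ('f::field_char_0^6^6, 'f, 'g) gstar_alg) (type0 n) =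
    (\<lambda>\<sigma>. if \<sigma> \<in> young_group (type0 n) then 1 else 0)"
proof (rule gstar_char_trivial[OF gstar_algebra_N3[OF g]])
  show "set (ylist [0..<n]) = typed_vars (type0 n)" by (simp only: typed_vars_type0)
  fix p :: "('g, 'f) gpoly" assume p: "p \<in> multilin_typed (type0 n)"
  have "typed_vars (type0 n :: 'g vtype \<Rightarrow> nat) \<noteq> {}" using assms unfolding typed_vars_type0 set_ylist by simp
  then show "p \<in> gstar_Id (N3 g) \<longleftrightarrow> content_sum (mset (ylist [0..<n])) p = 0"
    using gstar_Id_N3_typed[OF p] sums_vanish_type0[OF p] by blast
qed simp

lemma gstar_char_N3_type1_Plus:
  "gstar_char (N3 g :: ('f::field_char_0^6^6, 'f, 'g) gstar_alg) (type1 g Plus n) =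
    (\<lambda>\<sigma>. if \<sigma> \<in> young_group (type1 g Plus n) then 1 else 0)"
proof (rule gstar_char_trivial[OF gstar_algebra_N3[OF g]])
  show "set (X 0 g Plus # ylist [0..<n]) = typed_vars (type1 g Plus n)" by (simp only: typed_vars_type1[OF g])
  show "distinct (X 0 g Plus # ylist [0..<n])" using X_notin_ylist[OF g] by simp
  fix p :: "('g, 'f) gpoly" assume p: "p \<in> multilin_typed (type1 g Plus n)"
  have "typed_vars (type1 g Plus n) \<noteq> {}" unfolding typed_vars_type1[OF g] by simp
  then show "p \<in> gstar_Id (N3 g) \<longleftrightarrow> content_sum (mset (X 0 g Plus # ylist [0..<n])) p = 0"
    using gstar_Id_N3_typed[OF p] sums_vanish_type1[OF p] by simp
qed

lemma rename_var_type1: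
  assumes "\<sigma> \<in> young_group (type1 g e n)"
  shows "rename_var \<sigma> (X 0 g e) = X 0 g e" "rename_var \<sigma> (yvar i) = yvar (\<sigma> (0, Plus) i)"
proof -
  have "\<sigma> (g, e) permutes {..<type1 g e n (g, e)}" using assms unfolding young_group_def by blast
  then have "\<sigma> (g, e) permutes {0}" by (simp add: lessThan_Suc)
  then show "rename_var \<sigma> (X 0 g e) = X 0 g e" by (simp add: rename_var_def)
qed (simp add: rename_var_def)

text \<open>The group permutes the \<open>n\<close> basis words indexed by the variables of degree \<open>0\<close> modulo the
  word that begins with the variable of degree \<open>g\<close>.\<close>

lemma gstar_char_N3_type1_Minus:
  "gstar_char (N3 g :: ('f::field_char_0^6^6, 'f, 'g) gstar_alg) (type1 g Minus n) =
    (\<lambda>\<sigma>. if \<sigma> \<in> young_group (type1 g Minus n) then 1 + of_nat (card {i. i < n \<and> \<sigma> (0, Plus) i = i}) else 0)"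
proof
  fix \<sigma>
  define z :: "'g gvar" and c :: "'g gvar list" where "z = X 0 g Minus" and "c = ylist [0..<n]"
  have z: "z \<notin> set c" "degree z \<noteq> 0" unfolding z_def c_def using X_notin_ylist[OF g] g by simp_all
  have c: "c \<in> ywords" "distinct c" by (simp_all add: c_def)
  have vars: "typed_vars (type1 g Minus n) = set (z # c)" by (simp only: typed_vars_type1[OF g] z_def c_def)
  have skew: "distinct (skew_word c z v)" "set (skew_word c z v) = typed_vars (type1 g Minus n)"
    if "v \<in> set (z # c)" for v
  proof -
    have m: "mset (skew_word c z v) = mset (z # c)" by (rule mset_skew_word) fact
    show "set (skew_word c z v) = typed_vars (type1 g Minus n)" using mset_eq_setD[OF m] vars by simp
    show "distinct (skew_word c z v)" using mset_eq_imp_distinct_iff[OF m] z c by simp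
  qed
  have dual: "dual_basis pm_scale (multilin_typed (type1 g Minus n))
      (multilin_typed (type1 g Minus n) \<inter> gstar_Id (N3 g :: ('f::field_char_0^6^6, 'f, 'g) gstar_alg))
      (set (z # c)) (\<lambda>v. word (skew_word c z v)) (skew_coord c z)"
  proof (intro dual_basis.intro dual_basis_axioms.intro pm.vector_space_axioms subspace_multilin_typed)
    show "word (skew_word c z v) \<in> multilin_typed (type1 g Minus n)" if "v \<in> set (z # c)" for v
      by (intro word_in_multilin_typed skew that)
    show "skew_coord c z v (word (skew_word c z v')) = (if v = v' then 1 else 0)"
      if "v \<in> set (z # c)" "v' \<in> set (z # c)" for v v'
      by (rule skew_dual[OF c z(2) that])
    have "p \<in> gstar_Id (N3 g) \<longleftrightarrow> (\<forall>v\<in>set (z # c). skew_coord c z v p = 0)"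
      if "p \<in> multilin_typed (type1 g Minus n)" for p :: "('g, 'f) gpoly"
      unfolding skew_coord_vanish[OF z(1)] using gstar_Id_N3_typed[OF that] vars sums_vanish_type1[OF that]
      by (simp add: z_def c_def)
    then show "multilin_typed (type1 g Minus n) \<inter> gstar_Id (N3 g :: ('f^6^6, 'f, 'g) gstar_alg) =
        {p \<in> multilin_typed (type1 g Minus n). \<forall>v\<in>set (z # c). skew_coord c z v p = 0}"
      by blast
  qed (simp_all only: linear_skew_coord finite_set)
  show "gstar_char (N3 g :: ('f^6^6, 'f, 'g) gstar_alg) (type1 g Minus n) \<sigma> =
    (if \<sigma> \<in> young_group (type1 g Minus n) then 1 + of_nat (card {i. i < n \<and> \<sigma> (0, Plus) i = i}) else 0)"
  proof (cases "\<sigma> \<in> young_group (type1 g Minus n)")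
    case True
    let ?r = "rename_var \<sigma>"
    have rz: "?r z = z" unfolding z_def by (rule rename_var_type1[OF True])
    have ry: "?r (yvar i) = yvar (\<sigma> (0, Plus) i)" for i by (rule rename_var_type1[OF True])
    have msetr: "mset (map ?r (skew_word c z v)) = mset (z # c)" if "v \<in> set (z # c)" for v
      using rename_word_multilin_typed[OF True skew[OF that]] vars z c
        set_eq_iff_mset_eq_distinct[of "map ?r (skew_word c z v)" "z # c"] by simp
    \<comment> \<open>Renaming sends the basis word of \<open>v\<close> to one that starts with the
      image of \<open>v\<close>, up to the order of the letters after \<open>z\<close>; the diagonal
      entry is 1 exactly if \<open>v\<close> is fixed.\<close>
    have coord: "skew_coord c z v (rename \<sigma> (word (skew_word c z v)) :: ('g, 'f) gpoly) = (if ?r v = v then 1 else 0)"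
      if v: "v \<in> set (z # c)" for v
    proof (cases "v = z")
      case True
      have "skew_coord c z v (word ([] @ z # map ?r c) :: ('g, 'f) gpoly) = (if v = hd ([] @ [z]) then 1 else 0)"
        by (rule skew_coord_word[OF c z(2) v]) (use msetr[OF v] True rz in \<open>simp_all add: skew_word_def\<close>)
      then show ?thesis using True rz by (simp add: rename_word skew_word_def)
    next
      case False
      have "skew_coord c z v (word ([?r v] @ z # map ?r (remove1 v c)) :: ('g, 'f) gpoly) = (if v = hd ([?r v] @ [z]) then 1 else 0)"
        by (rule skew_coord_word[OF c z(2) v]) (use msetr[OF v] False rz in \<open>simp_all add: skew_word_def\<close>)
      then show ?thesis using False rz by (auto simp add: rename_word skew_word_def)
    qed
    have "gstar_char (N3 g :: ('f^6^6, 'f, 'g) gstar_alg) (type1 g Minus n) \<sigma> = (\<Sum>v\<in>set (z # c). if ?r v = v then 1 else 0)"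
      unfolding gstar_char_dual[OF gstar_algebra_N3[OF g] dual True] by (rule sum.cong[OF refl]) (rule coord)
    also have "\<dots> = 1 + (\<Sum>v\<in>set c. if ?r v = v then 1 else 0)"
      using z rz by simp
    also have "(\<Sum>v\<in>set c. if ?r v = v then 1 else 0 :: 'f) = (\<Sum>i\<in>{..<n}. if \<sigma> (0, Plus) i = i then 1 else 0)"
      unfolding c_def set_ylist by (subst sum.reindex) (auto simp: inj_on_def ry lessThan_atLeast0)
    also have "\<dots> = of_nat (card {i. i < n \<and> \<sigma> (0, Plus) i = i})"
      by (simp add: sum.If_cases Int_def)
    finally have "gstar_char (N3 g :: ('f^6^6, 'f, 'g) gstar_alg) (type1 g Minus n) \<sigma>
        = 1 + of_nat (card {i. i < n \<and> \<sigma> (0, Plus) i = i})" .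
    then show ?thesis using True by (simp only: if_True)
  qed (simp only: gstar_char_def if_False)
qed

end


subsection \<open>The characters of \<open>A2\<close>\<close>

lemma A2_simps [simp]:
  "amult (A2 g) = (**)" "ascale (A2 g) = mat_scale" "astar (A2 g) = reflection"
  by (simp_all add: A2_def)

lemma A2_hcomp:
  "hcomp (A2 g) 0 = {mat_scale a (E 1 1 + E 4 4) | a. True}"
  "g \<noteq> 0 \<Longrightarrow> hcomp (A2 g) g = {mat_scale d (E 1 2) + mat_scale e (E 3 4) | d e. True}"
  "h \<noteq> 0 \<Longrightarrow> h \<noteq> g \<Longrightarrow> hcomp (A2 g) h = {0}"
  by (simp_all add: A2_def set_eq_iff mat_span1 mat_span2)

text \<open>\<open>E 1 1 + E 4 4\<close> is idempotent, fixes \<open>E 1 2\<close> from the left and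
  \<open>E 3 4\<close> from the right, and annihilates each of them from the other side.\<close>

lemma A2_mult:
  "mat_scale a (E 1 1 + E 4 4) ** mat_scale b (E 1 1 + E 4 4) = mat_scale (a * b) (E 1 1 + E 4 4 :: 'f::field^4^4)"
  "mat_scale a (E 1 1 + E 4 4) ** (mat_scale d (E 1 2) + mat_scale e (E 3 4)) = mat_scale (a * d) (E 1 2 :: 'f::field^4^4)"
  "(mat_scale d (E 1 2) + mat_scale e (E 3 4)) ** mat_scale a (E 1 1 + E 4 4) = mat_scale (a * e) (E 3 4 :: 'f::field^4^4)"
  "mat_scale a (E 1 1 + E 4 4) ** mat_scale b (E 3 4) = (0 :: 'f::field^4^4)"
  "(mat_scale d (E 1 2) + mat_scale e (E 3 4)) ** (mat_scale d' (E 1 2) + mat_scale e' (E 3 4)) = (0 :: 'f::field^4^4)"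
  by (simp_all add: matrix_add_right matrix_add_ldistrib matrix_mat_scale E_mult)
    (simp_all add: vec_eq_iff algebra_simps)

lemma degree_relations_gstar_Id_A2:
  fixes g :: "'g::{finite,ab_group_add}"
  assumes g: "g \<noteq> 0"
  shows "degree_relations g (gstar_Id (A2 g) :: ('g, 'f::field_char_0) gpoly set)"
proof unfold_locales
  interpret gstar_algebra "A2 g :: ('f^4^4, 'f, 'g) gstar_alg" by (rule gstar_algebra_A2[OF g])
  have eval_word: "eval \<phi> (Poly_Mapping.single w 1) = nonempty_prod (**) (map \<phi> w)"
    for \<phi> :: "'g gvar \<Rightarrow> 'f^4^4" and w
    using eval_single[of \<phi> w 1] by (simp add: vec_eq_iff)
  have pt: "\<phi> (X i h e) \<in> hcomp (A2 g) h" "reflection (\<phi> (X i h e)) = (case e of Plus \<Rightarrow> \<phi> (X i h e) | Minus \<Rightarrow> - \<phi> (X i h e))"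
    if "admissible (A2 g) \<phi>" for \<phi> :: "'g gvar \<Rightarrow> 'f^4^4" and i h e
    using that unfolding admissible_def signed_comp_def
    by (cases e; auto dest!: spec[of _ "X i h e"])+
  show "TGstar_ideal (gstar_Id (A2 g :: ('f^4^4, 'f, 'g) gstar_alg))" by (rule TGstar_ideal_gstar_Id)
  show "var 0 0 Minus \<in> gstar_Id (A2 g :: ('f^4^4, 'f, 'g) gstar_alg)"
    unfolding gstar_Id_iff
  proof (intro conjI allI impI)
    fix \<phi> :: "'g gvar \<Rightarrow> 'f^4^4" assume \<phi>: "admissible (A2 g) \<phi>"
    obtain a where x: "\<phi> (X 0 0 Minus) = mat_scale a (E 1 1 + E 4 4)"
      using pt(1)[OF \<phi>, of 0 0 Minus] unfolding A2_hcomp by blast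
    have "reflection (\<phi> (X 0 0 Minus)) = \<phi> (X 0 0 Minus)"
      unfolding x by (simp add: reflection_linear reflection_E add.commute)
    then have "\<phi> (X 0 0 Minus) = 0"
      using pt(2)[OF \<phi>, of 0 0 Minus] by (intro double_matrix_eq_0) simp
    then show "eval \<phi> (var 0 0 Minus) = 0" by (simp add: var_def eval_word)
  qed (simp add: var_def)
  show "var 0 g d * var 1 g e \<in> gstar_Id (A2 g :: ('f^4^4, 'f, 'g) gstar_alg)" for d e
    unfolding gstar_Id_iff
  proof (intro conjI allI impI)
    fix \<phi> :: "'g gvar \<Rightarrow> 'f^4^4" assume \<phi>: "admissible (A2 g) \<phi>"
    obtain a1 b1 where x: "\<phi> (X 0 g d) = mat_scale a1 (E 1 2) + mat_scale b1 (E 3 4)"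
      using pt(1)[OF \<phi>, of 0 g d] unfolding A2_hcomp(2)[OF g] by blast
    obtain a2 b2 where y: "\<phi> (X 1 g e) = mat_scale a2 (E 1 2) + mat_scale b2 (E 3 4)"
      using pt(1)[OF \<phi>, of 1 g e] unfolding A2_hcomp(2)[OF g] by blast
    have "\<phi> (X 0 g d) ** \<phi> (X 1 g e) = 0" unfolding x y by (rule A2_mult)
    then show "eval \<phi> (var 0 g d * var 1 g e) = 0"
      unfolding var_def word_append[symmetric] by (simp add: eval_word)
  qed (simp add: var_def word_append[symmetric])
  show "var 0 r e \<in> gstar_Id (A2 g :: ('f^4^4, 'f, 'g) gstar_alg)" if r: "r \<noteq> 0" "r \<noteq> g" for r e
    unfolding gstar_Id_iff
  proof (intro conjI allI impI)
    fix \<phi> :: "'g gvar \<Rightarrow> 'f^4^4" assume \<phi>: "admissible (A2 g) \<phi>"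
    show "eval \<phi> (var 0 r e) = 0"
      using pt(1)[OF \<phi>, of 0 r e] unfolding A2_hcomp(3)[OF r] by (simp add: var_def eval_word)
  qed (simp add: var_def)
qed (rule g)

text \<open>The reflection interchanges \<open>E 1 2\<close> and \<open>E 3 4\<close>, which
  accounts for the two signs at degree \<open>g\<close>.\<close>

definition A2_point :: "'g::zero \<Rightarrow> 'g gvar \<Rightarrow> 'f::field^4^4"
  where "A2_point g x =
    (if degree x = 0 then (case pol x of Plus \<Rightarrow> E 1 1 + E 4 4 | Minus \<Rightarrow> 0)
     else if degree x = g then (case pol x of Plus \<Rightarrow> E 1 2 + E 3 4 | Minus \<Rightarrow> E 1 2 - E 3 4)
     else 0)"

lemma admissible_A2_point:
  fixes g :: "'g::{finite,ab_group_add}"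
  assumes g: "g \<noteq> 0"
  shows "admissible (A2 g) (A2_point g :: _ \<Rightarrow> 'f::field_char_0^4^4)"
proof -
  have eqs: "E 1 1 + E 4 4 = mat_scale 1 (E 1 1 + E 4 4 :: 'f^4^4)"
    "E 1 2 + E 3 4 = mat_scale 1 (E 1 2) + mat_scale 1 (E 3 4 :: 'f^4^4)"
    "E 1 2 - E 3 4 = mat_scale 1 (E 1 2) + mat_scale (- 1) (E 3 4 :: 'f^4^4)"
    by (simp_all add: vec_eq_iff)
  have "E 1 1 + E 4 4 \<in> (hcomp (A2 g) 0 :: ('f^4^4) set)" unfolding A2_hcomp(1) using eqs(1) by blast
  moreover have "E 1 2 + E 3 4 \<in> (hcomp (A2 g) g :: ('f^4^4) set)"
    unfolding A2_hcomp(2)[OF g] using eqs(2) by blast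
  moreover have "E 1 2 - E 3 4 \<in> (hcomp (A2 g) g :: ('f^4^4) set)"
    unfolding A2_hcomp(2)[OF g] using eqs(3) by blast
  moreover have "0 \<in> (hcomp (A2 g) h :: ('f^4^4) set)" for h
    using module.subspace_0[OF mat_scale.module_axioms gstar_algebra.comp_subspace[OF gstar_algebra_A2[OF g], unfolded A2_simps]] .
  ultimately show ?thesis
    by (simp add: g admissible_def A2_point_def signed_comp_def reflection_linear reflection_E reflection_zero
       add.commute split: polarity.splits)
qed

text \<open>Modulo the identities of \<open>A2\<close>, only words that begin or end with the variable of degree \<open>g\<close> survive.\<close>

definition first_sum :: "'g gvar \<Rightarrow> ('g, 'f::field) gpoly \<Rightarrow> 'f"
  where "first_sum z = lin_ext (*) (\<lambda>w. if hd w = z then 1 else 0)"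

definition last_sum :: "'g gvar \<Rightarrow> ('g, 'f::field) gpoly \<Rightarrow> 'f"
  where "last_sum z = lin_ext (*) (\<lambda>w. if last w = z then 1 else 0)"

context
  fixes g :: "'g::{finite,ab_group_add}"
  assumes g: "g \<noteq> 0"
begin

interpretation A2: gstar_algebra "A2 g :: ('f::field_char_0^4^4, 'f, 'g) gstar_alg"
  by (rule gstar_algebra_A2[OF g])

lemma A2_product_ywords:
  fixes \<phi> :: "'g gvar \<Rightarrow> 'f::field_char_0^4^4"
  assumes "\<And>x. x \<in> set u \<Longrightarrow> \<phi> x = mat_scale (a x) (E 1 1 + E 4 4)" "u \<noteq> []"
  shows "nonempty_prod (**) (map \<phi> u) = mat_scale (\<Prod>x\<in>#mset u. a x) (E 1 1 + E 4 4)"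
  using assms
proof (induction u rule: induct_list012)
  case (3 x y u)
  then show ?case by (simp only: list.map nonempty_prod.simps A2_mult) (simp add: A2_mult)
qed simp_all

text \<open>With letters on both sides of \<open>z\<close>, the right ones leave only
  \<open>E 3 4\<close>, which the left ones annihilate. So \<open>z\<close> must be first, leaving
  \<open>E 3 4\<close>, or last, leaving \<open>E 1 2\<close>.\<close>

lemma A2_product_one:
  fixes \<phi> :: "'g gvar \<Rightarrow> 'f::field_char_0^4^4"
  assumes a: "\<And>x. x \<in> set (u @ v) \<Longrightarrow> \<phi> x = mat_scale (a x) (E 1 1 + E 4 4)"
    and z: "\<phi> z = mat_scale d (E 1 2) + mat_scale e (E 3 4)" "z \<notin> set (u @ v)" "u @ v \<noteq> []"
    and \<phi>: "admissible (A2 g) \<phi>"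
  shows "nonempty_prod (**) (map \<phi> (u @ z # v)) =
    mat_scale ((\<Prod>x\<in>#mset (u @ v). a x) * e * (if hd (u @ z # v) = z then 1 else 0)) (E 3 4) +
    mat_scale ((\<Prod>x\<in>#mset (u @ v). a x) * d * (if last (u @ z # v) = z then 1 else 0)) (E 1 2)"
proof -
  have acarrier: "set (map \<phi> w) \<subseteq> acarrier (A2 g)" for w
    using A2.admissibleD(3)[OF \<phi>] by auto
  have hd: "u \<noteq> [] \<Longrightarrow> hd u \<noteq> z" and last: "v \<noteq> [] \<Longrightarrow> last v \<noteq> z" using z(2) by auto
  consider "u = []" "v \<noteq> []" | "u \<noteq> []" "v = []" | "u \<noteq> []" "v \<noteq> []" using z(3) by auto
  then show ?thesis
  proof cases
    case 1
    have "nonempty_prod (**) (map \<phi> ([z] @ v)) = nonempty_prod (**) (map \<phi> [z]) ** nonempty_prod (**) (map \<phi> v)"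
      unfolding map_append using 1 A2.nonempty_prod_append[OF _ _ acarrier acarrier, of "[z]" v] by simp
    also have "\<dots> = mat_scale ((\<Prod>x\<in>#mset v. a x) * e) (E 3 4)"
      using A2_product_ywords[of v \<phi> a] a 1 by (simp add: z A2_mult)
    finally show ?thesis using 1 last by (simp add: vec_eq_iff)
  next
    case 2
    have "nonempty_prod (**) (map \<phi> (u @ [z])) = nonempty_prod (**) (map \<phi> u) ** nonempty_prod (**) (map \<phi> [z])"
      unfolding map_append using 2 A2.nonempty_prod_append[OF _ _ acarrier acarrier, of u "[z]"] by simp
    also have "\<dots> = mat_scale ((\<Prod>x\<in>#mset u. a x) * d) (E 1 2)"
      using A2_product_ywords[of u \<phi> a] a 2 by (simp add: z A2_mult)
    finally show ?thesis using 2 hd by (simp add: vec_eq_iff)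
  next
    case 3
    have "nonempty_prod (**) (map \<phi> (u @ [z] @ v)) = nonempty_prod (**) (map \<phi> u) ** nonempty_prod (**) (map \<phi> ([z] @ v))"
      unfolding map_append[of \<phi> u] using 3 A2.nonempty_prod_append[OF _ _ acarrier acarrier, of u "[z] @ v"] by simp
    also have "nonempty_prod (**) (map \<phi> ([z] @ v)) = nonempty_prod (**) (map \<phi> [z]) ** nonempty_prod (**) (map \<phi> v)"
      unfolding map_append using 3 A2.nonempty_prod_append[OF _ _ acarrier acarrier, of "[z]" v] by simp
    also have "nonempty_prod (**) (map \<phi> u) ** \<dots> = 0"
      using A2_product_ywords[of u \<phi> a] A2_product_ywords[of v \<phi> a] a 3 by (simp add: z A2_mult)
    finally show ?thesis using 3 hd last by (simp add: vec_eq_iff)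
  qed
qed

lemma A2_eval_type1:
  fixes p :: "('g, 'f::field_char_0) gpoly"
  assumes p: "p \<in> multilin_typed (type1 g s n)" and n: "n \<ge> 1"
    and a: "\<And>x. x \<in> set (ylist [0..<n]) \<Longrightarrow> \<phi> x = mat_scale (a x) (E 1 1 + E 4 4)"
    and z: "\<phi> (X 0 g s) = mat_scale d (E 1 2) + mat_scale e (E 3 4)"
    and \<phi>: "admissible (A2 g) \<phi>"
  shows "poly_eval (A2 g) \<phi> p =
    mat_scale ((\<Prod>x\<in>#mset (ylist [0..<n]). a x) * e * first_sum (X 0 g s) p) (E 3 4) +
    mat_scale ((\<Prod>x\<in>#mset (ylist [0..<n]). a x) * d * last_sum (X 0 g s) p) (E 1 2)"
proof -
  let ?z = "X 0 g s" and ?P = "\<Prod>x\<in>#mset (ylist [0..<n]). a x"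
  have word: "nonempty_prod (**) (map \<phi> w) =
      mat_scale (?P * e * (if hd w = ?z then 1 else 0)) (E 3 4) + mat_scale (?P * d * (if last w = ?z then 1 else 0)) (E 1 2)"
    if w: "w \<in> Poly_Mapping.keys p" for w
  proof -
    have "mset w = mset ([] @ ?z # ylist [0..<n])"
      using multilin_typed_mset[OF p w, of "?z # ylist [0..<n]"] typed_vars_type1[OF g] X_notin_ylist[OF g]
      by simp
    then obtain u v where w: "w = u @ ?z # v" "mset (u @ v) = mset ([] @ ylist [0..<n])" by (rule mset_eq_split)
    have set: "set (u @ v) = set (ylist [0..<n])" using mset_eq_setD[OF w(2)] by simp
    have "u @ v \<noteq> []" using w(2) n mset_eq_length[OF w(2)] by auto
    note * = A2_product_one[of u v \<phi> a ?z d e, OF _ z _ this \<phi>, unfolded w(2) append_Nil]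
    show ?thesis
      unfolding w(1)
    proof (rule *)
      show "X 0 g s \<notin> set (u @ v)" unfolding set by (rule X_notin_ylist[OF g])
      show "\<phi> x = mat_scale (a x) (E 1 1 + E 4 4)" if "x \<in> set (u @ v)" for x
        using that unfolding set by (rule a)
    qed
  qed
  have collect: "(\<Sum>w\<in>Poly_Mapping.keys p. mat_scale (Poly_Mapping.lookup p w) (mat_scale (q * h w) M))
      = mat_scale (q * (\<Sum>w\<in>Poly_Mapping.keys p. Poly_Mapping.lookup p w * h w)) M" for q h and M :: "'f^4^4"
  proof -
    have "(\<Sum>w\<in>Poly_Mapping.keys p. mat_scale (Poly_Mapping.lookup p w) (mat_scale (q * h w) M))
        = mat_scale (\<Sum>w\<in>Poly_Mapping.keys p. Poly_Mapping.lookup p w * (q * h w)) M"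
      by (simp only: mat_scale.scale_scale mat_scale.scale_sum_left)
    then show ?thesis by (simp only: sum_distrib_left mult.left_commute)
  qed
  have "poly_eval (A2 g) \<phi> p = (\<Sum>w\<in>Poly_Mapping.keys p. mat_scale (Poly_Mapping.lookup p w)
     (mat_scale (?P * e * (if hd w = ?z then 1 else 0)) (E 3 4) + mat_scale (?P * d * (if last w = ?z then 1 else 0)) (E 1 2)))"
    unfolding poly_eval_def A2_simps by (intro sum.cong refl) (simp only: word)
  also have "\<dots> = mat_scale (?P * e * first_sum ?z p) (E 3 4) + mat_scale (?P * d * last_sum ?z p) (E 1 2)"
    unfolding mat_scale.scale_right_distrib sum.distrib first_sum_def last_sum_def lin_ext_def by (simp only: collect)
  finally show ?thesis .
qed

lemma A2_ypoint:
  fixes \<phi> :: "'g gvar \<Rightarrow> 'f::field_char_0^4^4"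
  assumes \<phi>: "admissible (A2 g) \<phi>"
  obtains a where "\<And>x. degree x = 0 \<Longrightarrow> \<phi> x = mat_scale (a x) (E 1 1 + E 4 4)"
proof -
  have "\<forall>x. \<exists>a. degree x = 0 \<longrightarrow> \<phi> x = mat_scale a (E 1 1 + E 4 4)"
  proof
    fix x
    show "\<exists>a. degree x = 0 \<longrightarrow> \<phi> x = mat_scale a (E 1 1 + E 4 4)"
    proof (cases "degree x = 0")
      case True
      then have "\<phi> x \<in> hcomp (A2 g) 0" using A2.admissibleD(1)[OF \<phi>, of x] by simp
      then show ?thesis unfolding A2_hcomp by blast
    qed simp
  qed
  then show ?thesis using that by metis
qed

text \<open>The test point takes a value with both components nonzero at the variable of degree
  \<open>g\<close>, so its evaluation displays the two sums in separate entries; conversely, every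
  evaluation is a combination of the two sums.\<close>

lemma gstar_Id_A2_type1:
  fixes p :: "('g, 'f::field_char_0) gpoly"
  assumes p: "p \<in> multilin_typed (type1 g s n)" and n: "n \<ge> 1"
  shows "p \<in> gstar_Id (A2 g) \<longleftrightarrow> first_sum (X 0 g s) p = 0 \<and> last_sum (X 0 g s) p = 0"
proof
  assume "p \<in> gstar_Id (A2 g)"
  then have "poly_eval (A2 g) (A2_point g) p = (0 :: 'f^4^4)"
    using admissible_A2_point[OF g, where 'f = 'f] by (simp add: gstar_Id_iff)
  moreover have "A2_point g x = mat_scale 1 (E 1 1 + E 4 4 :: 'f^4^4)" if "x \<in> set (ylist [0..<n])" for x
    using that by (auto simp: set_ylist A2_point_def vec_eq_iff)
  moreover have "A2_point g (X 0 g s) = mat_scale 1 (E 1 2) + mat_scale (pol_sign s) (E 3 4 :: 'f^4^4)"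
    using g by (cases s) (simp_all add: A2_point_def vec_eq_iff)
  ultimately have 0: "mat_scale (pol_sign s * first_sum (X 0 g s) p) (E 3 4) + mat_scale (last_sum (X 0 g s) p) (E 1 2) = (0 :: 'f^4^4)"
    using A2_eval_type1[OF p n, of "A2_point g" "\<lambda>_. 1" 1 "pol_sign s"] admissible_A2_point[OF g, where 'f = 'f] by simp
  have "pol_sign s * first_sum (X 0 g s) p = 0"
    using arg_cong[OF 0, of "\<lambda>M. M $ 3 $ 4"] by (simp add: E_def)
  moreover have "last_sum (X 0 g s) p = 0"
    using arg_cong[OF 0, of "\<lambda>M. M $ 1 $ 2"] by (simp add: E_def)
  ultimately show "first_sum (X 0 g s) p = 0 \<and> last_sum (X 0 g s) p = 0" by (cases s) simp_all
next
  assume 0: "first_sum (X 0 g s) p = 0 \<and> last_sum (X 0 g s) p = 0"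
  have "poly_eval (A2 g) \<phi> p = 0" if \<phi>: "admissible (A2 g) \<phi>" for \<phi> :: "'g gvar \<Rightarrow> 'f^4^4"
  proof -
    obtain a where "\<And>x. degree x = 0 \<Longrightarrow> \<phi> x = mat_scale (a x) (E 1 1 + E 4 4)" using A2_ypoint[OF \<phi>] by blast
    then have a: "\<phi> x = mat_scale (a x) (E 1 1 + E 4 4)" if "x \<in> set (ylist [0..<n])" for x
      using that by (auto simp: set_ylist)
    have "\<phi> (X 0 g s) \<in> hcomp (A2 g) g" using A2.admissibleD(1)[OF \<phi>, of "X 0 g s"] by simp
    then obtain d e where z: "\<phi> (X 0 g s) = mat_scale d (E 1 2) + mat_scale e (E 3 4)" unfolding A2_hcomp(2)[OF g] by blast
    have "poly_eval (A2 g) \<phi> p = mat_scale 0 (E 3 4) + mat_scale 0 (E 1 2)"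
      using A2_eval_type1[OF p n a z \<phi>] 0 by (simp only: mult_zero_right)
    then show ?thesis by (simp add: vec_eq_iff)
  qed
  moreover have "p \<in> free_alg"
    by (rule multilin_typed_free_alg[OF p], unfold typed_vars_type1[OF g]) simp
  ultimately show "p \<in> gstar_Id (A2 g)" by (simp add: gstar_Id_iff)
qed

text \<open>The words \<open>z # c\<close> and \<open>c @ [z]\<close> give a basis, indexed by the
  truth values; they differ because \<open>n\<close> at least 1 provides a letter in
  \<open>c\<close>. Renaming keeps \<open>z\<close> in its place, so the trace is 2.\<close>

lemma gstar_char_A2_type1:
  assumes n: "n \<ge> 1"
  shows "gstar_char (A2 g :: ('f::field_char_0^4^4, 'f, 'g) gstar_alg) (type1 g s n) =
    (\<lambda>\<sigma>. if \<sigma> \<in> young_group (type1 g s n) then 2 else 0)"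
proof
  fix \<sigma>
  define z :: "'g gvar" and c :: "'g gvar list" where "z = X 0 g s" and "c = ylist [0..<n]"
  have z: "z \<notin> set c" unfolding z_def c_def by (rule X_notin_ylist[OF g])
  have "distinct c" "length c = n" by (simp_all add: c_def)
  then have c: "distinct c" "c \<noteq> []" using n by auto
  have vars: "typed_vars (type1 g s n) = set (z # c)" by (simp only: typed_vars_type1[OF g] z_def c_def)
  have ends: "hd c \<noteq> z" "last c \<noteq> z" using z c by auto
  have dual: "dual_basis pm_scale (multilin_typed (type1 g s n))
      (multilin_typed (type1 g s n) \<inter> gstar_Id (A2 g :: ('f^4^4, 'f, 'g) gstar_alg))
      UNIV (\<lambda>b. word (if b then z # c else c @ [z])) (\<lambda>b. if b then first_sum z else last_sum z)"
  proof (intro dual_basis.intro dual_basis_axioms.intro pm.vector_space_axioms subspace_multilin_typed)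
    show "word (if b then z # c else c @ [z]) \<in> multilin_typed (type1 g s n)" for b
      using z c vars by (intro word_in_multilin_typed) (auto simp del: fun_upd_apply)
    show "(if i then first_sum z else last_sum z) (word (if j then z # c else c @ [z])) = (if i = j then 1 else 0)" for i j
      using ends c by (auto simp: first_sum_def last_sum_def)
    show "Vector_Spaces.linear pm_scale (*) (if b then first_sum z else last_sum z)" for b
      by (simp add: first_sum_def last_sum_def field_mult.linear_lin_ext)
    show "multilin_typed (type1 g s n) \<inter> gstar_Id (A2 g :: ('f^4^4, 'f, 'g) gstar_alg) =
        {p \<in> multilin_typed (type1 g s n). \<forall>b\<in>UNIV. (if b then first_sum z else last_sum z) p = 0}"
      using gstar_Id_A2_type1[OF _ n, of _ s, folded z_def] by (auto simp: UNIV_bool simp del: fun_upd_apply)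
  qed simp
  show "gstar_char (A2 g :: ('f^4^4, 'f, 'g) gstar_alg) (type1 g s n) \<sigma> =
    (if \<sigma> \<in> young_group (type1 g s n) then 2 else 0)"
  proof (cases "\<sigma> \<in> young_group (type1 g s n)")
    case True
    have "rename_var \<sigma> z = z" unfolding z_def by (rule rename_var_type1[OF g True])
    then have "gstar_char (A2 g :: ('f^4^4, 'f, 'g) gstar_alg) (type1 g s n) \<sigma> = 2"
      unfolding gstar_char_dual[OF A2.gstar_algebra_axioms dual True]
      by (simp add: UNIV_bool rename_word) (simp add: first_sum_def last_sum_def)
    then show ?thesis using True by (simp only: if_True)
  qed (simp only: gstar_char_def if_False)
qed

lemma gstar_char_A2_type0:
  assumes "n \<ge> 1"
  shows "gstar_char (A2 g :: ('f::field_char_0^4^4, 'f, 'g) gstar_alg) (type0 n) =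
    (\<lambda>\<sigma>. if \<sigma> \<in> young_group (type0 n) then 1 else 0)"
proof (rule gstar_char_trivial[OF A2.gstar_algebra_axioms])
  show "set (ylist [0..<n]) = typed_vars (type0 n)" by (simp only: typed_vars_type0)
  fix p :: "('g, 'f) gpoly" assume p: "p \<in> multilin_typed (type0 n)"
  have "typed_vars (type0 n :: 'g vtype \<Rightarrow> nat) \<noteq> {}" using assms unfolding typed_vars_type0 set_ylist by simp
  then have free: "p \<in> free_alg" by (rule multilin_typed_free_alg[OF p])
  have eval: "poly_eval (A2 g) \<phi> p = mat_scale (content_sum (mset (ylist [0..<n])) p * (\<Prod>x\<in>#mset (ylist [0..<n]). a x)) (E 1 1 + E 4 4)"
    if a: "\<And>x. degree x = 0 \<Longrightarrow> \<phi> x = mat_scale (a x) (E 1 1 + E 4 4)" for \<phi> :: "'g gvar \<Rightarrow> 'f^4^4" and a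
  proof -
    have mset: "mset w = mset (ylist [0..<n])" if "w \<in> Poly_Mapping.keys p" for w
      using multilin_typed_mset[OF p that, of "ylist [0..<n]"] by (simp add: typed_vars_type0)
    have word: "nonempty_prod (**) (map \<phi> w) = mat_scale (\<Prod>x\<in>#mset (ylist [0..<n]). a x) (E 1 1 + E 4 4)"
      if w: "w \<in> Poly_Mapping.keys p" for w
    proof -
      have "w \<noteq> []" using w free by (auto simp: free_alg_keys)
      moreover have "\<phi> x = mat_scale (a x) (E 1 1 + E 4 4)" if "x \<in> set w" for x
        using that mset_eq_setD[OF mset[OF w]] by (intro a) (auto simp: set_ylist)
      ultimately show ?thesis using A2_product_ywords[of w \<phi> a] mset[OF w] by simp
    qed
    have keys: "{w \<in> Poly_Mapping.keys p. mset w = mset (ylist [0..<n])} = Poly_Mapping.keys p"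
      using mset by auto
    have "poly_eval (A2 g) \<phi> p = (\<Sum>w\<in>Poly_Mapping.keys p. mat_scale (Poly_Mapping.lookup p w)
        (mat_scale (\<Prod>x\<in>#mset (ylist [0..<n]). a x) (E 1 1 + E 4 4)))"
      unfolding poly_eval_def A2_simps by (intro sum.cong refl) (simp only: word)
    also have "\<dots> = mat_scale (\<Sum>w\<in>Poly_Mapping.keys p. Poly_Mapping.lookup p w)
        (mat_scale (\<Prod>x\<in>#mset (ylist [0..<n]). a x) (E 1 1 + E 4 4))"
      by (rule mat_scale.scale_sum_left[symmetric])
    finally show ?thesis
      unfolding content_sum_eq keys mat_scale.scale_scale .
  qed
  show "p \<in> gstar_Id (A2 g) \<longleftrightarrow> content_sum (mset (ylist [0..<n])) p = 0"
  proof
    assume "p \<in> gstar_Id (A2 g)"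
    then have 0: "poly_eval (A2 g) (A2_point g) p = (0 :: 'f^4^4)"
      using admissible_A2_point[OF g, where 'f = 'f] by (simp add: gstar_Id_iff)
    obtain a where a: "\<And>x. degree x = 0 \<Longrightarrow> A2_point g x = mat_scale (a x) (E 1 1 + E 4 4 :: 'f^4^4)"
      using A2_ypoint[OF admissible_A2_point[OF g]] by blast
    have "mat_scale (content_sum (mset (ylist [0..<n])) p * (\<Prod>x\<in>#mset (ylist [0..<n]). a x)) (E 1 1 + E 4 4)
        = (0 :: 'f^4^4)"
      by (rule trans[OF eval[OF a, symmetric] 0])
    from arg_cong[OF this, of "\<lambda>M. M $ 1 $ 1"]
    have "content_sum (mset (ylist [0..<n])) p * (\<Prod>x\<in>#mset (ylist [0..<n]). a x) = 0" by (simp add: E_def)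
    moreover have "a x = 1" if "x \<in> set (ylist [0..<n])" for x
    proof -
      have "A2_point g x = (E 1 1 + E 4 4 :: 'f^4^4)" "degree x = 0" using that by (auto simp: A2_point_def set_ylist)
      then show ?thesis using arg_cong[OF a[of x], of "\<lambda>M. M $ 1 $ 1"] by (simp add: E_def)
    qed
    then have "(\<Prod>x\<in>#mset (ylist [0..<n]). a x) \<noteq> 0" by (auto simp: prod_mset_zero_iff)
    ultimately show "content_sum (mset (ylist [0..<n])) p = 0" by simp
  next
    assume 0: "content_sum (mset (ylist [0..<n])) p = 0"
    have "poly_eval (A2 g) \<phi> p = 0" if \<phi>: "admissible (A2 g) \<phi>" for \<phi> :: "'g gvar \<Rightarrow> 'f^4^4"
    proof -
      obtain a where a: "\<And>x. degree x = 0 \<Longrightarrow> \<phi> x = mat_scale (a x) (E 1 1 + E 4 4)" using A2_ypoint[OF \<phi>] by blast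
      have "poly_eval (A2 g) \<phi> p = mat_scale 0 (E 1 1 + E 4 4)"
        using eval[OF a] 0 by (simp only: mult_zero_left)
      then show ?thesis by (simp add: vec_eq_iff)
    qed
    then show "p \<in> gstar_Id (A2 g)" using free by (simp add: gstar_Id_iff)
  qed
qed simp

end


section \<open>Specht modules\<close>

text \<open>Prescribing the independent set \<open>S\<close> allows a basis adapted to a subspace,
  as the trace computation for a transposition needs.\<close>

lemma exists_dual_basis:
  fixes V :: "('k \<Rightarrow>\<^sub>0 'f::field_char_0) set"
  assumes V: "pm.subspace V" "V \<subseteq> pm.span R" "finite R" and S: "S \<subseteq> V" "pm.independent S"
  obtains B f where "S \<subseteq> B" "B \<subseteq> V" "finite B" "dual_basis pm_scale V {0} B (\<lambda>b. b) f"
proof -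
  obtain B where B: "S \<subseteq> B" "B \<subseteq> V" "pm.independent B" "V \<subseteq> pm.span B"
    using pm.maximal_independent_subset_extend[OF S] by blast
  have fin: "finite B"
    using pm.independent_span_bound[OF V(3) B(3)] B(2) V(2) by blast
  interpret vector_space_pair "pm_scale :: 'f \<Rightarrow> ('k \<Rightarrow>\<^sub>0 'f) \<Rightarrow> _" "(*) :: 'f \<Rightarrow> _" ..
  have "\<exists>f. Vector_Spaces.linear pm_scale (*) f \<and> (\<forall>x\<in>B. f x = (if b = x then 1 else 0 :: 'f))" for b
    by (rule linear_independent_extend[OF B(3)])
  then obtain f where f: "\<And>b. Vector_Spaces.linear pm_scale (*) (f b)"
    "\<And>b x. x \<in> B \<Longrightarrow> f b x = (if b = x then 1 else 0 :: 'f)" by metis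
  have "dual_basis pm_scale V {0} B (\<lambda>b. b) f"
  proof (intro dual_basis.intro dual_basis_axioms.intro pm.vector_space_axioms)
    have "v = 0" if v: "v \<in> V" "\<forall>b\<in>B. f b v = 0" for v
    proof -
      obtain r where r: "v = (\<Sum>b\<in>B. pm_scale (r b) b)" using v(1) B(4) pm.span_finite[OF fin] by auto
      have "r b = 0" if b: "b \<in> B" for b
      proof -
        interpret f: Vector_Spaces.linear pm_scale "(*)" "f b" by (rule f)
        have "f b v = (\<Sum>x\<in>B. if b = x then r x else 0)"
          unfolding r by (auto simp: f.sum f.scale f(2) intro!: sum.cong)
        then show ?thesis using v(2) b fin by simp
      qed
      then show ?thesis unfolding r by (intro sum.neutral) auto
    qed
    moreover have "f b 0 = 0" for b using f(1)[of b] by (metis field_mult.scale_zero_left pm.scale_zero_left linear_scale)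
    ultimately show "{0} = {v \<in> V. \<forall>b\<in>B. f b v = 0}"
      using pm.subspace_0[OF V(1)] by auto
  qed (use V B fin f in auto)
  then show ?thesis using that B fin by blast
qed

section \<open>The action of permutations on tabloids and polytabloids\<close>

abbreviation tabloid_act :: "(nat \<Rightarrow> nat) \<Rightarrow> ((nat \<Rightarrow> nat) \<Rightarrow>\<^sub>0 'f) \<Rightarrow> ((nat \<Rightarrow> nat) \<Rightarrow>\<^sub>0 'f::field)"
  where "tabloid_act \<pi> \<equiv> pm_push (\<lambda>r. r \<circ> inv \<pi>)"

lemma tabloid_comp: "\<pi> permutes {..<n} \<Longrightarrow> tabloid n t \<circ> inv \<pi> = tabloid n (t \<circ> inv \<pi>)"
  using permutes_in_image[OF permutes_inv, of \<pi> "{..<n}"] by (auto simp: tabloid_def fun_eq_iff)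

lemma linear_tabloid_act: "Vector_Spaces.linear pm_scale pm_scale (tabloid_act \<pi>)"
  by (rule linear_pm_push)

lemma tabloid_act_polytabloid_sum:
  assumes \<pi>: "\<pi> permutes {..<n}"
  shows "tabloid_act \<pi> (polytabloid n t) =
    (\<Sum>\<rho>\<in>column_stabilizer n t. Poly_Mapping.single (tabloid n (t \<circ> inv \<rho> \<circ> inv \<pi>)) (of_int (sign \<rho>)))"
proof -
  interpret Vector_Spaces.linear pm_scale pm_scale "tabloid_act \<pi>" by (rule linear_tabloid_act)
  show ?thesis
    unfolding polytabloid_def sum by (rule sum.cong[OF refl]) (simp add: tabloid_comp[OF \<pi>] o_assoc)
qed

lemma column_stabilizerD:
  assumes "\<rho> \<in> column_stabilizer n t"
  shows "\<rho> permutes {..<n}" "k < n \<Longrightarrow> snd (t (\<rho> k)) = snd (t k)" "k < n \<Longrightarrow> snd (t (inv \<rho> k)) = snd (t k)"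
proof -
  show \<rho>: "\<rho> permutes {..<n}" and snd: "k < n \<Longrightarrow> snd (t (\<rho> k)) = snd (t k)" for k
    using assms by (simp_all add: column_stabilizer_def)
  show "snd (t (inv \<rho> k)) = snd (t k)" if "k < n"
  proof -
    have "inv \<rho> k < n" using permutes_in_image[OF permutes_inv[OF \<rho>], of k] that by simp
    from snd[OF this] show ?thesis by (simp add: permutes_inverses[OF \<rho>])
  qed
qed

text \<open>Conjugation by \<open>\<pi>\<close> carries the column stabilizer of \<open>t\<close> to
  that of the moved tableau and preserves signs.\<close>

lemma tabloid_act_polytabloid:
  assumes \<pi>: "\<pi> permutes {..<n}"
  shows "tabloid_act \<pi> (polytabloid n t) = polytabloid n (t \<circ> inv \<pi>)"
proof -
  note inv = permutes_inverses[OF \<pi>] permutes_inv_o[OF \<pi>]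
  note less = permutes_in_image[OF \<pi>, of _, unfolded lessThan_iff] permutes_in_image[OF permutes_inv[OF \<pi>], of _, unfolded lessThan_iff]
  have fwd: "\<pi> \<circ> \<rho> \<circ> inv \<pi> \<in> column_stabilizer n (t \<circ> inv \<pi>)" if \<rho>: "\<rho> \<in> column_stabilizer n t" for \<rho>
    unfolding column_stabilizer_def
    using \<pi> column_stabilizerD[OF \<rho>] less by (auto intro!: permutes_compose permutes_inv simp: inv)
  have bwd: "inv \<pi> \<circ> \<rho> \<circ> \<pi> \<in> column_stabilizer n t" if \<rho>: "\<rho> \<in> column_stabilizer n (t \<circ> inv \<pi>)" for \<rho>
    unfolding column_stabilizer_def
    using \<pi> column_stabilizerD[OF \<rho>] less by (auto intro!: permutes_compose permutes_inv simp: inv)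
  show ?thesis
    unfolding tabloid_act_polytabloid_sum[OF \<pi>] unfolding polytabloid_def
  proof (rule sum.reindex_bij_witness[where i = "\<lambda>\<rho>. inv \<pi> \<circ> \<rho> \<circ> \<pi>" and j = "\<lambda>\<rho>. \<pi> \<circ> \<rho> \<circ> inv \<pi>"])
    fix \<rho> assume \<rho>: "\<rho> \<in> column_stabilizer n t"
    have perm: "permutation \<pi>" "permutation \<rho>" "permutation (inv \<pi>)"
      using \<pi> column_stabilizerD(1)[OF \<rho>] permutes_inv[OF \<pi>] by (auto simp: permutation_permutes)
    then have "sign (\<pi> \<circ> \<rho> \<circ> inv \<pi>) = sign \<rho>"
      by (simp add: sign_compose permutation_compose sign_inverse)
    moreover have "t \<circ> inv \<pi> \<circ> inv (\<pi> \<circ> \<rho> \<circ> inv \<pi>) = t \<circ> inv \<rho> \<circ> inv \<pi>"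
    proof -
      have b: "bij \<pi>" "bij \<rho>" "bij (inv \<pi>)" "bij (\<pi> \<circ> \<rho>)"
        using permutes_bij[OF \<pi>] permutes_bij[OF column_stabilizerD(1)[OF \<rho>]] by (auto simp: bij_imp_bij_inv bij_comp)
      have "inv (\<pi> \<circ> \<rho> \<circ> inv \<pi>) = \<pi> \<circ> (inv \<rho> \<circ> inv \<pi>)"
        using b by (simp add: o_inv_distrib inv_inv_eq)
      then show ?thesis by (auto simp: fun_eq_iff inv)
    qed
    ultimately show "Poly_Mapping.single (tabloid n (t \<circ> inv \<pi> \<circ> inv (\<pi> \<circ> \<rho> \<circ> inv \<pi>))) (of_int (sign (\<pi> \<circ> \<rho> \<circ> inv \<pi>)))
      = Poly_Mapping.single (tabloid n (t \<circ> inv \<rho> \<circ> inv \<pi>)) (of_int (sign \<rho>))" by simp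
  qed (use fwd bwd inv in \<open>auto simp: fun_eq_iff\<close>)
qed

text \<open>Left translation by \<open>s\<close> permutes the column stabilizer and multiplies signs
  by \<open>sign s\<close>.\<close>

lemma tabloid_act_column:
  assumes s: "s \<in> column_stabilizer n t"
  shows "tabloid_act s (polytabloid n t) = pm_scale (of_int (sign s)) (polytabloid n t :: _ \<Rightarrow>\<^sub>0 'f::field)"
proof -
  note sp = column_stabilizerD(1)[OF s]
  note inv = permutes_inverses[OF sp]
  note less = permutes_in_image[OF sp, of _, unfolded lessThan_iff] permutes_in_image[OF permutes_inv[OF sp], of _, unfolded lessThan_iff]
  have mem: "s \<circ> \<rho> \<in> column_stabilizer n t" "inv s \<circ> \<rho> \<in> column_stabilizer n t" if \<rho>: "\<rho> \<in> column_stabilizer n t" for \<rho>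
    using column_stabilizerD[OF s] column_stabilizerD[OF \<rho>] permutes_in_image[OF column_stabilizerD(1)[OF \<rho>]]
    by (auto simp: column_stabilizer_def intro!: permutes_compose permutes_inv)
  have "tabloid_act s (polytabloid n t :: _ \<Rightarrow>\<^sub>0 'f) = (\<Sum>\<rho>\<in>column_stabilizer n t.
      pm_scale (of_int (sign s)) (Poly_Mapping.single (tabloid n (t \<circ> inv \<rho>)) (of_int (sign \<rho>))))"
    unfolding tabloid_act_polytabloid_sum[OF sp]
  proof (rule sum.reindex_bij_witness[where i = "\<lambda>\<rho>. inv s \<circ> \<rho>" and j = "\<lambda>\<rho>. s \<circ> \<rho>"])
    fix \<rho> assume \<rho>: "\<rho> \<in> column_stabilizer n t"
    have "permutation s" "permutation \<rho>"
      using sp column_stabilizerD(1)[OF \<rho>] by (auto simp: permutation_permutes)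
    then have "sign s * sign (s \<circ> \<rho>) = sign \<rho>" by (simp add: sign_compose sign_idempotent mult.assoc[symmetric])
    then have "of_int (sign s) * of_int (sign (s \<circ> \<rho>)) = (of_int (sign \<rho>) :: 'f)" by (metis of_int_mult)
    moreover have "t \<circ> inv (s \<circ> \<rho>) = t \<circ> inv \<rho> \<circ> inv s"
      using permutes_bij[OF sp] permutes_bij[OF column_stabilizerD(1)[OF \<rho>]] by (simp add: o_inv_distrib o_assoc)
    ultimately show "pm_scale (of_int (sign s)) (Poly_Mapping.single (tabloid n (t \<circ> inv (s \<circ> \<rho>))) (of_int (sign (s \<circ> \<rho>))))
      = (Poly_Mapping.single (tabloid n (t \<circ> inv \<rho> \<circ> inv s)) (of_int (sign \<rho>)) :: _ \<Rightarrow>\<^sub>0 'f)" by simp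
  qed (use mem inv in \<open>auto simp: fun_eq_iff\<close>)
  then show ?thesis unfolding polytabloid_def pm.scale_sum_right .
qed

lemma finite_column_stabilizer: "finite (column_stabilizer n t)"
  unfolding column_stabilizer_def by (rule finite_subset[OF _ finite_permutations[of "{..<n}"]]) auto

text \<open>The coefficient at the tabloid of \<open>t\<close> is 1: a permutation that keeps the
  row and the column of every entry is the identity.\<close>

lemma polytabloid_nonzero:
  assumes t: "inj_on t {..<n}"
  shows "polytabloid n t \<noteq> (0 :: _ \<Rightarrow>\<^sub>0 'f::field)"
proof -
  have id: "\<rho> = id" if \<rho>: "\<rho> \<in> column_stabilizer n t" and eq: "tabloid n (t \<circ> inv \<rho>) = tabloid n t" for \<rho>
  proof -
    have "inv \<rho> k = k" for k
    proof (cases "k < n")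
      case True
      have "fst (t (inv \<rho> k)) = fst (t k)" using True fun_cong[OF eq, of k] by (simp add: tabloid_def)
      then have "t (inv \<rho> k) = t k" using column_stabilizerD(3)[OF \<rho> True] by (simp add: prod_eq_iff)
      moreover have "inv \<rho> k < n"
        using permutes_in_image[OF permutes_inv[OF column_stabilizerD(1)[OF \<rho>]], of k] True by simp
      ultimately show ?thesis using t True by (simp add: inj_on_def)
    next
      case False
      then show ?thesis using permutes_not_in[OF permutes_inv[OF column_stabilizerD(1)[OF \<rho>]], of k] by simp
    qed
    then have "\<rho> k = k" for k
      using permutes_inverses(1)[OF column_stabilizerD(1)[OF \<rho>], of k] by simp
    then show ?thesis by (auto simp: fun_eq_iff)
  qed
  have "Poly_Mapping.lookup (polytabloid n t) (tabloid n t) =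
      (\<Sum>\<rho>\<in>column_stabilizer n t. if \<rho> = id then 1 else 0 :: 'f)"
    unfolding polytabloid_def lookup_sum lookup_single
    by (rule sum.cong[OF refl]) (use id in \<open>auto simp: when_def sign_id\<close>)
  also have "\<dots> = 1"
    using finite_column_stabilizer[of n t] by (simp add: column_stabilizer_def permutes_id)
  finally show ?thesis by auto
qed

lemma card_boxes: "card {(i, j). i < length l \<and> j < l ! i} = sum_list l"
  and finite_boxes: "finite {(i, j). i < length l \<and> j < l ! i}"
proof -
  have *: "{(i, j). i < length l \<and> j < l ! i} = (SIGMA i : {..<length l}. {..<l ! i})" by auto
  show "card {(i, j). i < length l \<and> j < l ! i} = sum_list l"
    unfolding * by (simp add: sum_list_sum_nth lessThan_atLeast0)
  show "finite {(i, j). i < length l \<and> j < l ! i}" unfolding * by simp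
qed

lemma tableaux_nonempty: "tableaux l \<noteq> {}"
  using ex_bij_betw_nat_finite[OF finite_boxes[of l]] card_boxes[of l]
  by (auto simp: tableaux_def lessThan_atLeast0)

lemma tableauxD:
  assumes "t \<in> tableaux l"
  shows "inj_on t {..<sum_list l}" "t ` {..<sum_list l} = {(i, j). i < length l \<and> j < l ! i}"
  using assms by (auto simp: tableaux_def bij_betw_def)

lemma tableaux_comp:
  assumes "t \<in> tableaux l" "\<pi> permutes {..<sum_list l}"
  shows "t \<circ> \<pi> \<in> tableaux l"
  using assms permutes_imp_bij[OF assms(2)] by (auto simp: tableaux_def intro: bij_betw_trans)

lemma subspace_specht: "pm.subspace (specht l)"
  unfolding specht_def by (rule pm.subspace_span)

lemma polytabloid_in_specht: "t \<in> tableaux l \<Longrightarrow> polytabloid (sum_list l) t \<in> specht l"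
  unfolding specht_def by (intro pm.span_base imageI)

lemma specht_induct:
  assumes "v \<in> specht l" "pm.subspace {v. P v}" "\<And>t. t \<in> tableaux l \<Longrightarrow> P (polytabloid (sum_list l) t)"
  shows "P v"
  using pm.span_minimal[of "polytabloid (sum_list l) ` tableaux l" "{v. P v}"] assms by (auto simp: specht_def)

text \<open>Tabloids are functions on all naturals, but only finitely many arise from a given shape,
  so the Specht module is finite-dimensional.\<close>

lemma specht_tabloids:
  obtains R where "finite R" "(specht l :: (_ \<Rightarrow>\<^sub>0 'f::field) set) \<subseteq> pm.span R"
proof
  let ?R = "{r. \<forall>k. (k \<in> {..<sum_list l} \<longrightarrow> r k \<in> {..<length l}) \<and> (k \<notin> {..<sum_list l} \<longrightarrow> r k = 0)}"
  let ?S = "(\<lambda>r. Poly_Mapping.single r (1 :: 'f)) ` ?R"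
  show "finite ?S" by (intro finite_imageI finite_set_of_finite_funs) auto
  show "specht l \<subseteq> pm.span ?S"
  proof
    fix v :: "_ \<Rightarrow>\<^sub>0 'f" assume "v \<in> specht l"
    then show "v \<in> pm.span ?S"
    proof (rule specht_induct)
      fix t assume t: "t \<in> tableaux l"
      have "tabloid (sum_list l) (t \<circ> inv \<rho>) \<in> ?R" if "\<rho> \<in> column_stabilizer (sum_list l) t" for \<rho>
      proof -
        have "t \<circ> inv \<rho> \<in> tableaux l"
          by (rule tableaux_comp[OF t permutes_inv[OF column_stabilizerD(1)[OF that]]])
        note boxes = tableauxD(2)[OF this]
        have "fst ((t \<circ> inv \<rho>) k) < length l" if "k < sum_list l" for k
        proof -
          have "(t \<circ> inv \<rho>) k \<in> {(i, j). i < length l \<and> j < l ! i}" unfolding boxes[symmetric] using that by simp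
          then show ?thesis by (simp add: case_prod_beta)
        qed
        then show ?thesis by (simp add: tabloid_def)
      qed
      then have "\<And>\<rho>. \<rho> \<in> column_stabilizer (sum_list l) t \<Longrightarrow>
         pm_scale (of_int (sign \<rho>)) (Poly_Mapping.single (tabloid (sum_list l) (t \<circ> inv \<rho>)) 1) \<in> pm.span ?S"
        by (intro pm.span_scale pm.span_base imageI)
      then show "polytabloid (sum_list l) t \<in> pm.span ?S"
        unfolding polytabloid_def by (intro pm.span_sum) simp
    qed simp
  qed
qed

lemma tabloid_act_specht:
  assumes \<pi>: "\<pi> permutes {..<sum_list l}" and v: "v \<in> specht l"
  shows "tabloid_act \<pi> v \<in> specht l"
  using v
proof (rule specht_induct)
  interpret Vector_Spaces.linear pm_scale pm_scale "tabloid_act \<pi>" by (rule linear_tabloid_act)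
  show "pm.subspace {v. tabloid_act \<pi> v \<in> specht l}"
    by (rule subspace_linear_preimage[OF subspace_specht])
  show "tabloid_act \<pi> (polytabloid (sum_list l) t) \<in> specht l" if "t \<in> tableaux l" for t
    unfolding tabloid_act_polytabloid[OF \<pi>] by (intro polytabloid_in_specht tableaux_comp that permutes_inv \<pi>)
qed

text \<open>The two boxes head the first column, so that the transposition of \<open>i\<close> and
  \<open>j\<close> becomes a column permutation. Swapping boxes in an arbitrary tableau puts the
  entries there.\<close>

lemma tableau_with_entries:
  assumes l: "is_partition l" "length l \<ge> 2" and ij: "i < sum_list l" "j < sum_list l" "i \<noteq> j"
  obtains t where "t \<in> tableaux l" "t i = (0, 0)" "t j = (1, 0)"
proof -
  let ?B = "{(i, j). i < length l \<and> j < l ! i}"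
  have "l ! 0 \<in> set l" "l ! 1 \<in> set l" by (rule nth_mem, use l(2) in linarith)+
  then have boxes: "(0, 0) \<in> ?B" "(1, 0) \<in> ?B" using l by (auto simp: is_partition_def)
  obtain t0 where t0: "bij_betw t0 {..<sum_list l} ?B" using tableaux_nonempty[of l] by (auto simp: tableaux_def)
  define t1 where "t1 = Transposition.transpose (t0 i) (0, 0) \<circ> t0"
  have tr: "bij_betw (Transposition.transpose a b) ?B ?B" if "a \<in> ?B" "b \<in> ?B" for a b
    by (rule permutes_imp_bij) (rule permutes_swap_id[OF that])
  have "t0 i \<in> ?B" using bij_betw_apply[OF t0, of i] ij by simp
  then have t1: "bij_betw t1 {..<sum_list l} ?B" "t1 i = (0, 0)"
    unfolding t1_def using t0 tr boxes by (auto intro: bij_betw_trans)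
  define t2 where "t2 = Transposition.transpose (t1 j) (1, 0) \<circ> t1"
  have "t1 j \<in> ?B" using bij_betw_apply[OF t1(1), of j] ij by simp
  then have t2: "bij_betw t2 {..<sum_list l} ?B" "t2 j = (1, 0)"
    unfolding t2_def using t1 tr boxes by (auto intro: bij_betw_trans)
  have "t1 i \<noteq> t1 j" using t1(1) ij by (auto simp: bij_betw_def inj_on_def)
  then have "t2 i = (0, 0)" using t1(2) by (simp add: t2_def transpose_apply_other)
  then show ?thesis using t2 that by (auto simp: tableaux_def)
qed

lemma transpose_column_stabilizer:
  assumes "i < n" "j < n" "snd (t i) = snd (t j)"
  shows "Transposition.transpose i j \<in> column_stabilizer n t"
  using assms by (auto simp: column_stabilizer_def Transposition.transpose_def intro!: permutes_swap_id)

lemma tabloid_act_transpose: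
  assumes "i < n" "j < n" "i \<noteq> j" "snd (t i) = snd (t j)"
  shows "tabloid_act (Transposition.transpose i j) (polytabloid n t) = - polytabloid n t"
  using tabloid_act_column[OF transpose_column_stabilizer[OF assms(1,2,4)]] assms(3)
  by (simp add: sign_swap_id)


subsection \<open>Characters of Specht modules\<close>

lemma specht_dual_basis:
  fixes S :: "((nat \<Rightarrow> nat) \<Rightarrow>\<^sub>0 'f::field_char_0) set"
  assumes "S \<subseteq> specht l" "pm.independent S"
  obtains B f where "S \<subseteq> B" "B \<subseteq> specht l" "finite B" "dual_basis pm_scale (specht l) {0} B (\<lambda>b. b) f"
proof -
  obtain R where "finite R" "(specht l :: (_ \<Rightarrow>\<^sub>0 'f) set) \<subseteq> pm.span R" by (rule specht_tabloids)
  then show ?thesis using that exists_dual_basis[OF subspace_specht _ _ assms] by blast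
qed

lemma specht_char_dual:
  assumes dual: "dual_basis pm_scale (specht l) {0} I e f" and \<pi>: "\<pi> permutes {..<sum_list l}"
  shows "specht_char l \<pi> = (\<Sum>i\<in>I. f i (tabloid_act \<pi> (e i)))"
  unfolding specht_char_def
proof (rule dual_basis.quot_trace[OF dual linear_tabloid_act])
  interpret Vector_Spaces.linear pm_scale pm_scale "tabloid_act \<pi> :: (_ \<Rightarrow>\<^sub>0 'a) \<Rightarrow> _" by (rule linear_tabloid_act)
  show "tabloid_act \<pi> v \<in> {0}" if "v \<in> {0}" for v :: "_ \<Rightarrow>\<^sub>0 'a" using that by (simp add: zero)
qed (rule tabloid_act_specht[OF \<pi>])

lemma tabloid_act_id: "tabloid_act id v = v"
  using sum_single[of v] by (simp add: pm_push_def)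

text \<open>The trace of the identity is the dimension, which is positive because polytabloids do
  not vanish.\<close>

lemma specht_char_id:
  obtains d where "d \<ge> 1" "specht_char l id = (of_nat d :: 'f::field_char_0)"
proof -
  obtain B and f :: "_ \<Rightarrow> _ \<Rightarrow> 'f" where B: "{} \<subseteq> B" "B \<subseteq> specht l" "finite B"
      "dual_basis pm_scale (specht l) {0} B (\<lambda>b. b) f"
    by (rule specht_dual_basis[OF empty_subsetI pm.independent_empty, of l])
  interpret dual_basis pm_scale "specht l" "{0}" B "\<lambda>b. b" f by fact
  have "B \<noteq> {}"
  proof
    assume "B = {}"
    then have "specht l = {0 :: _ \<Rightarrow>\<^sub>0 'f}" using W_eq by simp
    moreover obtain t where "t \<in> tableaux l" using tableaux_nonempty by blast
    ultimately show False using polytabloid_in_specht polytabloid_nonzero[OF tableauxD(1)] by blast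
  qed
  then have "card B \<ge> 1" using B(3) by (simp add: Suc_le_eq card_gt_0_iff)
  moreover have "specht_char l id = (of_nat (card B) :: 'f)"
    using specht_char_dual[OF B(4) permutes_id] unfolding tabloid_act_id by (simp add: dual)
  ultimately show ?thesis by (rule that)
qed

text \<open>A transposition in the column stabilizer of \<open>t\<close> negates the polytabloid of \<open>t\<close>, so that it is killed
  by the symmetrizer: the trivial representation does not occur.\<close>

lemma sum_specht_char:
  assumes l: "is_partition l" "length l \<ge> 2" and n: "sum_list l \<ge> 2"
  shows "(\<Sum>\<pi> | \<pi> permutes {..<sum_list l}. specht_char l \<pi>) = (0 :: 'f::field_char_0)"
proof -
  let ?n = "sum_list l" and ?P = "{\<pi>. \<pi> permutes {..<sum_list l}}"
  obtain B and f :: "_ \<Rightarrow> _ \<Rightarrow> 'f" where B: "{} \<subseteq> B" "B \<subseteq> specht l" "finite B"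
      "dual_basis pm_scale (specht l) {0} B (\<lambda>b. b) f"
    by (rule specht_dual_basis[OF empty_subsetI pm.independent_empty, of l])
  interpret dual_basis pm_scale "specht l" "{0}" B "\<lambda>b. b" f by fact
  have "(\<Sum>\<pi>\<in>?P. tabloid_act \<pi> v) = 0" if "v \<in> specht l" for v :: "_ \<Rightarrow>\<^sub>0 'f"
    using that
  proof (rule specht_induct)
    have "Vector_Spaces.linear pm_scale pm_scale (tabloid_act \<pi> :: (_ \<Rightarrow>\<^sub>0 'f) \<Rightarrow> _)" for \<pi>
      by (rule linear_tabloid_act)
    then have "Vector_Spaces.linear pm_scale pm_scale (\<lambda>v :: _ \<Rightarrow>\<^sub>0 'f. \<Sum>\<pi>\<in>?P. tabloid_act \<pi> v)"
      by (auto simp: Vector_Spaces.linear_iff sum.distrib pm.scale_sum_right)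
    then interpret S: Vector_Spaces.linear pm_scale pm_scale "\<lambda>v :: _ \<Rightarrow>\<^sub>0 'f. \<Sum>\<pi>\<in>?P. tabloid_act \<pi> v" .
    show "pm.subspace {v :: _ \<Rightarrow>\<^sub>0 'f. (\<Sum>\<pi>\<in>?P. tabloid_act \<pi> v) = 0}" by (rule S.subspace_kernel)
    fix t assume t: "t \<in> tableaux l"
    have "l ! 0 \<in> set l" "l ! 1 \<in> set l" by (rule nth_mem, use l(2) in linarith)+
    then have "(0, 0) \<in> t ` {..<?n}" "(1, 0) \<in> t ` {..<?n}"
      unfolding tableauxD(2)[OF t] using l by (auto simp: is_partition_def)
    then obtain i j where ij: "i < ?n" "j < ?n" "t i = (0, 0)" "t j = (1, 0)" by (metis imageE lessThan_iff)
    then have neq: "i \<noteq> j" by auto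
    define s where "s = Transposition.transpose i j"
    have s: "s permutes {..<?n}" unfolding s_def using ij by (intro permutes_swap_id) auto
    have "(\<Sum>\<pi>\<in>?P. tabloid_act \<pi> (polytabloid ?n t)) = (\<Sum>\<pi>\<in>?P. tabloid_act \<pi> (- polytabloid ?n t) :: _ \<Rightarrow>\<^sub>0 'f)"
    \<comment> \<open>Right multiplication by \<open>s\<close> permutes the group, and the inner
      \<open>s\<close> turns the polytabloid into its negative; the sum thus equals its own
      negative.\<close>
    proof (rule sum.reindex_bij_witness[where i = "\<lambda>\<pi>. \<pi> \<circ> s" and j = "\<lambda>\<pi>. \<pi> \<circ> s"])
      fix \<pi> assume "\<pi> \<in> ?P"
      then have \<pi>: "\<pi> permutes {..<?n}" by simp
      have "- polytabloid ?n t = (tabloid_act s (polytabloid ?n t) :: _ \<Rightarrow>\<^sub>0 'f)"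
        unfolding s_def by (subst tabloid_act_transpose) (use ij neq in auto)
      moreover have "t \<circ> inv s \<circ> inv (\<pi> \<circ> s) = t \<circ> inv \<pi>"
        using permutes_bij[OF s] permutes_bij[OF \<pi>] by (simp add: o_inv_distrib fun_eq_iff) (simp add: s_def)
      ultimately show "tabloid_act (\<pi> \<circ> s) (- polytabloid ?n t) = (tabloid_act \<pi> (polytabloid ?n t) :: _ \<Rightarrow>\<^sub>0 'f)"
        by (simp only: tabloid_act_polytabloid[OF s] tabloid_act_polytabloid[OF \<pi>]
          tabloid_act_polytabloid[OF permutes_compose[OF s \<pi>]])
      show "\<pi> \<circ> s \<in> ?P" using permutes_compose[OF s \<pi>] by simp
    qed (auto simp: s_def fun_eq_iff intro!: permutes_compose[OF s[unfolded s_def]])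
    also have "\<dots> = - (\<Sum>\<pi>\<in>?P. tabloid_act \<pi> (polytabloid ?n t))" by (rule S.neg)
    finally have "pm_scale 2 (\<Sum>\<pi>\<in>?P. tabloid_act \<pi> (polytabloid ?n t) :: _ \<Rightarrow>\<^sub>0 'f) = 0"
      by (metis (no_types, lifting) eq_neg_iff_add_eq_0 one_add_one pm.scale_left_distrib pm.scale_one)
    then show "(\<Sum>\<pi>\<in>?P. tabloid_act \<pi> (polytabloid ?n t) :: _ \<Rightarrow>\<^sub>0 'f) = 0" by simp
  qed
  \<comment> \<open>The sum of all permutations acts as zero, and its trace is the sum of the
    character values.\<close>
  then have "quot_trace pm_scale (specht l) {0} (\<lambda>v :: _ \<Rightarrow>\<^sub>0 'f. \<Sum>\<pi>\<in>?P. tabloid_act \<pi> v) = 0"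
    by (intro quot_trace_zero[OF quot_basis_e]) simp
  then show ?thesis
    unfolding specht_char_def
    by (subst (asm) quot_trace_sum[OF quot_basis_e]) (auto intro: tabloid_act_specht)
qed

text \<open>The difference is the trace of \<open>1 - s\<close>, twice a projection onto the \<open>- 1\<close> eigenspace of the
  transposition \<open>s\<close>.\<close>

lemma specht_char_transpose:
  assumes l: "is_partition l" "length l \<ge> 2" and n: "sum_list l \<ge> 2"
  obtains k where "k \<ge> 1" "specht_char l id - specht_char l (Transposition.transpose 0 1) = (2 * of_nat k :: 'f::field_char_0)"
proof -
  define s where "s = Transposition.transpose 0 (1::nat)"
  have s: "s permutes {..<sum_list l}" unfolding s_def using n by (intro permutes_swap_id) auto
  interpret s: Vector_Spaces.linear pm_scale pm_scale "tabloid_act s :: (_ \<Rightarrow>\<^sub>0 'f) \<Rightarrow> _" by (rule linear_tabloid_act)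
  define V1 where "V1 = {v :: _ \<Rightarrow>\<^sub>0 'f. v \<in> specht l \<and> tabloid_act s v = - v}"
  have V1: "pm.subspace V1"
    unfolding V1_def by (rule pm.subspaceI)
      (auto simp: s.add s.scale pm.subspace_0[OF subspace_specht] pm.subspace_add[OF subspace_specht]
        pm.subspace_scale[OF subspace_specht])
  obtain B1 where B1: "B1 \<subseteq> V1" "pm.independent B1" "V1 \<subseteq> pm.span B1"
    using pm.maximal_independent_subset[of V1] by blast
  obtain B and f :: "_ \<Rightarrow> _ \<Rightarrow> 'f" where B: "B1 \<subseteq> B" "B \<subseteq> specht l" "finite B"
      "dual_basis pm_scale (specht l) {0} B (\<lambda>b. b) f"
    using specht_dual_basis[of B1 l] B1 unfolding V1_def by blast
  interpret dual_basis pm_scale "specht l" "{0}" B "\<lambda>b. b" f by fact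
  have act_act: "tabloid_act s (tabloid_act s v) = v" if "v \<in> specht l" for v :: "_ \<Rightarrow>\<^sub>0 'f"
    using that
  proof (rule specht_induct)
    have "Vector_Spaces.linear pm_scale pm_scale (\<lambda>v :: _ \<Rightarrow>\<^sub>0 'f. tabloid_act s (tabloid_act s v) - v)"
      by (simp add: Vector_Spaces.linear_iff pm.vector_space_axioms s.add s.scale pm.scale_right_diff_distrib)
    then interpret D: Vector_Spaces.linear pm_scale pm_scale "\<lambda>v :: _ \<Rightarrow>\<^sub>0 'f. tabloid_act s (tabloid_act s v) - v" .
    show "pm.subspace {v :: _ \<Rightarrow>\<^sub>0 'f. tabloid_act s (tabloid_act s v) = v}"
      using D.subspace_kernel by simp
    show "tabloid_act s (tabloid_act s (polytabloid (sum_list l) t)) = polytabloid (sum_list l) t" for t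
      unfolding tabloid_act_polytabloid[OF s] by (simp add: o_assoc[symmetric] s_def)
  qed
  \<comment> \<open>The basis extends a basis \<open>B1\<close> of the \<open>-1\<close> eigenspace
    \<open>V1\<close>, which contains every \<open>b - tabloid_act s b\<close>; so the diagonal
    entry of \<open>1 - s\<close> is 2 on \<open>B1\<close> and 0 elsewhere.\<close>
  have "f b (b - tabloid_act s b) = (if b \<in> B1 then 2 else 0)" if b: "b \<in> B" for b
  proof (cases "b \<in> B1")
    case True
    then have "tabloid_act s b = - b" using B1 by (auto simp: V1_def)
    then have "b - tabloid_act s b = pm_scale 2 b" by (simp add: pm.scale_left_distrib[of 1 1, simplified])
    then show ?thesis using True b by (simp add: f_scale dual)
  next
    case False
    have "b \<in> specht l" using b B(2) by blast
    then have "b - tabloid_act s b \<in> V1"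
      using act_act[of b] pm.subspace_diff[OF subspace_specht] tabloid_act_specht[OF s, of b]
      by (auto simp: V1_def s.diff)
    then have "b - tabloid_act s b \<in> pm.span B1" using B1 by blast
    moreover have "pm.subspace {v. f b v = 0}"
      using b by (intro pm.subspaceI) (auto simp: f_zero f_add f_scale)
    moreover have "B1 \<subseteq> {v. f b v = 0}" using B False b dual by auto
    ultimately show ?thesis using pm.span_minimal[of B1 "{v. f b v = 0}"] False by auto
  qed
  then have "(\<Sum>b\<in>B. f b (b - tabloid_act s b)) = (\<Sum>b\<in>B. if b \<in> B1 then 2 else 0)" by (rule sum.cong[OF refl])
  also have "\<dots> = 2 * of_nat (card B1)"
    using B by (simp add: sum.If_cases Int_absorb1)
  finally have "specht_char l id - specht_char l s = (2 * of_nat (card B1) :: 'f)"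
    using specht_char_dual[OF B(4) permutes_id] specht_char_dual[OF B(4) s]
    unfolding tabloid_act_id by (simp add: f_diff sum_subtractf)
  moreover have "card B1 \<ge> 1"
  proof -
    \<comment> \<open>The eigenspace is nonzero: a tableau with 0 and 1 in the first column has a
      polytabloid negated by \<open>s\<close>.\<close>
    obtain t where t: "t \<in> tableaux l" "t 0 = (0, 0)" "t 1 = (1, 0)"
      by (rule tableau_with_entries[OF l, of 0 1]) (use n in auto)
    have "polytabloid (sum_list l) t \<in> V1"
      using polytabloid_in_specht[OF t(1)] tabloid_act_transpose[of 0 "sum_list l" 1 t] t n
      unfolding V1_def s_def by simp
    moreover have "polytabloid (sum_list l) t \<noteq> (0 :: _ \<Rightarrow>\<^sub>0 'f)" by (rule polytabloid_nonzero[OF tableauxD(1)[OF t(1)]])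
    ultimately have "B1 \<noteq> {}" using B1(3) by auto
    then show ?thesis using finite_subset[OF B(1,3)] by (simp add: Suc_le_eq card_gt_0_iff)
  qed
  ultimately show ?thesis using that unfolding s_def by blast
qed

text \<open>With at most one row all columns are single boxes, so every polytabloid is the same
  single tabloid. The empty partition is included because most types have no variables.\<close>

lemma specht_char_row:
  assumes l: "length l \<le> 1" and \<pi>: "\<pi> permutes {..<sum_list l}"
  shows "specht_char l \<pi> = (1 :: 'f::field_char_0)"
proof -
  let ?e = "Poly_Mapping.single (\<lambda>_. 0 :: nat) (1 :: 'f)"
  have poly: "polytabloid (sum_list l) t = ?e" if t: "t \<in> tableaux l" for t
  proof -
    have row: "fst (t k) = 0" if "k < sum_list l" for k
    proof -
      have "t k \<in> {(i, j). i < length l \<and> j < l ! i}" unfolding tableauxD(2)[OF t, symmetric] using that by simp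
      then show ?thesis using l by (auto simp: case_prod_beta)
    qed
    have "\<rho> = id" if \<rho>: "\<rho> \<in> column_stabilizer (sum_list l) t" for \<rho>
    proof
      fix k
      note perm = column_stabilizerD(1)[OF \<rho>]
      show "\<rho> k = id k"
      proof (cases "k < sum_list l")
        case True
        then have lt: "\<rho> k < sum_list l" using permutes_in_image[OF perm, of k] by simp
        then have "t (\<rho> k) = t k" using row column_stabilizerD(2)[OF \<rho> True] True by (simp add: prod_eq_iff)
        then show ?thesis using tableauxD(1)[OF t] True lt by (simp add: inj_on_def)
      next
        case False
        then show ?thesis using permutes_not_in[OF perm, of k] by simp
      qed
    qed
    then have "column_stabilizer (sum_list l) t = {id}" by (auto simp: column_stabilizer_def permutes_id)
    moreover have "tabloid (sum_list l) t = (\<lambda>_. 0)" using row by (auto simp: tabloid_def)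
    ultimately show ?thesis by (simp add: polytabloid_def sign_id)
  qed
  have specht: "specht l = pm.span {?e}"
  proof -
    have "polytabloid (sum_list l) ` tableaux l = {?e}" using poly tableaux_nonempty[of l] by auto
    then show ?thesis by (simp add: specht_def)
  qed
  have "dual_basis pm_scale (specht l) {0} {()} (\<lambda>_. ?e) (\<lambda>_ v. Poly_Mapping.lookup v (\<lambda>_. 0))"
  proof (intro dual_basis.intro dual_basis_axioms.intro pm.vector_space_axioms subspace_specht)
    show "Vector_Spaces.linear pm_scale (*) (\<lambda>v. Poly_Mapping.lookup v (\<lambda>_. 0 :: nat) :: 'f)"
      by (simp add: Vector_Spaces.linear_iff pm.vector_space_axioms field_mult.vector_space_axioms lookup_add)
    show "{0} = {v \<in> specht l. \<forall>i\<in>{()}. Poly_Mapping.lookup v (\<lambda>_. 0) = (0 :: 'f)}"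
      unfolding specht pm.span_singleton by (auto intro!: range_eqI[of _ _ 0])
  qed (simp_all add: specht pm.span_base)
  then show ?thesis using specht_char_dual[OF _ \<pi>] by (force simp: comp_def)
qed


text \<open>A tabloid of this shape is determined by the entry \<open>j\<close> of its second row,
  and a polytabloid is a difference \<open>D j - D i\<close>. The module is thus the sum-zero part
  of the permutation module, whose character counts fixed points; the complementary trivial line
  accounts for the \<open>- 1\<close>.\<close>

lemma specht_char_standard:
  assumes n: "n \<ge> 2" and \<pi>: "\<pi> permutes {..<n}"
  shows "specht_char [n - 1, 1] \<pi> = (of_nat (card {i. i < n \<and> \<pi> i = i}) - 1 :: 'f::field_char_0)"
proof -
  let ?l = "[n - 1, 1]"
  have size: "sum_list ?l = n" and l: "is_partition ?l" "length ?l \<ge> 2" using n by (auto simp: is_partition_def)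
  define \<delta> :: "nat \<Rightarrow> nat \<Rightarrow> nat" where "\<delta> k = (\<lambda>i. if i = k then 1 else 0)" for k
  define D :: "nat \<Rightarrow> (nat \<Rightarrow> nat) \<Rightarrow>\<^sub>0 'f" where "D k = Poly_Mapping.single (\<delta> k) 1" for k
  have \<delta>_eq: "\<delta> i = \<delta> j \<longleftrightarrow> i = j" for i j unfolding \<delta>_def by (metis zero_neq_one)
  have lookup_D: "Poly_Mapping.lookup (D i) (\<delta> j) = (if i = j then 1 else 0)" for i j
    by (simp add: D_def lookup_single when_def \<delta>_eq)
  have box: "t k = (1, 0) \<or> fst (t k) = 0" if "t \<in> tableaux ?l" "k < n" for t k
  proof -
    have "t k \<in> {(i, j). i < length ?l \<and> j < ?l ! i}" unfolding tableauxD(2)[OF that(1), symmetric] size using that by simp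
    then have "fst (t k) < 2" "snd (t k) < ?l ! fst (t k)" by (simp_all add: case_prod_beta)
    then show ?thesis using less_2_cases[of "fst (t k)"] by (auto simp: prod_eq_iff)
  qed
  have inj: "k = k'" if "t \<in> tableaux ?l" "t k = t k'" "k < n" "k' < n" for t k k'
    using tableauxD(1)[OF that(1)] that unfolding size by (simp add: inj_on_def)
  have tabloid: "tabloid n t = \<delta> j" if t: "t \<in> tableaux ?l" "j < n" "t j = (1, 0)" for t j
  proof
    fix k
    show "tabloid n t k = \<delta> j k"
    proof (cases "k < n")
      case True
      show ?thesis
      proof (cases "k = j")
        case False
        then have "t k \<noteq> (1, 0)" using inj[OF t(1), of k j] t True by auto
        then show ?thesis using box[OF t(1) True] True False by (simp add: tabloid_def \<delta>_def)
      qed (use t in \<open>simp add: tabloid_def \<delta>_def\<close>)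
    qed (use t in \<open>auto simp: tabloid_def \<delta>_def\<close>)
  qed
  have poly: "polytabloid n t = D j - D i"
    if t: "t \<in> tableaux ?l" and ij: "i < n" "j < n" "t i = (0, 0)" "t j = (1, 0)" for t i j
  proof -
    let ?s = "Transposition.transpose i j"
    have neq: "i \<noteq> j" using ij by auto
    have s: "?s permutes {..<n}" using ij by (intro permutes_swap_id) auto
    have "column_stabilizer n t = {id, ?s}"
    proof
      show "{id, ?s} \<subseteq> column_stabilizer n t"
        using transpose_column_stabilizer[of i n j t] ij by (auto simp: column_stabilizer_def permutes_id)
      show "column_stabilizer n t \<subseteq> {id, ?s}"
      proof
        fix \<rho> assume \<rho>: "\<rho> \<in> column_stabilizer n t"
        note perm = column_stabilizerD(1)[OF \<rho>]
        have "\<rho> k = k" if k: "k \<in> {..<n} - {i, j}" for k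
        proof -
          have lt: "k < n" "\<rho> k < n" using k permutes_in_image[OF perm, of k] by auto
          have "t k \<noteq> (0, 0)" "t k \<noteq> (1, 0)" using inj[OF t, of k i] inj[OF t, of k j] ij k by auto
          then have "fst (t k) = 0" "snd (t k) \<noteq> 0" using box[OF t lt(1)] by (auto simp: prod_eq_iff)
          then have "t (\<rho> k) = t k"
            using box[OF t lt(2)] column_stabilizerD(2)[OF \<rho> lt(1)] by (auto simp: prod_eq_iff)
          then show ?thesis using inj[OF t _ lt(2,1)] by blast
        qed
        then have "\<rho> permutes {i, j}" using permutes_superset[OF perm, of "{i, j}"] by blast
        then show "\<rho> \<in> {id, ?s}" by (simp add: permutes_doubleton_iff)
      qed
    qed
    moreover have "id \<noteq> ?s" using neq by (metis id_apply transpose_apply_first)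
    moreover have "tabloid n (t \<circ> ?s) = \<delta> i"
      by (rule tabloid) (use tableaux_comp[OF t, unfolded size, OF s] ij in auto)
    ultimately show ?thesis
      using tabloid[OF t ij(2,4)] neq by (simp add: polytabloid_def sign_swap_id D_def sign_id single_uminus)
  qed
  have generators: "polytabloid (sum_list ?l) t \<in> {D j - D i | i j. i < n \<and> j < n}" if t: "t \<in> tableaux ?l" for t
  proof -
    have "(0, 0) \<in> t ` {..<n}" "(1, 0) \<in> t ` {..<n}"
      unfolding tableauxD(2)[OF t, unfolded size] using n by auto
    then obtain i j where "i < n" "j < n" "t i = (0, 0)" "t j = (1, 0)" by (metis imageE lessThan_iff)
    then show ?thesis using poly[OF t] unfolding size by blast
  qed
  have split: "(\<Sum>k<n. h k) = h 0 + (\<Sum>k\<in>{1..<n}. h k)" for h :: "nat \<Rightarrow> 'f"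
    using n by (simp add: lessThan_atLeast0 sum.atLeast_Suc_lessThan)
  have dual: "dual_basis pm_scale (specht ?l) {0} {1..<n} (\<lambda>k. D k - D 0) (\<lambda>k v. Poly_Mapping.lookup v (\<delta> k))"
  proof (intro dual_basis.intro dual_basis_axioms.intro pm.vector_space_axioms subspace_specht)
    show "Vector_Spaces.linear pm_scale (*) (\<lambda>v. Poly_Mapping.lookup v (\<delta> k) :: 'f)" for k
      by (simp add: Vector_Spaces.linear_iff pm.vector_space_axioms field_mult.vector_space_axioms lookup_add)
    show "D k - D 0 \<in> specht ?l" if k: "k \<in> {1..<n}" for k
    proof -
      obtain t where t: "t \<in> tableaux ?l" "t 0 = (0, 0)" "t k = (1, 0)"
        by (rule tableau_with_entries[OF l, of 0 k]) (use k size in auto)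
      have "(polytabloid n t :: _ \<Rightarrow>\<^sub>0 'f) \<in> specht ?l" using polytabloid_in_specht[OF t(1)] unfolding size .
      moreover have "polytabloid n t = D k - D 0" by (rule poly[OF t(1)]) (use k t in auto)
      ultimately show ?thesis by simp
    qed
    have "v = 0" if v: "v \<in> specht ?l" "\<forall>k\<in>{1..<n}. Poly_Mapping.lookup v (\<delta> k) = 0" for v :: "_ \<Rightarrow>\<^sub>0 'f"
    proof (rule poly_mapping_eqI)
      fix r
      \<comment> \<open>All generators, hence all vectors, are supported on the
        \<open>\<delta> k\<close> and have coordinate sum zero; so the coordinates at 1 to
        \<open>n - 1\<close> determine the one at 0.\<close>
      have "(r \<notin> \<delta> ` {..<n} \<longrightarrow> Poly_Mapping.lookup v r = 0) \<and> (\<Sum>k<n. Poly_Mapping.lookup v (\<delta> k)) = 0"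
        using v(1)
      proof (rule specht_induct)
        show "pm.subspace {v :: _ \<Rightarrow>\<^sub>0 'f. (r \<notin> \<delta> ` {..<n} \<longrightarrow> Poly_Mapping.lookup v r = 0) \<and>
            (\<Sum>k<n. Poly_Mapping.lookup v (\<delta> k)) = 0}"
          by (rule pm.subspaceI) (auto simp: lookup_add sum.distrib sum_distrib_left[symmetric])
        fix t assume "t \<in> tableaux ?l"
        then obtain i j where ij: "polytabloid (sum_list ?l) t = D j - D i" "i < n" "j < n" using generators by blast
        then show "(r \<notin> \<delta> ` {..<n} \<longrightarrow> Poly_Mapping.lookup (polytabloid (sum_list ?l) t :: _ \<Rightarrow>\<^sub>0 'f) r = 0) \<and>
            (\<Sum>k<n. Poly_Mapping.lookup (polytabloid (sum_list ?l) t :: _ \<Rightarrow>\<^sub>0 'f) (\<delta> k)) = 0"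
          unfolding ij(1) lookup_minus lookup_D sum_subtractf by (auto simp: D_def lookup_single when_def)
      qed
      note r = this
      have "Poly_Mapping.lookup v (\<delta> k) = 0" if "k < n" for k
      proof (cases "k = 0")
        case True
        have "(\<Sum>k\<in>{1..<n}. Poly_Mapping.lookup v (\<delta> k)) = 0" using v(2) by (rule sum.neutral)
        then show ?thesis using r True by (simp add: split)
      qed (use v(2) that in simp)
      then show "Poly_Mapping.lookup v r = Poly_Mapping.lookup 0 r"
        using r by (cases "r \<in> \<delta> ` {..<n}") auto
    qed
    then show "{0} = {v \<in> specht ?l. \<forall>k\<in>{1..<n}. Poly_Mapping.lookup v (\<delta> k) = (0 :: 'f)}"
      using pm.subspace_0[OF subspace_specht, of ?l] by auto
  qed (auto simp: lookup_minus lookup_D)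
  interpret act: Vector_Spaces.linear pm_scale pm_scale "tabloid_act \<pi> :: (_ \<Rightarrow>\<^sub>0 'f) \<Rightarrow> _" by (rule linear_tabloid_act)
  have act_D: "tabloid_act \<pi> (D k) = D (\<pi> k)" for k
  proof -
    have "inv \<pi> i = k \<longleftrightarrow> i = \<pi> k" for i using permutes_inverses[OF \<pi>] by metis
    then have "\<delta> k \<circ> inv \<pi> = \<delta> (\<pi> k)" by (simp add: \<delta>_def fun_eq_iff)
    then show ?thesis by (simp add: D_def)
  qed
  have "specht_char ?l \<pi> = (\<Sum>k\<in>{1..<n}. Poly_Mapping.lookup (tabloid_act \<pi> (D k - D 0)) (\<delta> k))"
    by (rule specht_char_dual[OF dual]) (use \<pi> size in simp)
  \<comment> \<open>These are the coordinates of \<open>D (\<pi> k) - D (\<pi> 0)\<close> at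
    \<open>\<delta> k\<close>. Both sums miss the index 0, and the two corrections for it
    cancel.\<close>
  also have "\<dots> = (\<Sum>k\<in>{1..<n}. if \<pi> k = k then 1 else 0) - (\<Sum>k\<in>{1..<n}. if \<pi> 0 = k then 1 else 0)"
    unfolding act.diff act_D lookup_minus lookup_D sum_subtractf ..
  also have "(\<Sum>k\<in>{1..<n}. if \<pi> 0 = k then 1 else 0 :: 'f) = (\<Sum>k<n. if \<pi> 0 = k then 1 else 0) - (if \<pi> 0 = 0 then 1 else 0)"
    unfolding split[of "\<lambda>k. if \<pi> 0 = k then 1 else 0"] by simp
  also have "(\<Sum>k<n. if \<pi> 0 = k then 1 else 0 :: 'f) = 1"
    using permutes_in_image[OF \<pi>, of 0] n by simp
  also have "(\<Sum>k\<in>{1..<n}. if \<pi> k = k then 1 else 0 :: 'f) = (\<Sum>k<n. if \<pi> k = k then 1 else 0) - (if \<pi> 0 = 0 then 1 else 0)"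
    unfolding split[of "\<lambda>k. if \<pi> k = k then 1 else 0"] by simp
  also have "(\<Sum>k<n. if \<pi> k = k then 1 else 0 :: 'f) = of_nat (card {i. i < n \<and> \<pi> i = i})"
    by (simp add: sum.If_cases Int_def)
  finally show ?thesis by simp
qed


section \<open>Cocharacters and colengths\<close>

lemma UNIV_polarity: "UNIV = {Plus, Minus}"
  using polarity.exhaust by auto

lemma finite_vtype: "finite (UNIV :: 'g::finite vtype set)"
  by (rule finite_Prod_UNIV) (simp_all add: UNIV_polarity)

lemma partition_bounds:
  assumes "is_partition l"
  shows "length l \<le> sum_list l" "set l \<subseteq> {..sum_list l}"
proof -
  have "\<forall>k\<in>set l. 1 \<le> k" using assms by (auto simp: is_partition_def Suc_le_eq)
  then show "length l \<le> sum_list l" by (induction l) auto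
  show "set l \<subseteq> {..sum_list l}" using member_le_sum_list by auto
qed

lemma mpartsD: "l \<in> mparts nn \<Longrightarrow> is_partition (l \<tau>)" "l \<in> mparts nn \<Longrightarrow> sum_list (l \<tau>) = nn \<tau>"
  "l \<in> mparts nn \<Longrightarrow> mpart_size l = nn"
  unfolding mparts_def mpart_size_def by (blast, auto)

lemma finite_mparts: "finite (mparts nn)" for nn :: "'g::finite vtype \<Rightarrow> nat"
proof (rule finite_subset)
  show "mparts nn \<subseteq> PiE UNIV (\<lambda>\<tau>. {l. set l \<subseteq> {..nn \<tau>} \<and> length l \<le> nn \<tau>})"
  proof
    fix l assume l: "l \<in> mparts nn"
    have "set (l \<tau>) \<subseteq> {..nn \<tau>} \<and> length (l \<tau>) \<le> nn \<tau>" for \<tau>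
      using partition_bounds[OF mpartsD(1)[OF l, of \<tau>]] mpartsD(2)[OF l, of \<tau>] by simp
    then show "l \<in> PiE UNIV (\<lambda>\<tau>. {l. set l \<subseteq> {..nn \<tau>} \<and> length l \<le> nn \<tau>})" by auto
  qed
  show "finite (PiE UNIV (\<lambda>\<tau>. {l. set l \<subseteq> {..nn \<tau>} \<and> length l \<le> nn \<tau>}))"
    by (intro finite_PiE finite_vtype finite_lists_length_le) simp
qed

lemma young_group_id: "(\<lambda>_. id) \<in> young_group nn"
  by (simp add: young_group_def permutes_id)

lemma mpart_char_id:
  fixes l :: "'g::finite vtype \<Rightarrow> nat list"
  obtains d where "d \<ge> 1" "mpart_char l (\<lambda>_. id) = (of_nat d :: 'f::field_char_0)"
proof -
  have "\<exists>d\<ge>1. specht_char (l \<tau>) id = (of_nat d :: 'f)" for \<tau> by (metis specht_char_id)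
  then obtain d where d: "\<And>\<tau>. d \<tau> \<ge> 1" "\<And>\<tau>. specht_char (l \<tau>) id = (of_nat (d \<tau>) :: 'f)" by metis
  show ?thesis
  proof
    show "mpart_char l (\<lambda>_. id) = (of_nat (\<Prod>\<tau>\<in>UNIV. d \<tau>) :: 'f)"
      by (simp add: mpart_char_def young_group_id d)
    show "(\<Prod>\<tau>\<in>UNIV. d \<tau>) \<ge> 1"
      using d(1) by (intro prod_ge_1) simp
  qed
qed

text \<open>\<open>THE\<close> ranges over totals, so uniqueness is a matter of the total
  multiplicity alone.\<close>

lemma num_constituents_eqI:
  assumes "c = (\<lambda>\<sigma>. \<Sum>l\<in>mparts nn. of_nat (m l) * mpart_char l \<sigma>)" "k = (\<Sum>l\<in>mparts nn. m l)"
    and "\<And>m. c = (\<lambda>\<sigma>. \<Sum>l\<in>mparts nn. of_nat (m l) * mpart_char l \<sigma>) \<Longrightarrow> (\<Sum>l\<in>mparts nn. m l) = k"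
  shows "num_constituents nn c = k"
  unfolding num_constituents_def by (rule the_equality) (use assms in blast)+

text \<open>The values at the identity are positive integers, so a vanishing combination with
  natural coefficients has no nonzero coefficient; characteristic 0 brings the equation back to the
  naturals.\<close>

lemma multiplicities_zero:
  fixes m :: "('g::finite vtype \<Rightarrow> nat list) \<Rightarrow> nat"
  assumes "S \<subseteq> mparts nn" "(\<Sum>l\<in>S. of_nat (m l) * mpart_char l (\<lambda>_. id)) = (0 :: 'f::field_char_0)" "l \<in> S"
  shows "m l = 0"
proof -
  have "\<exists>d\<ge>1. mpart_char l (\<lambda>_. id) = (of_nat d :: 'f)" for l :: "'g vtype \<Rightarrow> nat list" by (metis mpart_char_id)
  then obtain d where d: "\<And>l. d l \<ge> 1" "\<And>l :: 'g vtype \<Rightarrow> nat list. mpart_char l (\<lambda>_. id) = (of_nat (d l) :: 'f)" by metis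
  have "of_nat (\<Sum>l\<in>S. m l * d l) = (0 :: 'f)" using assms(2) by (simp add: d)
  then have "(\<Sum>l\<in>S. m l * d l) = 0" by (simp only: of_nat_eq_0_iff)
  then have "m l * d l = 0" using assms(3) finite_subset[OF assms(1) finite_mparts] by simp
  then show ?thesis using d(1)[of l] by simp
qed

lemma num_constituents_zero:
  fixes nn :: "'g::finite vtype \<Rightarrow> nat"
  shows "num_constituents nn (\<lambda>_. 0 :: 'f::field_char_0) = 0"
proof (rule num_constituents_eqI)
  show "(\<lambda>_. 0 :: 'f) = (\<lambda>\<sigma>. \<Sum>l\<in>mparts nn. of_nat ((\<lambda>_. 0) l) * mpart_char l \<sigma>)" by simp
  fix m assume "(\<lambda>_. 0 :: 'f) = (\<lambda>\<sigma>. \<Sum>l\<in>mparts nn. of_nat (m l) * mpart_char l \<sigma>)"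
  from fun_cong[OF this, of "\<lambda>_. id"]
  have "m l = 0" if "l \<in> mparts nn" for l using multiplicities_zero[OF subset_refl _ that, of m, where 'f = 'f] by simp
  then show "(\<Sum>l\<in>mparts nn. m l) = 0" by simp
qed simp

text \<open>For these types only the symmetric group at \<open>(0, Plus)\<close> is nontrivial.\<close>

locale thin_type =
  fixes nn :: "'g::{finite,zero} vtype \<Rightarrow> nat"
  assumes thin: "\<tau> \<noteq> (0, Plus) \<Longrightarrow> nn \<tau> \<le> 1"
begin

text \<open>A variable type of size 0 gets the empty partition, since parts are positive.\<close>

definition trivial :: "'g vtype \<Rightarrow> nat list"
  where "trivial = (\<lambda>\<tau>. if nn \<tau> = 0 then [] else [nn \<tau>])"

definition embed :: "(nat \<Rightarrow> nat) \<Rightarrow> 'g vtype \<Rightarrow> nat \<Rightarrow> nat"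
  where "embed \<pi> = (\<lambda>_. id)((0, Plus) := \<pi>)"

lemma trivial_mparts: "trivial \<in> mparts nn"
  by (auto simp: trivial_def mparts_def mpart_size_def is_partition_def)

lemma embed_young: "\<pi> permutes {..<nn (0, Plus)} \<Longrightarrow> embed \<pi> \<in> young_group nn"
  by (simp add: embed_def young_group_def permutes_id)

lemma length_thin:
  assumes "l \<in> mparts nn" "\<tau> \<noteq> (0, Plus)" shows "length (l \<tau>) \<le> 1"
  using partition_bounds(1)[OF mpartsD(1)[OF assms(1), of \<tau>]] mpartsD(2)[OF assms(1), of \<tau>] thin[OF assms(2)] by simp

lemma mpart_char_thin:
  assumes l: "l \<in> mparts nn"
  shows "mpart_char l \<sigma> = (if \<sigma> \<in> young_group nn then specht_char (l (0, Plus)) (\<sigma> (0, Plus)) else (0 :: 'f::field_char_0))"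
proof (cases "\<sigma> \<in> young_group nn")
  case True
  then have "\<sigma> \<tau> permutes {..<sum_list (l \<tau>)}" for \<tau> unfolding young_group_def mpartsD(2)[OF l] by blast
  then have "specht_char (l \<tau>) (\<sigma> \<tau>) = (1 :: 'f)" if "\<tau> \<noteq> (0, Plus)" for \<tau>
    by (intro specht_char_row length_thin[OF l that])
  then have "(\<Prod>\<tau>\<in>UNIV. specht_char (l \<tau>) (\<sigma> \<tau>)) = (\<Prod>\<tau>\<in>{(0, Plus)}. specht_char (l \<tau>) (\<sigma> \<tau>) :: 'f)"
    by (intro prod.mono_neutral_right finite_vtype) auto
  then show ?thesis using True by (simp add: mpart_char_def mpartsD(3)[OF l])
qed (simp add: mpart_char_def mpartsD(3)[OF l])

lemma mpart_char_trivial: "mpart_char trivial \<sigma> = (if \<sigma> \<in> young_group nn then 1 else (0 :: 'f::field_char_0))"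
proof (cases "\<sigma> \<in> young_group nn")
  case True
  then have "\<sigma> (0, Plus) permutes {..<sum_list (trivial (0, Plus))}"
    unfolding young_group_def mpartsD(2)[OF trivial_mparts] by blast
  then have "specht_char (trivial (0, Plus)) (\<sigma> (0, Plus)) = (1 :: 'f)"
    by (intro specht_char_row) (simp add: trivial_def)
  then show ?thesis using True by (simp add: mpart_char_thin[OF trivial_mparts])
qed (simp add: mpart_char_thin[OF trivial_mparts])

lemma nontrivial_length:
  assumes l: "l \<in> mparts nn" "l \<noteq> trivial"
  shows "length (l (0, Plus)) \<ge> 2"
proof (rule ccontr)
  assume "\<not> length (l (0, Plus)) \<ge> 2"
  then have len: "length (l \<tau>) \<le> 1" for \<tau> using length_thin[OF l(1), of \<tau>] by (cases "\<tau> = (0, Plus)") auto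
  have "l \<tau> = trivial \<tau>" for \<tau>
  proof (cases "l \<tau>")
    case Nil
    then show ?thesis using mpartsD(2)[OF l(1), of \<tau>] by (simp add: trivial_def)
  next
    case (Cons k ks)
    then have k: "l \<tau> = [k]" using len[of \<tau>] by simp
    then show ?thesis using mpartsD(1,2)[OF l(1), of \<tau>] by (simp add: trivial_def is_partition_def)
  qed
  with l(2) show False by (auto simp: fun_eq_iff)
qed

lemma nontrivial_size:
  assumes "l \<in> mparts nn" "l \<noteq> trivial"
  shows "sum_list (l (0, Plus)) \<ge> 2"
  using nontrivial_length[OF assms] partition_bounds(1)[OF mpartsD(1)[OF assms(1), of "(0, Plus)"]] by simp

lemma sum_mparts_trivial: "(\<Sum>l\<in>mparts nn. h l) = h trivial + (\<Sum>l\<in>mparts nn - {trivial}. h l)"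
  by (rule sum.remove[OF finite_mparts trivial_mparts])

text \<open>\<open>embed\<close> restricts to the one nontrivial factor, where
  \<open>sum_specht_char\<close> removes all constituents but the trivial one.\<close>

lemma trivial_multiplicity:
  assumes c: "c = (\<lambda>\<sigma>. \<Sum>l\<in>mparts nn. of_nat (m l) * mpart_char l \<sigma>)"
  shows "(\<Sum>\<pi> | \<pi> permutes {..<nn (0, Plus)}. c (embed \<pi>)) = (of_nat (m trivial) * fact (nn (0, Plus)) :: 'f::field_char_0)"
proof -
  let ?P = "{\<pi>. \<pi> permutes {..<nn (0, Plus)}}"
  have zero: "(\<Sum>\<pi>\<in>?P. mpart_char l (embed \<pi>)) = (0 :: 'f)" if l: "l \<in> mparts nn - {trivial}" for l
  proof -
    have l: "l \<in> mparts nn" "l \<noteq> trivial" using l by auto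
    have "(\<Sum>\<pi>\<in>?P. mpart_char l (embed \<pi>)) = (\<Sum>\<pi>\<in>?P. specht_char (l (0, Plus)) \<pi> :: 'f)"
      by (rule sum.cong[OF refl]) (simp add: mpart_char_thin[OF l(1)] embed_young, simp add: embed_def)
    also have "\<dots> = 0"
      using sum_specht_char[OF mpartsD(1)[OF l(1)] nontrivial_length[OF l] nontrivial_size[OF l]] mpartsD(2)[OF l(1)] by simp
    finally show ?thesis .
  qed
  have "(\<Sum>\<pi>\<in>?P. c (embed \<pi>)) = (\<Sum>l\<in>mparts nn. of_nat (m l) * (\<Sum>\<pi>\<in>?P. mpart_char l (embed \<pi>)))"
    unfolding c sum_distrib_left by (rule sum.swap)
  also have "\<dots> = of_nat (m trivial) * (\<Sum>\<pi>\<in>?P. mpart_char trivial (embed \<pi>))"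
    unfolding sum_mparts_trivial by (simp add: zero)
  also have "(\<Sum>\<pi>\<in>?P. mpart_char trivial (embed \<pi>)) = (of_nat (card ?P) :: 'f)"
    by (simp add: mpart_char_trivial embed_young)
  also have "card ?P = fact (nn (0, Plus))" by (rule card_permutations) simp_all
  finally show ?thesis by simp
qed

text \<open>The group sum fixes the trivial multiplicity at \<open>k\<close>; then the value at the
  identity leaves nothing for the other constituents.\<close>

lemma num_constituents_trivial:
  "num_constituents nn (\<lambda>\<sigma>. if \<sigma> \<in> young_group nn then of_nat k else (0 :: 'f::field_char_0)) = k" (is "num_constituents nn ?c = k")
proof (rule num_constituents_eqI)
  show "?c = (\<lambda>\<sigma>. \<Sum>l\<in>mparts nn. of_nat ((\<lambda>l. if l = trivial then k else 0) l) * mpart_char l \<sigma>)"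
    unfolding sum_mparts_trivial by (auto simp: mpart_char_trivial)
  show "k = (\<Sum>l\<in>mparts nn. (\<lambda>l. if l = trivial then k else 0) l)" unfolding sum_mparts_trivial by simp
  fix m assume c: "?c = (\<lambda>\<sigma>. \<Sum>l\<in>mparts nn. of_nat (m l) * mpart_char l \<sigma>)"
  have "(of_nat k * fact (nn (0, Plus)) :: 'f) = of_nat (m trivial) * fact (nn (0, Plus))"
    using trivial_multiplicity[OF c] by (simp add: embed_young card_permutations mult.commute)
  then have m: "m trivial = k" by simp
  have "(\<Sum>l\<in>mparts nn - {trivial}. of_nat (m l) * mpart_char l (\<lambda>_. id)) = (0 :: 'f)"
    using fun_cong[OF c, of "\<lambda>_. id"] unfolding sum_mparts_trivial by (simp add: mpart_char_trivial young_group_id m)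
  then have "m l = 0" if "l \<in> mparts nn - {trivial}" for l
    using multiplicities_zero[of "mparts nn - {trivial}" nn m l] that by blast
  then show "(\<Sum>l\<in>mparts nn. m l) = k" unfolding sum_mparts_trivial by (simp add: m)
qed

text \<open>Each nontrivial constituent contributes at least \<open>2\<close> to the difference of the values at the identity and
  at a transposition, and this difference is \<open>2\<close> for the standard representation.\<close>

lemma num_constituents_standard:
  assumes n: "nn (0, Plus) \<ge> 2" and std: "std \<in> mparts nn" "std (0, Plus) = [nn (0, Plus) - 1, 1]"
  shows "num_constituents nn (\<lambda>\<sigma>. 2 * mpart_char trivial \<sigma> + mpart_char std \<sigma> :: 'f::field_char_0) = 3"
    (is "num_constituents nn ?c = 3")
proof (rule num_constituents_eqI)
  have "length (trivial (0, Plus)) \<le> 1" by (simp add: trivial_def)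
  then have neq: "std \<noteq> trivial" using std(2) by auto
  let ?m = "\<lambda>l. if l = trivial then 2 else if l = std then 1 else 0 :: nat"
  have "(\<Sum>l\<in>mparts nn - {trivial}. of_nat (?m l) * h l) = (\<Sum>l\<in>{std}. h l)" for h :: "_ \<Rightarrow> 'b::comm_semiring_1"
    by (rule sum.mono_neutral_cong_right) (use finite_mparts std neq in auto)
  note m = this this[of "\<lambda>_. 1 :: nat"]
  show "?c = (\<lambda>\<sigma>. \<Sum>l\<in>mparts nn. of_nat (?m l) * mpart_char l \<sigma>)"
    unfolding sum_mparts_trivial m by simp
  show "3 = (\<Sum>l\<in>mparts nn. ?m l)" unfolding sum_mparts_trivial using m(2) by simp
  fix m assume c: "?c = (\<lambda>\<sigma>. \<Sum>l\<in>mparts nn. of_nat (m l) * mpart_char l \<sigma>)"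
  let ?P = "{\<pi>. \<pi> permutes {..<nn (0, Plus)}}"
  define s where "s = Transposition.transpose 0 (1::nat)"
  have s: "s permutes {..<nn (0, Plus)}" unfolding s_def using n by (intro permutes_swap_id) auto
  have char_embed: "mpart_char l (embed \<pi>) = (specht_char (l (0, Plus)) \<pi> :: 'f)"
    if "l \<in> mparts nn" "\<pi> permutes {..<nn (0, Plus)}" for l \<pi>
    using that by (simp add: mpart_char_thin embed_young) (simp add: embed_def)
  have std_sum: "(\<Sum>\<pi>\<in>?P. mpart_char std (embed \<pi>)) = (0 :: 'f)"
    using sum_specht_char[OF mpartsD(1)[OF std(1)] nontrivial_length[OF std(1) neq] nontrivial_size[OF std(1) neq], where 'f = 'f]
    unfolding mpartsD(2)[OF std(1)] by (simp add: char_embed[OF std(1)])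
  have "(\<Sum>\<pi>\<in>?P. ?c (embed \<pi>)) = (of_nat 2 * fact (nn (0, Plus)) :: 'f)"
    unfolding sum.distrib std_sum by (simp add: mpart_char_trivial embed_young card_permutations)
  then have "of_nat 2 * fact (nn (0, Plus)) = (of_nat (m trivial) * fact (nn (0, Plus)) :: 'f)"
    using trivial_multiplicity[OF c] by simp
  then have "of_nat 2 = (of_nat (m trivial) :: 'f)" by simp
  then have m_trivial: "m trivial = 2" by (simp only: of_nat_eq_iff)
  have "\<exists>k\<ge>1. mpart_char l (embed id) - mpart_char l (embed s) = (2 * of_nat k :: 'f)" if l: "l \<in> mparts nn - {trivial}" for l
  proof -
    have l: "l \<in> mparts nn" "l \<noteq> trivial" using l by auto
    show ?thesis
      using specht_char_transpose[OF mpartsD(1)[OF l(1)] nontrivial_length[OF l] nontrivial_size[OF l], where 'f = 'f, folded s_def]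
      unfolding char_embed[OF l(1) permutes_id] char_embed[OF l(1) s] by metis
  qed
  then obtain k where k: "\<And>l. l \<in> mparts nn - {trivial} \<Longrightarrow> k l \<ge> 1"
    "\<And>l. l \<in> mparts nn - {trivial} \<Longrightarrow> mpart_char l (embed id) - mpart_char l (embed s) = (2 * of_nat (k l) :: 'f)" by metis
  \<comment> \<open>A transposition fixes all but two points, so the standard character drops by
    exactly 2.\<close>
  have "{i. i < nn (0, Plus) \<and> s i = i} = {..<nn (0, Plus)} - {0, 1}" by (auto simp: s_def Transposition.transpose_def)
  then have fix_s: "card {i. i < nn (0, Plus) \<and> s i = i} = nn (0, Plus) - 2" using n by (simp add: card_Diff_subset)
  obtain j where j: "nn (0, Plus) = j + 2" using le_Suc_ex[OF n] by (metis add.commute)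
  have "mpart_char std (embed id) = (of_nat (nn (0, Plus)) - 1 :: 'f)"
    unfolding char_embed[OF std(1) permutes_id] std(2) specht_char_standard[OF n permutes_id] by simp
  moreover have "mpart_char std (embed s) = (of_nat (nn (0, Plus) - 2) - 1 :: 'f)"
    unfolding char_embed[OF std(1) s] std(2) specht_char_standard[OF n s] fix_s ..
  ultimately have diff: "mpart_char std (embed id) - mpart_char std (embed s) = (2 :: 'f)" by (simp add: j)
  have "?c (embed id) - ?c (embed s) = 2"
    unfolding mpart_char_trivial if_P[OF embed_young[OF permutes_id]] if_P[OF embed_young[OF s]] add_diff_cancel_left
    by (rule diff)
  also have "?c (embed id) - ?c (embed s) =
      (\<Sum>l\<in>mparts nn. of_nat (m l) * (mpart_char l (embed id) - mpart_char l (embed s)))"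
    unfolding right_diff_distrib sum_subtractf fun_cong[OF c, of "embed id"] fun_cong[OF c, of "embed s"] ..
  also have "\<dots> = (\<Sum>l\<in>mparts nn - {trivial}. of_nat (m l) * (2 * of_nat (k l)))"
    unfolding sum_mparts_trivial by (simp add: mpart_char_trivial embed_young permutes_id s k(2))
  also have "\<dots> = 2 * of_nat (\<Sum>l\<in>mparts nn - {trivial}. m l * k l)"
    unfolding of_nat_sum of_nat_mult sum_distrib_left by (rule sum.cong[OF refl], rule mult.left_commute)
  finally have "of_nat (\<Sum>l\<in>mparts nn - {trivial}. m l * k l) = (of_nat 1 :: 'f)" by simp
  then have sum_k: "(\<Sum>l\<in>mparts nn - {trivial}. m l * k l) = 1" by (simp only: of_nat_eq_iff)
  \<comment> \<open>With weights \<open>k l\<close> at least 1 and weighted total 1, exactly one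
    nontrivial constituent occurs.\<close>
  have "(\<Sum>l\<in>mparts nn - {trivial}. m l) \<le> (\<Sum>l\<in>mparts nn - {trivial}. m l * k l)"
    using mult_le_mono2[OF k(1)] by (intro sum_mono) fastforce
  moreover have "(\<Sum>l\<in>mparts nn - {trivial}. m l) \<noteq> 0"
  proof
    assume "(\<Sum>l\<in>mparts nn - {trivial}. m l) = 0"
    then have "\<forall>l\<in>mparts nn - {trivial}. m l = 0" using finite_mparts by (subst (asm) sum_eq_0_iff) auto
    then have "(\<Sum>l\<in>mparts nn - {trivial}. m l * k l) = 0" by simp
    with sum_k show False by simp
  qed
  ultimately have "(\<Sum>l\<in>mparts nn - {trivial}. m l) = 1" using sum_k by linarith
  then show "(\<Sum>l\<in>mparts nn. m l) = 3" unfolding sum_mparts_trivial by (simp add: m_trivial)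
qed

end


section \<open>The variable types that occur in total degree \<open>n\<close>\<close>

lemma sum_type0: "sum (type0 n :: 'g::{finite,zero} vtype \<Rightarrow> nat) UNIV = n"
  using finite_vtype[where 'g = 'g] by (simp add: fun_upd_def)

lemma sum_type1: "g \<noteq> 0 \<Longrightarrow> sum (type1 g e n :: 'g::{finite,zero} vtype \<Rightarrow> nat) UNIV = n + 1"
proof -
  assume g: "g \<noteq> 0"
  have "sum (type1 g e n) UNIV = sum (type1 g e n) {(0, Plus), (g, e)}"
    by (rule sum.mono_neutral_right[OF finite_vtype]) auto
  then show ?thesis using g by simp
qed

lemma finite_types: "finite {nn :: 'g::finite vtype \<Rightarrow> nat. sum nn UNIV = n}"
proof (rule finite_subset)
  show "{nn :: 'g vtype \<Rightarrow> nat. sum nn UNIV = n} \<subseteq> PiE UNIV (\<lambda>_. {..n})"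
  proof
    fix nn :: "'g vtype \<Rightarrow> nat" assume "nn \<in> {nn. sum nn UNIV = n}"
    then have "nn \<tau> \<le> n" for \<tau> using member_le_sum[of \<tau> UNIV nn, OF _ _ finite_vtype] by simp
    then show "nn \<in> PiE UNIV (\<lambda>_. {..n})" by auto
  qed
  show "finite (PiE (UNIV :: 'g vtype set) (\<lambda>_. {..n}))" by (intro finite_PiE finite_vtype) simp
qed

lemma thin_type0: "thin_type (type0 n :: 'g::{finite,zero} vtype \<Rightarrow> nat)"
  by unfold_locales auto

lemma thin_type1: "g \<noteq> 0 \<Longrightarrow> thin_type (type1 (g :: 'g::{finite,zero}) e n)"
  by unfold_locales auto

lemma types_distinct:
  fixes g :: "'g::zero"
  assumes "g \<noteq> 0"
  shows "type0 n \<noteq> type1 g e k" "type1 g Plus k \<noteq> type1 g Minus k"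
proof -
  show "type0 n \<noteq> type1 g e k"
  proof
    assume "type0 n = type1 g e k"
    from fun_cong[OF this, of "(g, e)"] show False using assms by simp
  qed
  show "type1 g Plus k \<noteq> type1 g Minus k"
  proof
    assume "type1 g Plus k = type1 g Minus k"
    from fun_cong[OF this, of "(g, Plus)"] show False using assms by simp
  qed
qed

text \<open>What \<open>N3\<close> and \<open>A2\<close> share: only the types \<open>type0\<close>
  and \<open>type1\<close> can have a nonzero character, so cocharacter and colength reduce to three
  characters.\<close>

locale relations_algebra = degree_relations g "gstar_Id A" + gstar_algebra A
  for g :: "'g::{finite,ab_group_add}" and A :: "('a::ab_group_add, 'f::field_char_0, 'g) gstar_alg"
begin

lemma gstar_char_other:
  assumes "nn \<noteq> type0 (sum nn UNIV)" "\<And>e. nn \<noteq> type1 g e (sum nn UNIV - 1)"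
  shows "gstar_char A nn = (\<lambda>_. 0)"
proof (rule gstar_char_zero[OF gstar_algebra_axioms multilin_typed_I])
  have "nn \<noteq> type0 k" for k
  proof
    assume eq: "nn = type0 k"
    have "sum nn UNIV = k" unfolding eq by (rule sum_type0)
    from assms(1)[unfolded this] eq show False by (rule notE)
  qed
  then show "nn \<noteq> type0 (nn (0, Plus))" .
  have "nn \<noteq> type1 g e k" for e k
  proof
    assume eq: "nn = type1 g e k"
    have "sum nn UNIV = k + 1" unfolding eq by (rule sum_type1[OF g])
    then have "sum nn UNIV - 1 = k" by simp
    from assms(2)[of e, unfolded this] eq show False by (rule notE)
  qed
  then show "nn \<noteq> type1 g e (nn (0, Plus))" for e .
qed

lemma gstar_char_cases:
  assumes "sum nn UNIV = n" "gstar_char A nn \<noteq> (\<lambda>_. 0)"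
  shows "nn \<in> {type0 n, type1 g Plus (n - 1), type1 g Minus (n - 1)}"
proof (rule ccontr)
  assume "nn \<notin> {type0 n, type1 g Plus (n - 1), type1 g Minus (n - 1)}"
  then have no: "nn \<noteq> type0 n" "nn \<noteq> type1 g Plus (n - 1)" "nn \<noteq> type1 g Minus (n - 1)"
    by (simp_all only: insert_iff de_Morgan_disj simp_thms)
  have "nn \<noteq> type1 g e (n - 1)" for e by (cases e) (simp_all only: no simp_thms)
  then have "gstar_char A nn = (\<lambda>_. 0)"
    by (intro gstar_char_other) (simp_all only: assms(1) no simp_thms)
  with assms(2) show False by (rule notE)
qed

lemma gstar_cochar_eq:
  assumes n: "n \<ge> 1"
    and nz: "gstar_char A (type0 n) \<noteq> (\<lambda>_. 0)" "\<And>e. gstar_char A (type1 g e (n - 1)) \<noteq> (\<lambda>_. 0)"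
  shows "gstar_cochar n A = {(type0 n, gstar_char A (type0 n)), (type1 g Plus (n - 1), gstar_char A (type1 g Plus (n - 1))),
    (type1 g Minus (n - 1), gstar_char A (type1 g Minus (n - 1)))}" (is "_ = ?R")
proof
  show "gstar_cochar n A \<subseteq> ?R"
  proof
    fix x assume "x \<in> gstar_cochar n A"
    then obtain nn where x: "x = (nn, gstar_char A nn)" "sum nn UNIV = n" "gstar_char A nn \<noteq> (\<lambda>_. 0)"
      unfolding gstar_cochar_def by blast
    from gstar_char_cases[OF x(2,3)] show "x \<in> ?R"
      unfolding x(1) by (elim insertE emptyE) (simp_all only: insert_iff simp_thms)
  qed
  have mem: "(nn, gstar_char A nn) \<in> gstar_cochar n A" if "sum nn UNIV = n" "gstar_char A nn \<noteq> (\<lambda>_. 0)" for nn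
    unfolding gstar_cochar_def using that by blast
  have sums: "sum (type0 n :: 'g vtype \<Rightarrow> nat) UNIV = n" "sum (type1 g e (n - 1)) UNIV = n" for e
    unfolding sum_type0 sum_type1[OF g] using n by simp_all
  show "?R \<subseteq> gstar_cochar n A" by (intro insert_subsetI empty_subsetI mem sums nz)
qed

lemma gstar_colength_eq:
  assumes n: "n \<ge> 1"
  shows "gstar_colength n A = num_constituents (type0 n) (gstar_char A (type0 n))
    + num_constituents (type1 g Plus (n - 1)) (gstar_char A (type1 g Plus (n - 1)))
    + num_constituents (type1 g Minus (n - 1)) (gstar_char A (type1 g Minus (n - 1)))"
proof -
  have "sum (type0 n :: 'g vtype \<Rightarrow> nat) UNIV = n" "sum (type1 g e (n - 1)) UNIV = n" for e
    unfolding sum_type0 sum_type1[OF g] using n by simp_all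
  then have sub: "{type0 n, type1 g Plus (n - 1), type1 g Minus (n - 1)} \<subseteq> {nn. sum nn UNIV = n}"
    by (intro insert_subsetI empty_subsetI) (simp_all only: mem_Collect_eq)
  have "num_constituents nn (gstar_char A nn) = 0"
    if "nn \<in> {nn. sum nn UNIV = n} - {type0 n, type1 g Plus (n - 1), type1 g Minus (n - 1)}" for nn
  proof -
    have "sum nn UNIV = n" "nn \<notin> {type0 n, type1 g Plus (n - 1), type1 g Minus (n - 1)}"
      using that by (simp_all only: Diff_iff mem_Collect_eq simp_thms)
    then have "gstar_char A nn = (\<lambda>_. 0)" using gstar_char_cases by metis
    then show ?thesis by (simp only: num_constituents_zero)
  qed
  then have "gstar_colength n A = (\<Sum>nn\<in>{type0 n, type1 g Plus (n - 1), type1 g Minus (n - 1)}.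
      num_constituents nn (gstar_char A nn))"
    unfolding gstar_colength_def by (intro sum.mono_neutral_right finite_types sub ballI)
  moreover have "type0 n \<notin> {type1 g Plus (n - 1), type1 g Minus (n - 1)}"
    "type1 g Plus (n - 1) \<notin> {type1 g Minus (n - 1)}"
    using types_distinct[OF g] by (simp_all only: insert_iff empty_iff simp_thms)
  ultimately show ?thesis
    by (simp only: sum.insert finite.emptyI finite_insert empty_iff not_False_eq_True sum.empty add_0_right add.assoc)
qed

end

lemma young_nonzero: "(\<lambda>\<sigma>. if \<sigma> \<in> young_group nn then c \<sigma> else (0 :: 'f::field_char_0)) \<noteq> (\<lambda>_. 0)"
  if "c (\<lambda>_. id) \<noteq> 0"
proof
  assume "(\<lambda>\<sigma>. if \<sigma> \<in> young_group nn then c \<sigma> else 0) = (\<lambda>_. 0)"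
  from fun_cong[OF this, of "\<lambda>_. id"] show False using that young_group_id[of nn] by simp
qed

section \<open>Identification with the listed irreducible characters\<close>

context
  fixes g :: "'g::{finite,ab_group_add}"
  assumes g: "g \<noteq> 0"
begin

lemma mpart_trivial0:
  fixes l :: "'g vtype \<Rightarrow> nat list"
  assumes "n \<ge> 1"
  defines "l \<equiv> (\<lambda>_. [])((0, Plus) := [n])"
  shows "mpart_size l = type0 n" "mpart_char l = (\<lambda>\<sigma>. if \<sigma> \<in> young_group (type0 n) then 1 else (0 :: 'f::field_char_0))"
proof -
  interpret thin_type "type0 n :: 'g vtype \<Rightarrow> nat" by (rule thin_type0)
  have l: "l = trivial" unfolding l_def trivial_def using assms(1) by (auto simp: fun_eq_iff)
  show "mpart_size l = type0 n" by (auto simp: l_def mpart_size_def fun_eq_iff)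
  show "mpart_char l = (\<lambda>\<sigma>. if \<sigma> \<in> young_group (type0 n) then 1 else (0 :: 'f))"
    unfolding l by (rule ext) (rule mpart_char_trivial)
qed

lemma mpart_trivial1:
  fixes l :: "'g vtype \<Rightarrow> nat list" and e :: polarity
  assumes "n \<ge> 1"
  defines "l \<equiv> (\<lambda>_. [])((0, Plus) := [n], (g, e) := [1])"
  shows "mpart_size l = type1 g e n"
    "mpart_char l = (\<lambda>\<sigma>. if \<sigma> \<in> young_group (type1 g e n) then 1 else (0 :: 'f::field_char_0))"
    "l = thin_type.trivial (type1 g e n)"
proof -
  interpret thin_type "type1 g e n" by (rule thin_type1[OF g])
  show l: "l = trivial" unfolding l_def trivial_def using assms(1) by (auto simp: fun_eq_iff)
  show "mpart_size l = type1 g e n" by (auto simp: l_def mpart_size_def fun_eq_iff)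
  show "mpart_char l = (\<lambda>\<sigma>. if \<sigma> \<in> young_group (type1 g e n) then 1 else (0 :: 'f))"
    unfolding l by (rule ext) (rule mpart_char_trivial)
qed

text \<open>The group here is the symmetric group on \<open>n - 1\<close> letters, so
  \<open>[n - 2, 1]\<close> gives its standard representation, and \<open>1 + fix\<close> splits as
  \<open>2 * 1 + (fix - 1)\<close> with \<open>fix\<close> the number of fixed points.\<close>

lemma N3_skew_char:
  assumes n: "n \<ge> 3"
  defines "l3 \<equiv> (\<lambda>_. [])((0, Plus) := [n - 1], (g, Minus) := [1])"
    and "l4 \<equiv> (\<lambda>_. [])((0, Plus) := [n - 2, 1], (g, Minus) := [1])"
  shows "gstar_char (N3 g :: ('f::field_char_0^6^6, 'f, 'g) gstar_alg) (type1 g Minus (n - 1)) =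
      (\<lambda>\<sigma>. 2 * mpart_char l3 \<sigma> + mpart_char l4 \<sigma>)"
    and "num_constituents (type1 g Minus (n - 1)) (\<lambda>\<sigma>. 2 * mpart_char l3 \<sigma> + mpart_char l4 \<sigma> :: 'f) = 3"
proof -
  interpret thin_type "type1 g Minus (n - 1)" by (rule thin_type1[OF g])
  have l3: "l3 = trivial" unfolding l3_def by (rule mpart_trivial1) (use n in simp)
  have parts: "is_partition [n - 2, 1]" "is_partition [1]" "is_partition []" using n by (auto simp: is_partition_def)
  have "mpart_size l4 = type1 g Minus (n - 1)" using n by (auto simp: l4_def mpart_size_def fun_eq_iff)
  then have l4: "l4 \<in> mparts (type1 g Minus (n - 1))" using parts by (auto simp: mparts_def l4_def)
  have l4': "l4 (0, Plus) = [n - 1 - 1, 1]" using g n by (simp add: l4_def numeral_2_eq_2)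
  have type: "type1 g Minus (n - 1) (0, Plus) = n - 1" using g by simp
  show "gstar_char (N3 g :: ('f^6^6, 'f, 'g) gstar_alg) (type1 g Minus (n - 1)) =
      (\<lambda>\<sigma>. 2 * mpart_char l3 \<sigma> + mpart_char l4 \<sigma>)"
  proof
    fix \<sigma>
    show "gstar_char (N3 g :: ('f^6^6, 'f, 'g) gstar_alg) (type1 g Minus (n - 1)) \<sigma> = 2 * mpart_char l3 \<sigma> + mpart_char l4 \<sigma>"
    proof (cases "\<sigma> \<in> young_group (type1 g Minus (n - 1))")
      case True
      then have "\<sigma> (0, Plus) permutes {..<type1 g Minus (n - 1) (0, Plus)}" unfolding young_group_def by blast
      then have perm: "\<sigma> (0, Plus) permutes {..<n - 1}" unfolding type .
      have "2 \<le> n - 1" using n by simp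
      then have "specht_char (l4 (0, Plus)) (\<sigma> (0, Plus)) = (of_nat (card {i. i < n - 1 \<and> \<sigma> (0, Plus) i = i}) - 1 :: 'f)"
        unfolding l4' by (rule specht_char_standard[OF _ perm])
      then show ?thesis
        using True unfolding gstar_char_N3_type1_Minus[OF g] l3 mpart_char_trivial mpart_char_thin[OF l4] by (simp only: if_True) simp
    next
      case False
      then show ?thesis
        unfolding gstar_char_N3_type1_Minus[OF g] l3 mpart_char_trivial mpart_char_thin[OF l4] by (simp only: if_False) simp
    qed
  qed
  show "num_constituents (type1 g Minus (n - 1)) (\<lambda>\<sigma>. 2 * mpart_char l3 \<sigma> + mpart_char l4 \<sigma> :: 'f) = 3"
    unfolding l3 by (rule num_constituents_standard[OF _ l4], unfold type l4') (use n in simp_all)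
qed

end

theorem lemma4p12:
  fixes g :: "'g::{finite,ab_group_add}"
  assumes "g \<noteq> 0"
  shows
    "(gstar_Id (N3 g :: ('f::field_char_0 ^ 6 ^ 6, 'f, 'g) gstar_alg) =
        TGstar_generated
          ({var 0 0 Minus}
           \<union> {var 0 g d * var 1 g e | d e. True}
           \<union> {commutator (var 0 g Plus) (var 0 0 Plus)}
           \<union> {var 0 r e | r e. r \<noteq> 0 \<and> r \<noteq> g})
      \<and> (\<forall>n\<ge>1. gstar_codim n (N3 g :: ('f ^ 6 ^ 6, 'f, 'g) gstar_alg)
                  = 1 + 2 * n + 2 * (n choose 2)))
   \<and> (\<forall>n\<ge>3. gstar_cochar n (N3 g :: ('f ^ 6 ^ 6, 'f, 'g) gstar_alg) =
        (let l1 = (\<lambda>_. [])((0, Plus) := [n]);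
             l2 = (\<lambda>_. [])((0, Plus) := [n - 1], (g, Plus) := [1]);
             l3 = (\<lambda>_. [])((0, Plus) := [n - 1], (g, Minus) := [1]);
             l4 = (\<lambda>_. [])((0, Plus) := [n - 2, 1], (g, Minus) := [1])
         in {(mpart_size l1, mpart_char l1),
             (mpart_size l2, mpart_char l2),
             (mpart_size l3, \<lambda>\<sigma>. 2 * mpart_char l3 \<sigma> + mpart_char l4 \<sigma>)}))
   \<and> (\<forall>n\<ge>2. gstar_cochar n (A2 g :: ('f ^ 4 ^ 4, 'f, 'g) gstar_alg) =
        (let l1 = (\<lambda>_. [])((0, Plus) := [n]);
             l2 = (\<lambda>_. [])((0, Plus) := [n - 1], (g, Plus) := [1]);
             l3 = (\<lambda>_. [])((0, Plus) := [n - 1], (g, Minus) := [1])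
         in {(mpart_size l1, mpart_char l1),
             (mpart_size l2, \<lambda>\<sigma>. 2 * mpart_char l2 \<sigma>),
             (mpart_size l3, \<lambda>\<sigma>. 2 * mpart_char l3 \<sigma>)}))
   \<and> ((\<forall>n\<ge>2. gstar_colength n (A2 g :: ('f ^ 4 ^ 4, 'f, 'g) gstar_alg) = 5)
      \<and> (\<forall>n\<ge>3. gstar_colength n (N3 g :: ('f ^ 6 ^ 6, 'f, 'g) gstar_alg) = 5))"
proof (intro conjI allI impI)
  show "gstar_Id (N3 g :: ('f ^ 6 ^ 6, 'f, 'g) gstar_alg) =
        TGstar_generated
          ({var 0 0 Minus}
           \<union> {var 0 g d * var 1 g e | d e. True}
           \<union> {commutator (var 0 g Plus) (var 0 0 Plus)}
           \<union> {var 0 r e | r e. r \<noteq> 0 \<and> r \<noteq> g})"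
    by (rule gstar_Id_N3_generators[OF assms])
  show "gstar_codim n (N3 g :: ('f ^ 6 ^ 6, 'f, 'g) gstar_alg) = 1 + 2 * n + 2 * (n choose 2)" if "n \<ge> 1" for n
    by (rule gstar_codim_N3[OF assms that])
  interpret N3: relations_algebra g "N3 g :: ('f^6^6, 'f, 'g) gstar_alg"
    by (intro relations_algebra.intro gstar_algebra_N3 assms N3_relations.axioms(1) N3_relations_gstar_Id)
  interpret A2: relations_algebra g "A2 g :: ('f^4^4, 'f, 'g) gstar_alg"
    by (intro relations_algebra.intro gstar_algebra_A2 assms degree_relations_gstar_Id_A2)
  {
    fix n :: nat assume n: "n \<ge> 3"
    then have n1: "n \<ge> 1" "n - 1 \<ge> 1" by auto
    note chars = gstar_char_N3_type0[OF assms n1(1), where 'f = 'f] gstar_char_N3_type1_Plus[OF assms, of "n - 1", where 'f = 'f]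
    have nz: "gstar_char (N3 g :: ('f^6^6, 'f, 'g) gstar_alg) (type0 n) \<noteq> (\<lambda>_. 0)"
      "gstar_char (N3 g :: ('f^6^6, 'f, 'g) gstar_alg) (type1 g e (n - 1)) \<noteq> (\<lambda>_. 0)" for e
    proof -
      show "gstar_char (N3 g :: ('f^6^6, 'f, 'g) gstar_alg) (type0 n) \<noteq> (\<lambda>_. 0)"
        unfolding chars by (rule young_nonzero) simp
      \<comment> \<open>The skew character takes such a value at the identity.\<close>
      have pos: "(1 :: 'f) + of_nat k \<noteq> 0" for k
        unfolding of_nat_Suc[symmetric] of_nat_eq_0_iff by simp
      show "gstar_char (N3 g :: ('f^6^6, 'f, 'g) gstar_alg) (type1 g e (n - 1)) \<noteq> (\<lambda>_. 0)"
      proof (cases e)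
        case Plus
        show ?thesis unfolding Plus chars by (rule young_nonzero) simp
      next
        case Minus
        show ?thesis unfolding Minus gstar_char_N3_type1_Minus[OF assms] by (rule young_nonzero) (rule pos)
      qed
    qed
    show "gstar_cochar n (N3 g :: ('f ^ 6 ^ 6, 'f, 'g) gstar_alg) =
        (let l1 = (\<lambda>_. [])((0, Plus) := [n]);
             l2 = (\<lambda>_. [])((0, Plus) := [n - 1], (g, Plus) := [1]);
             l3 = (\<lambda>_. [])((0, Plus) := [n - 1], (g, Minus) := [1]);
             l4 = (\<lambda>_. [])((0, Plus) := [n - 2, 1], (g, Minus) := [1])
         in {(mpart_size l1, mpart_char l1),
             (mpart_size l2, mpart_char l2),
             (mpart_size l3, \<lambda>\<sigma>. 2 * mpart_char l3 \<sigma> + mpart_char l4 \<sigma>)})"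
      unfolding Let_def N3.gstar_cochar_eq[OF n1(1) nz] chars N3_skew_char(1)[OF assms n]
        mpart_trivial0[OF assms n1(1)] mpart_trivial1(1)[OF assms n1(2)] mpart_trivial1(2)[OF assms n1(2), of Plus] ..
    \<comment> \<open>The three types contribute \<open>1 + 1 + 3\<close>.\<close>
    show "gstar_colength n (N3 g :: ('f ^ 6 ^ 6, 'f, 'g) gstar_alg) = 5"
      unfolding N3.gstar_colength_eq[OF n1(1)] chars N3_skew_char[OF assms n]
      unfolding thin_type.num_constituents_trivial[OF thin_type0[where n = n and 'g = 'g], where k = 1 and 'f = 'f, unfolded of_nat_1]
        thin_type.num_constituents_trivial[OF thin_type1[OF assms, where e = Plus and n = "n - 1"], where k = 1 and 'f = 'f, unfolded of_nat_1]
      by simp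
  }
  {
    fix n :: nat assume n: "n \<ge> 2"
    then have n1: "n \<ge> 1" "n - 1 \<ge> 1" by auto
    note chars = gstar_char_A2_type0[OF assms n1(1), where 'f = 'f] gstar_char_A2_type1[OF assms n1(2), where 'f = 'f]
    have nz: "gstar_char (A2 g :: ('f^4^4, 'f, 'g) gstar_alg) (type0 n) \<noteq> (\<lambda>_. 0)"
      "gstar_char (A2 g :: ('f^4^4, 'f, 'g) gstar_alg) (type1 g e (n - 1)) \<noteq> (\<lambda>_. 0)" for e
      unfolding chars by (rule young_nonzero, simp)+
    have double: "(\<lambda>\<sigma>. 2 * (if \<sigma> \<in> S then 1 else 0 :: 'f)) = (\<lambda>\<sigma>. if \<sigma> \<in> S then 2 else 0)" for S :: "('g vtype \<Rightarrow> nat \<Rightarrow> nat) set"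
      by auto
    show "gstar_cochar n (A2 g :: ('f ^ 4 ^ 4, 'f, 'g) gstar_alg) =
        (let l1 = (\<lambda>_. [])((0, Plus) := [n]);
             l2 = (\<lambda>_. [])((0, Plus) := [n - 1], (g, Plus) := [1]);
             l3 = (\<lambda>_. [])((0, Plus) := [n - 1], (g, Minus) := [1])
         in {(mpart_size l1, mpart_char l1),
             (mpart_size l2, \<lambda>\<sigma>. 2 * mpart_char l2 \<sigma>),
             (mpart_size l3, \<lambda>\<sigma>. 2 * mpart_char l3 \<sigma>)})"
      unfolding Let_def A2.gstar_cochar_eq[OF n1(1) nz] chars
        mpart_trivial0[OF assms n1(1)] mpart_trivial1(1,2)[OF assms n1(2)] double ..
    \<comment> \<open>The three types contribute \<open>1 + 2 + 2\<close>.\<close>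
    show "gstar_colength n (A2 g :: ('f ^ 4 ^ 4, 'f, 'g) gstar_alg) = 5"
      unfolding A2.gstar_colength_eq[OF n1(1)] chars
      unfolding thin_type.num_constituents_trivial[OF thin_type0[where n = n and 'g = 'g], where k = 1 and 'f = 'f, unfolded of_nat_1]
        thin_type.num_constituents_trivial[OF thin_type1[OF assms, where n = "n - 1"], where k = 2 and 'f = 'f, unfolded of_nat_numeral]
      by simp
  }
qed

end
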